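(* Let $\varphi$ and $\psi$ be nonconstant linear fractional self-maps of $\mathbb D$. Then $$\|C_\varphi C_\psi^*\|_{e,\mathcal D}=\begin{cases}0,&\varphi(\mathbb T)\cap\psi(\mathbb T)\cap\mathbb T=\varnothing,\\ 1,&\varphi(\mathbb T)\cap\psi(\mathbb T)\cap\mathbb T\neq\varnothing.\end{cases}$$
   Context: $\mathbb D$ is the open unit disk in $\mathbb C$, $\mathbb T$ is the unit circle, and $dA$ is the normalized area measure on $\mathbb D$. The classical Dirichlet space $\mathcal D=\mathcal D_0$ is the Hilbert space of analytic functions $f$ on $\mathbb D$ with $\|f\|_{\mathcal D}^2=|f(0)|^2+\int_{\mathbb D}|f'(z)|^2\,dA(z)<\infty$, with the associated inner product. A nonconstant linear fractional self-map of $\mathbb D$ is a map $\varphi(z)=\frac{az+b}{cz+d}$ with $ad-bc\neq0$ and $\varphi(\mathbb D)\subset\mathbb D$; it extends analytically to a neighborhood of $\overline{\mathbb D}$, and $\varphi(\mathbb T)$ is the image of $\mathbb T$ under this extension. The composition operator is $C_\varphi f=f\circ\varphi$; for such $\varphi$ it is bounded on $\mathcal D$. $C_\psi^*$ is the Hilbert space adjoint of $C_\psi$ on $\mathcal D$. For a bounded operator $T$ on a Hilbert space $\mathcal H$, the essential norm is $\|T\|_{e,\mathcal H}=\inf\{\|T-K\|:K\text{ compact on }\mathcal H\}$. *)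

theory Defs
  imports "HOL-Complex_Analysis.Complex_Analysis"
begin

section \<open>The Dirichlet space\<close>

abbreviation unit_disk :: "complex set" (\<open>\<DD>\<close>)
  where "\<DD> \<equiv> ball 0 1"

abbreviation unit_circle :: "complex set" (\<open>\<TT>\<close>)
  where "\<TT> \<equiv> sphere 0 1"

text \<open>
  HOL functions are total, so an analytic function on the disk is represented by its
  extension by 0.  This makes equality in the type the same as equality on the disk.
\<close>

definition dirichlet_functions :: "(complex \<Rightarrow> complex) set" where
  "dirichlet_functions =
     {f. f holomorphic_on \<DD> \<and> (\<forall>z. z \<notin> \<DD> \<longrightarrow> f z = 0) \<and>
         set_integrable lborel \<DD> (\<lambda>z. (cmod (deriv f z))\<^sup>2)}"

lemma dirichlet_functions_zero: "(\<lambda>_. 0) \<in> dirichlet_functions"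
  by (auto simp: dirichlet_functions_def set_integrable_def)

lemma dirichlet_deriv_measurable:
  assumes "f \<in> dirichlet_functions"
  shows "set_borel_measurable lborel \<DD> (deriv f)"
proof -
  have "continuous_on \<DD> (deriv f)"
    using assms by (auto simp: dirichlet_functions_def
        intro!: holomorphic_on_imp_continuous_on holomorphic_deriv)
  then show ?thesis
    by (simp add: set_borel_measurable_def borel_measurable_continuous_on_indicator)
qed

lemma dirichlet_deriv_integrable:
  assumes f: "f \<in> dirichlet_functions" and g: "g \<in> dirichlet_functions"
  shows "set_integrable lborel \<DD> (\<lambda>z. deriv f z * cnj (deriv g z))"
proof -
  let ?u = "\<lambda>z. (cmod (deriv f z))\<^sup>2 + (cmod (deriv g z))\<^sup>2"
  have i: "set_integrable lborel \<DD> ?u"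
    using f g by (auto simp: dirichlet_functions_def intro!: set_integral_add)
  have "set_borel_measurable lborel \<DD> (\<lambda>z. deriv f z * cnj (deriv g z))"
  proof -
    have "(\<lambda>z. (indicator \<DD> z *\<^sub>R deriv f z) * cnj (indicator \<DD> z *\<^sub>R deriv g z))
        \<in> borel_measurable lborel"
      using dirichlet_deriv_measurable[OF f] dirichlet_deriv_measurable[OF g]
      unfolding set_borel_measurable_def
      by (intro borel_measurable_times borel_measurable_continuous_on[of cnj])
         (auto intro: continuous_intros)
    also have "(\<lambda>z. (indicator \<DD> z *\<^sub>R deriv f z) * cnj (indicator \<DD> z *\<^sub>R deriv g z))
        = (\<lambda>z. indicator \<DD> z *\<^sub>R (deriv f z * cnj (deriv g z)))"
      by (auto simp: fun_eq_iff indicator_def)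
    finally show ?thesis
      by (simp add: set_borel_measurable_def)
  qed
  moreover have "cmod (deriv f z * cnj (deriv g z)) \<le> norm (?u z)" for z
  proof -
    have "2 * (cmod (deriv f z) * cmod (deriv g z)) \<le> ?u z"
      using sum_squares_bound[of "cmod (deriv f z)" "cmod (deriv g z)"] by simp
    moreover have "0 \<le> cmod (deriv f z) * cmod (deriv g z)"
      by simp
    ultimately have "cmod (deriv f z) * cmod (deriv g z) \<le> ?u z"
      by linarith
    then show ?thesis
      by (simp add: norm_mult)
  qed
  ultimately show ?thesis
    using i by (intro set_integrable_bound[OF i]) auto
qed

lemma dirichlet_deriv_add:
  assumes "f \<in> dirichlet_functions" "g \<in> dirichlet_functions" "z \<in> \<DD>"
  shows "deriv (\<lambda>z. f z + g z) z = deriv f z + deriv g z"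
  using assms by (intro deriv_add)
    (auto simp: dirichlet_functions_def holomorphic_on_imp_differentiable_at)

lemma dirichlet_deriv_scale:
  assumes "f \<in> dirichlet_functions" "z \<in> \<DD>"
  shows "deriv (\<lambda>z. c * f z) z = c * deriv f z"
  using assms by (intro deriv_cmult)
    (auto simp: dirichlet_functions_def holomorphic_on_imp_differentiable_at)

lemma dirichlet_functions_add:
  assumes f: "f \<in> dirichlet_functions" and g: "g \<in> dirichlet_functions"
  shows "(\<lambda>z. f z + g z) \<in> dirichlet_functions"
proof -
  let ?F = "\<lambda>z. deriv f z * cnj (deriv f z) + deriv f z * cnj (deriv g z)
               + (deriv g z * cnj (deriv f z) + deriv g z * cnj (deriv g z))"
  have "set_integrable lborel \<DD> ?F"
    by (intro set_integral_add dirichlet_deriv_integrable f g)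
  then have "set_integrable lborel \<DD> (\<lambda>z. norm (?F z))"
    by (rule set_integrable_norm)
  also have "?this \<longleftrightarrow>
      set_integrable lborel \<DD> (\<lambda>z. (cmod (deriv (\<lambda>z. f z + g z) z))\<^sup>2)"
  proof (rule set_integrable_cong)
    fix z assume "z \<in> \<DD>"
    have "?F z = (deriv f z + deriv g z) * cnj (deriv f z + deriv g z)"
      by (simp add: algebra_simps)
    also have "\<dots> = of_real ((cmod (deriv f z + deriv g z))\<^sup>2)"
      by (simp only: complex_norm_square)
    finally show "norm (?F z) = (cmod (deriv (\<lambda>z. f z + g z) z))\<^sup>2"
      using dirichlet_deriv_add[OF f g \<open>z \<in> \<DD>\<close>] by (simp only: norm_of_real) simp
  qed simp_all
  finally show ?thesis
    using f g by (auto simp: dirichlet_functions_def intro!: holomorphic_intros)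
qed

lemma dirichlet_functions_scale:
  assumes f: "f \<in> dirichlet_functions"
  shows "(\<lambda>z. c * f z) \<in> dirichlet_functions"
proof -
  have "set_integrable lborel \<DD> (\<lambda>z. (cmod c)\<^sup>2 * (cmod (deriv f z))\<^sup>2)"
    using f by (auto simp: dirichlet_functions_def)
  also have "?this \<longleftrightarrow> set_integrable lborel \<DD> (\<lambda>z. (cmod (deriv (\<lambda>z. c * f z) z))\<^sup>2)"
    by (rule set_integrable_cong)
       (simp_all add: dirichlet_deriv_scale[OF f] norm_mult power_mult_distrib)
  finally show ?thesis
    using f by (auto simp: dirichlet_functions_def intro!: holomorphic_intros)
qed

typedef dirichlet = dirichlet_functions
  morphisms dirichlet_fun Abs_dirichlet
  using dirichlet_functions_zero by blast

setup_lifting type_definition_dirichlet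

lift_definition scale_dirichlet :: "complex \<Rightarrow> dirichlet \<Rightarrow> dirichlet"
  is "\<lambda>c f z. c * f z"
  by (rule dirichlet_functions_scale)

text \<open>The area measure is normalized, whence the factor \<open>1/\<pi>\<close>.\<close>

lift_definition dirichlet_cinner :: "dirichlet \<Rightarrow> dirichlet \<Rightarrow> complex"
  is "\<lambda>f g. f 0 * cnj (g 0)
        + (1 / pi) *\<^sub>R (LINT z:\<DD>|lborel. deriv f z * cnj (deriv g z))" .

lemma dirichlet_cinner_self:
  "dirichlet_cinner f f = complex_of_real ((cmod (dirichlet_fun f 0))\<^sup>2
     + (1 / pi) * (LINT z:\<DD>|lborel. (cmod (deriv (dirichlet_fun f) z))\<^sup>2))"
proof transfer
  fix f
  have "(LINT z:\<DD>|lborel. deriv f z * cnj (deriv f z))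
      = (LINT z:\<DD>|lborel. complex_of_real ((cmod (deriv f z))\<^sup>2))"
    by (simp only: complex_norm_square)
  also have "\<dots> = complex_of_real (LINT z:\<DD>|lborel. (cmod (deriv f z))\<^sup>2)"
    by (rule set_integral_complex_of_real)
  finally show "f 0 * cnj (f 0) + (1 / pi) *\<^sub>R (LINT z:\<DD>|lborel. deriv f z * cnj (deriv f z))
      = complex_of_real ((cmod (f 0))\<^sup>2 + (1 / pi) * (LINT z:\<DD>|lborel. (cmod (deriv f z))\<^sup>2))"
    using complex_norm_square[of "f 0"] by (simp add: scaleR_conv_of_real)
qed

lemma dirichlet_integral_zero:
  assumes f: "f \<in> dirichlet_functions"
    and 0: "(LINT z:\<DD>|lborel. (cmod (deriv f z))\<^sup>2) = 0" and "f 0 = 0"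
  shows "f = (\<lambda>_. 0)"
proof
  fix z
  have hol: "f holomorphic_on \<DD>"
    using f by (simp add: dirichlet_functions_def)
  let ?h = "\<lambda>z. indicator \<DD> z *\<^sub>R (cmod (deriv f z))\<^sup>2"
  have "AE z in lborel. ?h z = 0"
    using f 0 integral_nonneg_eq_0_iff_AE[of lborel ?h]
    by (simp add: dirichlet_functions_def set_integrable_def set_lebesgue_integral_def)
  then have ae: "AE z in lborel. z \<notin> {z \<in> \<DD>. deriv f z \<noteq> 0}"
    by eventually_elim (auto split: split_indicator_asm)
  have "open {z \<in> \<DD>. deriv f z \<noteq> 0}"
  proof -
    have "continuous_on \<DD> (deriv f)"
      using hol by (auto intro!: holomorphic_on_imp_continuous_on holomorphic_deriv)
    then have "open (\<DD> \<inter> deriv f -` (- {0}))"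
      by (subst (asm) continuous_on_open_vimage) (auto simp: Int_commute)
    then show ?thesis
      by (simp add: vimage_def Int_def)
  qed
  moreover from this have "{z \<in> \<DD>. deriv f z \<noteq> 0} \<in> null_sets lborel"
    using ae by (subst AE_iff_null_sets) auto
  then have "negligible {z \<in> \<DD>. deriv f z \<noteq> 0}"
    by (simp add: negligible_iff_null_sets null_sets_completionI)
  ultimately have "{z \<in> \<DD>. deriv f z \<noteq> 0} = {}"
    using open_not_negligible by blast
  then have "\<And>w. w \<in> \<DD> \<Longrightarrow> (f has_field_derivative 0) (at w within \<DD>)"
    using hol by (metis (mono_tags, lifting) Collect_empty_eq centre_in_ball
        has_field_derivative_at_within holomorphic_derivI open_ball)
  then obtain c where "\<And>w. w \<in> \<DD> \<Longrightarrow> f w = c"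
    using has_field_derivative_zero_constant[of \<DD> f] by auto
  moreover have "\<And>w. w \<notin> \<DD> \<Longrightarrow> f w = 0"
    using f by (simp add: dirichlet_functions_def)
  ultimately show "f z = 0"
    using \<open>f 0 = 0\<close> by (metis centre_in_ball zero_less_one)
qed

instantiation dirichlet :: real_vector
begin

lift_definition zero_dirichlet :: dirichlet is "\<lambda>_. 0"
  by (rule dirichlet_functions_zero)

lift_definition plus_dirichlet :: "dirichlet \<Rightarrow> dirichlet \<Rightarrow> dirichlet"
  is "\<lambda>f g z. f z + g z"
  by (rule dirichlet_functions_add)

lift_definition uminus_dirichlet :: "dirichlet \<Rightarrow> dirichlet" is "\<lambda>f z. - f z"
  subgoal for f using dirichlet_functions_scale[of f "-1"] by simp
  done

lift_definition minus_dirichlet :: "dirichlet \<Rightarrow> dirichlet \<Rightarrow> dirichlet"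
  is "\<lambda>f g z. f z - g z"
  subgoal for f g
    using dirichlet_functions_add[OF _ dirichlet_functions_scale[of g "-1"], of f] by simp
  done

lift_definition scaleR_dirichlet :: "real \<Rightarrow> dirichlet \<Rightarrow> dirichlet"
  is "\<lambda>r f z. r *\<^sub>R f z"
  subgoal for r f using dirichlet_functions_scale[of f "of_real r"]
    by (simp add: scaleR_conv_of_real)
  done

instance
proof
  fix f g h :: dirichlet and r s :: real
  show "f + g + h = f + (g + h)" by transfer (simp add: add.assoc)
  show "f + g = g + f" by transfer (simp add: add.commute)
  show "0 + f = f" by transfer simp
  show "- f + f = 0" by transfer simp
  show "f - g = f + - g" by transfer simp
  show "r *\<^sub>R (f + g) = r *\<^sub>R f + r *\<^sub>R g" by transfer (simp add: scaleR_add_right)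
  show "(r + s) *\<^sub>R f = r *\<^sub>R f + s *\<^sub>R f" by transfer (simp add: scaleR_add_left)
  show "r *\<^sub>R s *\<^sub>R f = (r * s) *\<^sub>R f" by transfer simp
  show "1 *\<^sub>R f = f" by transfer simp
qed

end

instantiation dirichlet :: real_inner
begin

definition inner_dirichlet :: "dirichlet \<Rightarrow> dirichlet \<Rightarrow> real"
  where "inner_dirichlet f g = Re (dirichlet_cinner f g)"

definition norm_dirichlet :: "dirichlet \<Rightarrow> real"
  where "norm_dirichlet f = sqrt (inner f f)"

definition dist_dirichlet :: "dirichlet \<Rightarrow> dirichlet \<Rightarrow> real"
  where "dist_dirichlet f g = norm (f - g)"

definition sgn_dirichlet :: "dirichlet \<Rightarrow> dirichlet"
  where "sgn_dirichlet f = f /\<^sub>R norm f"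

definition uniformity_dirichlet :: "(dirichlet \<times> dirichlet) filter"
  where "uniformity_dirichlet = (INF e\<in>{0<..}. principal {(f, g). dist f g < e})"

definition open_dirichlet :: "dirichlet set \<Rightarrow> bool"
  where "open_dirichlet U \<longleftrightarrow>
    (\<forall>f\<in>U. eventually (\<lambda>(f', g). f' = f \<longrightarrow> g \<in> U) uniformity)"

instance
proof
  fix f g h :: dirichlet and r :: real and U :: "dirichlet set"
  show "dist f g = norm (f - g)" by (rule dist_dirichlet_def)
  show "sgn f = f /\<^sub>R norm f" by (rule sgn_dirichlet_def)
  show "uniformity = (INF e\<in>{0<..}. principal {(f, g :: dirichlet). dist f g < e})"
    by (rule uniformity_dirichlet_def)
  show "open U = (\<forall>f\<in>U. eventually (\<lambda>(f', g). f' = f \<longrightarrow> g \<in> U) uniformity)"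
    by (rule open_dirichlet_def)
  show "norm f = sqrt (inner f f)" by (rule norm_dirichlet_def)
  show "inner f g = inner g f"
  proof -
    have "dirichlet_cinner g f = cnj (dirichlet_cinner f g)"
    proof transfer
      fix f g
      have "(LINT z:\<DD>|lborel. deriv g z * cnj (deriv f z))
          = cnj (LINT z:\<DD>|lborel. deriv f z * cnj (deriv g z))"
        by (simp add: set_lebesgue_integral_def mult.commute
            flip: Bochner_Integration.integral_cnj)
      then show "g 0 * cnj (f 0) + (1 / pi) *\<^sub>R (LINT z:\<DD>|lborel. deriv g z * cnj (deriv f z))
        = cnj (f 0 * cnj (g 0) + (1 / pi) *\<^sub>R (LINT z:\<DD>|lborel. deriv f z * cnj (deriv g z)))"
        by (simp add: mult.commute)
    qed
    then show ?thesis by (simp add: inner_dirichlet_def)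
  qed
  show "inner (f + g) h = inner f h + inner g h"
  proof -
    have "dirichlet_cinner (f + g) h = dirichlet_cinner f h + dirichlet_cinner g h"
    proof transfer
      fix f g h
      assume f: "f \<in> dirichlet_functions" and g: "g \<in> dirichlet_functions"
        and h: "h \<in> dirichlet_functions"
      have "(LINT z:\<DD>|lborel. deriv (\<lambda>z. f z + g z) z * cnj (deriv h z))
          = (LINT z:\<DD>|lborel. deriv f z * cnj (deriv h z) + deriv g z * cnj (deriv h z))"
        by (rule set_lebesgue_integral_cong)
           (auto simp: dirichlet_deriv_add[OF f g] algebra_simps)
      also have "\<dots> = (LINT z:\<DD>|lborel. deriv f z * cnj (deriv h z))
          + (LINT z:\<DD>|lborel. deriv g z * cnj (deriv h z))"
        by (intro set_integral_add dirichlet_deriv_integrable f g h)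
      finally show "(f 0 + g 0) * cnj (h 0)
          + (1 / pi) *\<^sub>R (LINT z:\<DD>|lborel. deriv (\<lambda>z. f z + g z) z * cnj (deriv h z))
        = f 0 * cnj (h 0) + (1 / pi) *\<^sub>R (LINT z:\<DD>|lborel. deriv f z * cnj (deriv h z))
        + (g 0 * cnj (h 0) + (1 / pi) *\<^sub>R (LINT z:\<DD>|lborel. deriv g z * cnj (deriv h z)))"
        by (simp add: algebra_simps)
    qed
    then show ?thesis by (simp add: inner_dirichlet_def)
  qed
  show "inner (r *\<^sub>R f) g = r * inner f g"
  proof -
    have "dirichlet_cinner (r *\<^sub>R f) g = r *\<^sub>R dirichlet_cinner f g"
    proof transfer
      fix r :: real and f g
      assume f: "f \<in> dirichlet_functions"
      have "(LINT z:\<DD>|lborel. deriv (\<lambda>z. r *\<^sub>R f z) z * cnj (deriv g z))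
          = (LINT z:\<DD>|lborel. of_real r * (deriv f z * cnj (deriv g z)))"
        by (rule set_lebesgue_integral_cong)
           (auto simp: scaleR_conv_of_real dirichlet_deriv_scale[OF f])
      then show "r *\<^sub>R f 0 * cnj (g 0)
          + (1 / pi) *\<^sub>R (LINT z:\<DD>|lborel. deriv (\<lambda>z. r *\<^sub>R f z) z * cnj (deriv g z))
        = r *\<^sub>R (f 0 * cnj (g 0) + (1 / pi) *\<^sub>R (LINT z:\<DD>|lborel. deriv f z * cnj (deriv g z)))"
        by (simp add: scaleR_conv_of_real algebra_simps)
    qed
    then show ?thesis by (simp add: inner_dirichlet_def)
  qed
  have int_nonneg: "0 \<le> (LINT z:\<DD>|lborel. (cmod (deriv (dirichlet_fun f) z))\<^sup>2)"
    by (simp add: set_lebesgue_integral_def)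
  then show "0 \<le> inner f f"
    by (simp add: inner_dirichlet_def dirichlet_cinner_self)
  show "inner f f = 0 \<longleftrightarrow> f = 0"
  proof
    assume "inner f f = 0"
    moreover have "0 \<le> (1 / pi) * (LINT z:\<DD>|lborel. (cmod (deriv (dirichlet_fun f) z))\<^sup>2)"
      using int_nonneg by simp
    ultimately have "(cmod (dirichlet_fun f 0))\<^sup>2 = 0"
      and "(1 / pi) * (LINT z:\<DD>|lborel. (cmod (deriv (dirichlet_fun f) z))\<^sup>2) = 0"
      unfolding inner_dirichlet_def dirichlet_cinner_self Re_complex_of_real
      by (smt (verit) zero_le_power2)+
    then have "dirichlet_fun f = (\<lambda>_. 0)"
      by (intro dirichlet_integral_zero dirichlet_fun) auto
    then show "f = 0"
      by transfer
  next
    assume "f = 0"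
    then have "dirichlet_fun f = (\<lambda>_. 0)"
      by transfer
    then show "inner f f = 0"
      by (simp add: inner_dirichlet_def dirichlet_cinner_self set_lebesgue_integral_def)
  qed
qed

end

lemma norm_dirichlet_square:
  "(norm f)\<^sup>2 = (cmod (dirichlet_fun f 0))\<^sup>2
     + (1 / pi) * (LINT z:\<DD>|lborel. (cmod (deriv (dirichlet_fun f) z))\<^sup>2)"
  by (simp add: dot_square_norm[symmetric] inner_dirichlet_def dirichlet_cinner_self)


section \<open>Operators on the Dirichlet space\<close>

definition clinear_dirichlet :: "(dirichlet \<Rightarrow> dirichlet) \<Rightarrow> bool" where
  "clinear_dirichlet T \<longleftrightarrow>
     (\<forall>f g. T (f + g) = T f + T g) \<and>
     (\<forall>c f. T (scale_dirichlet c f) = scale_dirichlet c (T f))"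

definition compact_operator :: "(dirichlet \<Rightarrow> dirichlet) \<Rightarrow> bool" where
  "compact_operator K \<longleftrightarrow> clinear_dirichlet K \<and> compact (closure (K ` cball 0 1))"

text \<open>
  To be used for bounded \<open>T\<close> only: the library's \<^const>\<open>onorm\<close> is the operator norm of a
  bounded linear map, and is unspecified on unbounded ones.
\<close>

definition essential_norm :: "(dirichlet \<Rightarrow> dirichlet) \<Rightarrow> real" where
  "essential_norm T = (INF K\<in>{K. compact_operator K}. onorm (\<lambda>f. T f - K f))"

text \<open>
  The library's \<^const>\<open>adjoint\<close> refers to the real inner product; this is the adjoint with
  respect to the complex one.
\<close>

definition hilbert_adjoint :: "(dirichlet \<Rightarrow> dirichlet) \<Rightarrow> dirichlet \<Rightarrow> dirichlet" where
  "hilbert_adjoint T =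
     (THE S. \<forall>f g. dirichlet_cinner (T f) g = dirichlet_cinner f (S g))"

text \<open>
  \<^const>\<open>Abs_dirichlet\<close> is meaningful on members of \<^const>\<open>dirichlet_functions\<close> only.  For a
  linear fractional self-map \<open>\<phi>\<close> (which is univalent) \<open>f \<circ> \<phi>\<close> is again in the Dirichlet space.
\<close>

definition composition_operator :: "(complex \<Rightarrow> complex) \<Rightarrow> dirichlet \<Rightarrow> dirichlet" where
  "composition_operator \<phi> f =
     Abs_dirichlet (\<lambda>z. if z \<in> \<DD> then dirichlet_fun f (\<phi> z) else 0)"

text \<open>
  The map is given by its formula on the whole plane, not only on the disk, so that \<open>\<phi> ` \<TT>\<close> is
  the image of the circle under the analytic extension.  The pole lies outside the closed disk:
  it is excluded from the disk explicitly, and from the circle because \<open>\<phi>\<close> is bounded on the disk.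
\<close>

definition linear_fractional_self_map :: "(complex \<Rightarrow> complex) \<Rightarrow> bool" where
  "linear_fractional_self_map \<phi> \<longleftrightarrow>
     (\<exists>a b c d. a * d - b * c \<noteq> 0 \<and> (\<forall>z\<in>\<DD>. c * z + d \<noteq> 0) \<and>
        \<phi> = (\<lambda>z. (a * z + b) / (c * z + d)) \<and> \<phi> ` \<DD> \<subseteq> \<DD>)"

end

theory Submission
  imports Defs
begin

text \<open>
  Up to operators of finite rank, the product of \<open>C\<^sub>\<phi>\<close> with the adjoint of \<open>C\<^sub>\<psi>\<close> is again a composition
  operator.  For \<open>\<psi> z = (a z + b) / (c z + d)\<close> let \<open>\<sigma>\<close> be the Krein adjoint
  \<open>\<sigma> z = (cnj a z - cnj c) / (- cnj b z + cnj d)\<close>, which is also a self-map of the disk.  Then the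
  adjoint of \<open>C\<^sub>\<psi>\<close> maps \<open>g\<close> to \<open>g 0 \<cdot> k + (g \<circ> \<sigma> - g (\<sigma> 0))\<close>, where \<open>k\<close> is the reproducing kernel at \<open>\<psi> 0\<close>
  (\<open>hilbert_adjoint_composition\<close>).  Consequently the essential norm in question is that of
  \<open>C\<^sub>\<tau>\<close> with \<open>\<tau> = \<sigma> \<circ> \<phi>\<close>.  Since \<open>\<sigma>\<close> is \<open>\<psi>\<^sup>-\<^sup>1\<close> conjugated by the reflection in the circle, \<open>\<tau>\<close> maps a point
  of the circle to the circle if and only if \<open>\<phi>\<close> maps that point to a point of the circle which also
  lies in \<open>\<psi> ` \<TT>\<close> (\<open>krein_adjoint_unimodular_iff\<close>).  It remains to determine the essential norm of a single
  composition operator \<open>C\<^sub>\<tau>\<close> (\<open>essential_norm_composition_operator\<close>).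

  If \<open>\<tau>\<close> maps the closed disk into the open disk, then \<open>C\<^sub>\<tau>\<close> is compact by Montel's theorem.  In any
  case \<open>\<tau>\<close> is univalent, so that the energy of \<open>f \<circ> \<tau>\<close> is the energy of \<open>f\<close> over the image of \<open>\<tau>\<close>;
  therefore \<open>C\<^sub>\<tau>\<close> is a contraction up to the rank one operator \<open>f \<mapsto> f (\<tau> 0)\<close>, and its essential
  norm is at most 1.  If \<open>\<tau>\<close> takes a value \<open>\<zeta>\<close> of modulus 1 on the circle, then its image is a disk
  internally tangent to the circle at \<open>\<zeta>\<close>.  Suitably normalized disk automorphisms whose energy
  concentrates at \<open>\<zeta>\<close> lose nothing of their energy, in the limit, by restriction to this disk
  (\<open>peak_energy_tangent_disk\<close>), and their images under \<open>C\<^sub>\<tau>\<close> tend weakly to 0.  No compact operator can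
  then approximate \<open>C\<^sub>\<tau>\<close> to within less than 1.

  The formula for the adjoint rests on the identity \<open>adjoint_identity\<close> for derivatives, which lie in the
  Bergman space.  When \<open>\<psi>\<close> maps into a smaller disk, it follows from the Bergman reproducing
  formula by exchanging two integrals, because \<open>\<sigma>\<close> is made to satisfy the right identity of kernels
  (\<open>kernel_identity\<close>).  The general case is a weak limit of this one.  The reproducing formula itself
  comes from the mean value property by a change of variables with a disk automorphism.
\<close>

unbundle no fps_syntax

section \<open>Change of variables for holomorphic maps\<close>

definition complex_of_vec :: "real^2 \<Rightarrow> complex"
  where "complex_of_vec v = Complex (v $ 1) (v $ 2)"

definition vec_of_complex :: "complex \<Rightarrow> real^2"
  where "vec_of_complex z = (\<chi> i. if i = 1 then Re z else Im z)"

lemma vec_of_complex_nth [simp]: "vec_of_complex z $ 1 = Re z" "vec_of_complex z $ 2 = Im z"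
  by (simp_all add: vec_of_complex_def)

lemma complex_of_vec_sel [simp]: "Re (complex_of_vec v) = v $ 1" "Im (complex_of_vec v) = v $ 2"
  by (simp_all add: complex_of_vec_def)

lemma complex_vec_inverse [simp]:
  "complex_of_vec (vec_of_complex z) = z" "vec_of_complex (complex_of_vec v) = v"
  by (simp_all add: complex_eq_iff vec_eq_iff forall_2)

lemma bounded_linear_vec_of_complex: "bounded_linear vec_of_complex"
  by (intro linear_conv_bounded_linear[THEN iffD1] linearI)
     (simp_all add: vec_eq_iff forall_2)

lemma bounded_linear_complex_of_vec: "bounded_linear complex_of_vec"
  by (intro linear_conv_bounded_linear[THEN iffD1] linearI)
     (simp_all add: complex_eq_iff)

lemma vimage_complex_of_vec: "complex_of_vec -` S = vec_of_complex ` S"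
  by (auto simp: image_iff) (metis complex_vec_inverse(2))

lemma measurable_complex_of_vec [measurable]: "complex_of_vec \<in> borel \<rightarrow>\<^sub>M borel"
  by (intro borel_measurable_continuous_onI linear_continuous_on bounded_linear_complex_of_vec)

lemma lborel_complex_eq: "(lborel :: complex measure) = distr lborel borel complex_of_vec"
proof (rule lborel_eqI)
  fix l u :: complex
  assume le: "\<And>b. b \<in> Basis \<Longrightarrow> l \<bullet> b \<le> u \<bullet> b"
  have "complex_of_vec -` box l u = box (vec_of_complex l) (vec_of_complex u)"
    by (auto simp: box_def Basis_complex_def Basis_vec_def inner_axis complex_of_vec_def forall_2)
  moreover have "emeasure lborel (box (vec_of_complex l) (vec_of_complex u)) = (\<Prod>b\<in>Basis. (u - l) \<bullet> b)"
  proof (subst emeasure_lborel_box)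
    have B: "(Basis :: (real^2) set) = {axis 1 1, axis 2 1}"
      by (auto simp: Basis_vec_def forall_2) (metis exhaust_2)
    show "vec_of_complex l \<bullet> b \<le> vec_of_complex u \<bullet> b" if "b \<in> Basis" for b
      using that le[of 1] le[of \<i>] by (auto simp: B inner_axis Basis_complex_def)
    have "axis 1 1 \<noteq> (axis 2 1 :: real^2)"
      by (simp add: axis_eq_axis)
    then show "ennreal (\<Prod>b\<in>Basis. (vec_of_complex u - vec_of_complex l) \<bullet> b) = (\<Prod>b\<in>Basis. (u - l) \<bullet> b)"
      by (simp add: B inner_axis Basis_complex_def)
  qed
  ultimately show "emeasure (distr lborel borel complex_of_vec) (box l u) = (\<Prod>b\<in>Basis. (u - l) \<bullet> b)"
    by (simp add: emeasure_distr)
qed simp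

lemma set_integral_lborel_complex_as_vec:
  fixes h :: "complex \<Rightarrow> complex"
  assumes h: "continuous_on S h" and S: "open S"
  shows "set_integrable lborel S h \<longleftrightarrow>
           (\<lambda>v. vec_of_complex (h (complex_of_vec v))) absolutely_integrable_on (vec_of_complex ` S)"
    and "set_integrable lborel S h \<Longrightarrow>
           integral (vec_of_complex ` S) (\<lambda>v. vec_of_complex (h (complex_of_vec v)))
             = vec_of_complex (set_lebesgue_integral lborel S h)"
proof -
  let ?F = "\<lambda>z. indicator S z *\<^sub>R h z" and ?S = "vec_of_complex ` S"
  let ?G = "\<lambda>v. indicator ?S v *\<^sub>R vec_of_complex (h (complex_of_vec v))"
  have F: "?F \<in> borel_measurable borel"
    using h S by (intro borel_measurable_continuous_on_indicator) auto
  have GF: "?G = (\<lambda>v. vec_of_complex (?F (complex_of_vec v)))"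
    using bounded_linear.linear[OF bounded_linear_vec_of_complex]
    by (auto simp: fun_eq_iff indicator_def linear_0 simp flip: vimage_complex_of_vec)
  have G: "?G \<in> borel_measurable borel"
    unfolding GF using F
    by (intro measurable_compose[OF _ borel_measurable_continuous_onI[OF
        linear_continuous_on[OF bounded_linear_vec_of_complex]]] measurable_compose[OF _ F]) measurable
  have FG: "(\<lambda>v. ?F (complex_of_vec v)) = (\<lambda>v. complex_of_vec (?G v))"
    using bounded_linear.linear[OF bounded_linear_complex_of_vec]
    by (auto simp: fun_eq_iff indicator_def linear_0 simp flip: vimage_complex_of_vec)
  have 1: "set_integrable lborel S h \<longleftrightarrow> integrable lborel (\<lambda>v. ?F (complex_of_vec v))"
    unfolding set_integrable_def
    by (subst lborel_complex_eq, subst integrable_distr_eq) (use F in auto)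
  have 2: "integrable lborel (\<lambda>v. ?F (complex_of_vec v)) \<longleftrightarrow> integrable lborel ?G"
  proof
    assume "integrable lborel (\<lambda>v. ?F (complex_of_vec v))"
    from integrable_bounded_linear[OF bounded_linear_vec_of_complex this]
    show "integrable lborel ?G" unfolding GF .
  next
    assume "integrable lborel ?G"
    from integrable_bounded_linear[OF bounded_linear_complex_of_vec this]
    show "integrable lborel (\<lambda>v. ?F (complex_of_vec v))" unfolding FG .
  qed
  have 3: "?G absolutely_integrable_on UNIV \<longleftrightarrow> integrable lborel ?G"
    unfolding set_integrable_def using G by (simp add: integrable_completion)
  show I: "set_integrable lborel S h \<longleftrightarrow>
           (\<lambda>v. vec_of_complex (h (complex_of_vec v))) absolutely_integrable_on ?S"
    unfolding 1 2 3[symmetric] by (simp add: set_integrable_def)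
  assume i: "set_integrable lborel S h"
  have "integral ?S (\<lambda>v. vec_of_complex (h (complex_of_vec v)))
      = (LINT v:?S|lebesgue. vec_of_complex (h (complex_of_vec v)))"
    using i I by (intro set_lebesgue_integral_eq_integral(2)[symmetric]) simp
  also have "\<dots> = (LINT v|lborel. ?G v)"
    unfolding set_lebesgue_integral_def using G by (simp add: integral_completion)
  also have "\<dots> = vec_of_complex (LINT v|lborel. ?F (complex_of_vec v))"
    unfolding GF using i 1
    by (intro integral_bounded_linear[OF bounded_linear_vec_of_complex]) simp
  also have "(LINT v|lborel. ?F (complex_of_vec v)) = set_lebesgue_integral lborel S h"
    unfolding set_lebesgue_integral_def
    using integral_distr[of complex_of_vec lborel borel ?F] F
    by (simp add: measurable_complex_of_vec flip: lborel_complex_eq)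
  finally show "integral ?S (\<lambda>v. vec_of_complex (h (complex_of_vec v)))
     = vec_of_complex (set_lebesgue_integral lborel S h)" .
qed

lemma det_complex_multiplication:
  "\<bar>det (matrix (\<lambda>v. vec_of_complex (w * complex_of_vec v)))\<bar> = (cmod w)\<^sup>2"
  by (simp add: det_2 matrix_def axis_def complex_of_vec_def cmod_power2 flip: power2_eq_square)

text \<open>
  This is the change of variables theorem in \<open>real^2\<close>, carried over to the complex plane by the
  isometry that identifies the two Lebesgue measures; the Jacobian of an injective holomorphic map becomes \<open>|m'|\<^sup>2\<close>.  Continuity of the integrand
  makes it Borel measurable, so that integrals over the completed measure agree with those over
  \<^const>\<open>lborel\<close>.
\<close>

lemma holomorphic_change_of_variables:
  fixes h :: "complex \<Rightarrow> complex"
  assumes S: "open S" and m: "m holomorphic_on S" "inj_on m S" and h: "continuous_on (m ` S) h"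
  shows "set_integrable lborel (m ` S) h \<longleftrightarrow>
           set_integrable lborel S (\<lambda>z. (cmod (deriv m z))\<^sup>2 *\<^sub>R h (m z))"
    and "set_integrable lborel (m ` S) h \<Longrightarrow>
           (LINT z:m ` S|lborel. h z) = (LINT z:S|lborel. (cmod (deriv m z))\<^sup>2 *\<^sub>R h (m z))"
proof -
  let ?g = "\<lambda>v. vec_of_complex (m (complex_of_vec v))"
  let ?g' = "\<lambda>v u. vec_of_complex (deriv m (complex_of_vec v) * complex_of_vec u)"
  let ?f = "\<lambda>v. vec_of_complex (h (complex_of_vec v))"
  let ?k = "\<lambda>z. (cmod (deriv m z))\<^sup>2 *\<^sub>R h (m z)"
  let ?S = "vec_of_complex ` S"
  have oI: "open (m ` S)"
    using open_mapping_thm3[OF m(1) S m(2)] .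
  have ck: "continuous_on S ?k"
    using S m h by (intro continuous_intros holomorphic_on_imp_continuous_on holomorphic_deriv
      continuous_on_compose2[OF h]) auto
  have gS: "?g ` ?S = vec_of_complex ` m ` S"
    by (auto simp: image_iff)
  have der: "(?g has_derivative ?g' v) (at v within ?S)" if "v \<in> ?S" for v
  proof -
    have v: "complex_of_vec v \<in> S" using that by auto
    have "(m has_derivative (*) (deriv m (complex_of_vec v))) (at (complex_of_vec v))"
      using holomorphic_derivI[OF m(1) S v] by (simp add: has_field_derivative_def)
    then have "((\<lambda>v. m (complex_of_vec v)) has_derivative (\<lambda>u. deriv m (complex_of_vec v) * complex_of_vec u)) (at v)"
      by (rule has_derivative_compose[OF bounded_linear.has_derivative[OF bounded_linear_complex_of_vec has_derivative_ident]])
    then show ?thesis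
      by (rule has_derivative_at_withinI[OF bounded_linear.has_derivative[OF bounded_linear_vec_of_complex]])
  qed
  have "open ?S"
    unfolding vimage_complex_of_vec[symmetric]
    by (intro open_vimage S linear_continuous_on bounded_linear_complex_of_vec)
  then have SL: "?S \<in> sets lebesgue" by simp
  have inj: "inj_on ?g ?S"
    using m(2) by (auto simp: inj_on_def) (metis complex_vec_inverse(1))
  note cov = has_absolute_integral_change_of_variables[OF SL der inj, of ?f]
  have lhs: "(\<lambda>v. \<bar>det (matrix (?g' v))\<bar> *\<^sub>R ?f (?g v)) = (\<lambda>v. vec_of_complex (?k (complex_of_vec v)))"
    using bounded_linear.linear[OF bounded_linear_vec_of_complex]
    by (simp add: det_complex_multiplication linear_cmul fun_eq_iff)
  note cov = cov[unfolded lhs gS]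
  note A = set_integral_lborel_complex_as_vec[OF h oI]
  note B = set_integral_lborel_complex_as_vec[OF ck S]
  show I: "set_integrable lborel (m ` S) h \<longleftrightarrow> set_integrable lborel S ?k"
    unfolding A(1) B(1) using cov by blast
  assume i: "set_integrable lborel (m ` S) h"
  with I have i': "set_integrable lborel S ?k" by simp
  have "vec_of_complex (LINT z:m ` S|lborel. h z) = vec_of_complex (LINT z:S|lborel. ?k z)"
    using cov A(1) B(1) A(2)[OF i] B(2)[OF i'] i i' by metis
  then show "(LINT z:m ` S|lborel. h z) = (LINT z:S|lborel. ?k z)"
    by (metis complex_vec_inverse(1))
qed

section \<open>Linear fractional maps\<close>

definition moebius :: "complex \<Rightarrow> complex \<Rightarrow> complex \<Rightarrow> complex \<Rightarrow> complex \<Rightarrow> complex"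
  where "moebius a b c d z = (a * z + b) / (c * z + d)"

text \<open>
  For \<open>|c| < |d|\<close> the right-hand side is positive in the disk and vanishes on the circle.  Hence
  \<open>z \<mapsto> (cnj d * z + cnj c) / (c * z + d)\<close> maps the disk to itself and the circle to itself.
  By \<open>moebius_minus_center\<close> below, every linear fractional map without pole in the closed disk is
  this self-map followed by an affine map.
\<close>

lemma cmod_conjugate_pair_diff:
  "(cmod (c * z + d))\<^sup>2 - (cmod (cnj d * z + cnj c))\<^sup>2 = ((cmod d)\<^sup>2 - (cmod c)\<^sup>2) * (1 - (cmod z)\<^sup>2)"
  unfolding cmod_power2 by (simp add: power2_eq_square algebra_simps)

lemma moebius_denominator_nonzero:
  assumes "cmod c < cmod d" "cmod z \<le> 1"
  shows "c * z + d \<noteq> 0"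
proof
  assume "c * z + d = 0"
  then have "cmod (c * z) = cmod d"
    by (metis add_eq_0_iff norm_minus_cancel)
  moreover have "cmod (c * z) \<le> cmod c"
    using assms(2) by (simp add: norm_mult mult_left_le)
  ultimately show False using assms(1) by simp
qed

lemma moebius_has_field_derivative:
  assumes "c * z + d \<noteq> 0"
  shows "(moebius a b c d has_field_derivative (a * d - b * c) / (c * z + d)\<^sup>2) (at z)"
  unfolding moebius_def [abs_def]
  by (rule derivative_eq_intros refl assms)+ (simp add: field_simps power2_eq_square assms)

lemma deriv_moebius: "c * z + d \<noteq> 0 \<Longrightarrow> deriv (moebius a b c d) z = (a * d - b * c) / (c * z + d)\<^sup>2"
  by (rule DERIV_imp_deriv[OF moebius_has_field_derivative])

lemma moebius_holomorphic:
  assumes "\<And>z. z \<in> S \<Longrightarrow> c * z + d \<noteq> 0"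
  shows "moebius a b c d holomorphic_on S"
  unfolding moebius_def [abs_def] using assms by (auto intro!: holomorphic_intros)

lemma moebius_inj_on:
  assumes "\<And>z. z \<in> S \<Longrightarrow> c * z + d \<noteq> 0" and "a * d - b * c \<noteq> 0"
  shows "inj_on (moebius a b c d) S"
proof (rule inj_onI)
  fix z w assume zw: "z \<in> S" "w \<in> S" "moebius a b c d z = moebius a b c d w"
  then have "(a * z + b) * (c * w + d) = (a * w + b) * (c * z + d)"
    using assms(1) by (simp add: moebius_def frac_eq_eq)
  then have "(a * d - b * c) * (z - w) = 0" by (simp add: algebra_simps)
  then show "z = w" using assms(2) by simp
qed

lemma moebius_minus_center:
  assumes "cmod c < cmod d" and z: "c * z + d \<noteq> 0"
  shows "moebius a b c d z - (b * cnj d - a * cnj c) / of_real ((cmod d)\<^sup>2 - (cmod c)\<^sup>2)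
       = (a * d - b * c) / of_real ((cmod d)\<^sup>2 - (cmod c)\<^sup>2) * ((cnj d * z + cnj c) / (c * z + d))"
proof -
  have N: "of_real ((cmod d)\<^sup>2 - (cmod c)\<^sup>2) = d * cnj d - c * cnj c"
    by (simp only: of_real_diff complex_norm_square)
  have "(cmod d)\<^sup>2 - (cmod c)\<^sup>2 \<noteq> 0"
    using assms(1) power_strict_mono[of "cmod c" "cmod d" 2] by simp
  then have "d * cnj d - c * cnj c \<noteq> 0"
    using N by (metis of_real_eq_0_iff)
  then show ?thesis using z unfolding N moebius_def
    by (simp add: divide_simps) (simp add: algebra_simps)
qed

text \<open>
  By the previous lemma the map is the affine image of a map of the disk onto itself; the inverse of
  the latter has the same form, with \<open>-c\<close> and \<open>cnj d\<close> in place of \<open>c\<close> and \<open>d\<close>.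
\<close>

lemma moebius_image_disk:
  assumes cd: "cmod c < cmod d" and det: "a * d - b * c \<noteq> 0"
  defines "N \<equiv> (cmod d)\<^sup>2 - (cmod c)\<^sup>2"
  shows "moebius a b c d ` \<DD> = ball ((b * cnj d - a * cnj c) / of_real N) (cmod (a * d - b * c) / N)"
    (is "_ = ball ?p ?r")
proof -
  have N: "N > 0"
    unfolding N_def using cd power_strict_mono[of "cmod c" "cmod d" 2] by simp
  have less: "cmod (cnj e * z + cnj c') < cmod (c' * z + e)" if "cmod c' < cmod e" "cmod z < 1" for c' e z
  proof -
    have "(cmod z)\<^sup>2 < 1" "(cmod c')\<^sup>2 < (cmod e)\<^sup>2"
      using that power_strict_mono[of "cmod c'" "cmod e" 2] by (auto simp: abs_square_less_1)
    then have "((cmod e)\<^sup>2 - (cmod c')\<^sup>2) * (1 - (cmod z)\<^sup>2) > 0" by simp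
    then show ?thesis
      using cmod_conjugate_pair_diff[of c' z e]
        power2_less_imp_less[of "cmod (cnj e * z + cnj c')" "cmod (c' * z + e)"] by simp
  qed
  have dist: "dist ?p (moebius a b c d z) = ?r * cmod ((cnj d * z + cnj c) / (c * z + d))"
    if "cmod z < 1" for z
    using moebius_minus_center[OF cd, of z a b] moebius_denominator_nonzero[OF cd, of z] that N
    by (subst dist_commute) (simp add: dist_norm N_def[symmetric] norm_mult norm_divide del: of_real_diff)
  show ?thesis
  proof (intro equalityI subsetI)
    fix y assume "y \<in> moebius a b c d ` \<DD>"
    then obtain z where z: "y = moebius a b c d z" "cmod z < 1" by auto
    have "cmod ((cnj d * z + cnj c) / (c * z + d)) < 1"
      using less[OF cd z(2)] by (simp add: norm_divide divide_less_eq)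
    then have "?r * cmod ((cnj d * z + cnj c) / (c * z + d)) < ?r * 1"
      using N det by (intro mult_strict_left_mono) auto
    then show "y \<in> ball ?p ?r" using dist[OF z(2)] z by simp
  next
    fix y assume y: "y \<in> ball ?p ?r"
    define v where "v = (y - ?p) * of_real N / (a * d - b * c)"
    have v: "cmod v < 1"
    proof -
      define q where "q = y - ?p"
      have "cmod q < ?r" using y by (simp add: q_def dist_norm norm_minus_commute)
      then have "cmod q * N < cmod (a * d - b * c)" using N by (simp add: pos_less_divide_eq)
      then show ?thesis
        using N det by (simp add: v_def norm_mult norm_divide divide_less_eq flip: q_def)
    qed
    define z where "z = (d * v + - cnj c) / (cnj d + - c * v)"
    have nz: "cnj d + - c * v \<noteq> 0"
      using moebius_denominator_nonzero[of "-c" "cnj d" v] cd v by (simp add: add.commute)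
    have z: "cmod z < 1"
      using less[of "-c" "cnj d" v] cd v nz by (simp add: z_def norm_divide divide_less_eq add.commute)
    have nz2: "c * z + d \<noteq> 0" using moebius_denominator_nonzero[OF cd, of z] z by simp
    have Nc: "of_real N = d * cnj d - c * cnj c" "complex_of_real N \<noteq> 0"
      using N by (simp only: N_def of_real_diff complex_norm_square, simp)
    have "(cnj d * z + cnj c) = v * (c * z + d)"
      using nz by (simp add: z_def divide_simps) (simp add: algebra_simps)
    then have "(cnj d * z + cnj c) / (c * z + d) = v" using nz2 by simp
    then have "moebius a b c d z - ?p = (a * d - b * c) / of_real N * v"
      using moebius_minus_center[OF cd nz2] by (simp add: N_def)
    also have "\<dots> = y - ?p" using Nc(2) det by (simp add: v_def)
    finally show "y \<in> moebius a b c d ` \<DD>" using z by auto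
  qed
qed

section \<open>Square-integrable holomorphic functions on the disk\<close>

text \<open>
  The Bergman space of the disk, with no condition on the values outside the disk.  It contains
  the derivatives of the functions of the Dirichlet space.
\<close>

definition bergman_functions :: "(complex \<Rightarrow> complex) set" where
  "bergman_functions =
     {F. F holomorphic_on \<DD> \<and> set_integrable lborel \<DD> (\<lambda>z. (cmod (F z))\<^sup>2)}"

lemma bergman_functionsD:
  assumes "F \<in> bergman_functions"
  shows "F holomorphic_on \<DD>" "set_integrable lborel \<DD> (\<lambda>z. (cmod (F z))\<^sup>2)"
    "continuous_on \<DD> F"
  using assms holomorphic_on_imp_continuous_on by (auto simp: bergman_functions_def)

lemma finite_measure_disk [simp]: "emeasure lborel \<DD> \<noteq> top" "emeasure lborel \<DD> < \<infinity>"
  using emeasure_bounded_finite[of "\<DD>"] by auto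

lemma measure_lborel_ball: "0 \<le> r \<Longrightarrow> measure lborel (ball (c::complex) r) = pi * r\<^sup>2"
  using content_ball[of r c] unit_ball_vol_even[of 1] by simp

lemma set_borel_measurable_continuous:
  fixes h :: "complex \<Rightarrow> 'a::real_normed_vector"
  shows "continuous_on S h \<Longrightarrow> S \<in> sets borel \<Longrightarrow> set_borel_measurable lborel S h"
  by (simp add: set_borel_measurable_def borel_measurable_continuous_on_indicator)

lemma set_integrable_bounded_continuous:
  fixes h :: "complex \<Rightarrow> 'a::{banach, second_countable_topology}"
  assumes "continuous_on \<DD> h" "\<And>z. z \<in> \<DD> \<Longrightarrow> norm (h z) \<le> B"
  shows "set_integrable lborel \<DD> h"
proof (rule set_integrable_bound)
  show "set_integrable lborel \<DD> (\<lambda>_. B)"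
    unfolding set_integrable_def using finite_measure_disk(2)
    by (intro integrable_scaleR_left) (simp add: integrable_indicator_iff)
  show "set_borel_measurable lborel \<DD> h"
    using assms by (intro set_borel_measurable_continuous) auto
  show "AE x in lborel. x \<in> \<DD> \<longrightarrow> norm (h x) \<le> norm B"
    using assms(2) by (intro AE_I2) (force simp: abs_if)
qed

lemma bounded_holomorphic_in_bergman:
  assumes "F holomorphic_on \<DD>" "\<And>z. z \<in> \<DD> \<Longrightarrow> cmod (F z) \<le> B"
  shows "F \<in> bergman_functions"
  unfolding bergman_functions_def using assms
  by (auto intro!: set_integrable_bounded_continuous[of _ "B\<^sup>2"] continuous_intros
      holomorphic_on_imp_continuous_on power_mono)

text \<open>
  The weight \<open>t\<close> lets one of two factors be merely bounded in square mean while the other one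
  is small; this replaces the Cauchy-Schwarz inequality for integrals.
\<close>

lemma mult_le_weighted_squares:
  fixes x y t :: real
  assumes "t > 0"
  shows "x * y \<le> (t * x\<^sup>2 + y\<^sup>2 / t) / 2"
proof -
  have "0 \<le> (t * x - y)\<^sup>2 / t" using assms by simp
  also have "\<dots> = t * x\<^sup>2 + y\<^sup>2 / t - 2 * (x * y)"
    using assms by (simp add: power2_eq_square field_simps)
  finally show ?thesis by simp
qed

lemma square_integrable_product:
  fixes F G :: "complex \<Rightarrow> complex"
  assumes "S \<in> sets borel" "continuous_on S F" "continuous_on S G"
    "set_integrable lborel S (\<lambda>z. (cmod (F z))\<^sup>2)" "set_integrable lborel S (\<lambda>z. (cmod (G z))\<^sup>2)"
  shows "set_integrable lborel S (\<lambda>z. F z * cnj (G z))"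
proof (rule set_integrable_bound)
  show "set_integrable lborel S (\<lambda>z. (cmod (F z))\<^sup>2 + (cmod (G z))\<^sup>2)"
    using assms by (intro set_integral_add)
  show "set_borel_measurable lborel S (\<lambda>z. F z * cnj (G z))"
    using assms by (intro set_borel_measurable_continuous continuous_on_mult continuous_on_cnj)
  have "cmod (F z * cnj (G z)) \<le> norm ((cmod (F z))\<^sup>2 + (cmod (G z))\<^sup>2)" for z
  proof -
    have "0 \<le> cmod (F z) * cmod (G z)" by simp
    then have "cmod (F z) * cmod (G z) \<le> (cmod (F z))\<^sup>2 + (cmod (G z))\<^sup>2"
      using sum_squares_bound[of "cmod (F z)" "cmod (G z)"] unfolding mult.assoc by linarith
    then show ?thesis by (simp add: norm_mult)
  qed
  then show "AE x in lborel. x \<in> S \<longrightarrow> cmod (F x * cnj (G x)) \<le> norm ((cmod (F x))\<^sup>2 + (cmod (G x))\<^sup>2)"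
    by simp
qed

lemma bergman_product_integrable:
  assumes "F \<in> bergman_functions" "G \<in> bergman_functions"
  shows "set_integrable lborel \<DD> (\<lambda>z. F z * cnj (G z))"
  using assms by (intro square_integrable_product bergman_functionsD) auto

lemma bergman_integrable:
  assumes "F \<in> bergman_functions"
  shows "set_integrable lborel \<DD> F"
  using bergman_product_integrable[OF assms bounded_holomorphic_in_bergman[of "\<lambda>_. 1" 1]] by simp

lemma bergman_diff:
  assumes "F \<in> bergman_functions" "G \<in> bergman_functions"
  shows "(\<lambda>z. F z - G z) \<in> bergman_functions"
    and "(LINT z:\<DD>|lborel. (cmod (F z - G z))\<^sup>2)
       \<le> 2 * (LINT z:\<DD>|lborel. (cmod (F z))\<^sup>2) + 2 * (LINT z:\<DD>|lborel. (cmod (G z))\<^sup>2)"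
proof -
  let ?u = "\<lambda>z. 2 * (cmod (F z))\<^sup>2 + 2 * (cmod (G z))\<^sup>2"
  have u: "set_integrable lborel \<DD> ?u"
    using assms bergman_functionsD by (intro set_integral_add) auto
  have le: "(cmod (F z - G z))\<^sup>2 \<le> ?u z" for z
  proof -
    have "(cmod (F z - G z))\<^sup>2 \<le> (cmod (F z) + cmod (G z))\<^sup>2"
      by (intro power_mono norm_triangle_ineq4) auto
    also have "\<dots> \<le> ?u z"
      using sum_squares_bound[of "cmod (F z)" "cmod (G z)"] by (simp add: power2_sum)
    finally show ?thesis .
  qed
  have i: "set_integrable lborel \<DD> (\<lambda>z. (cmod (F z - G z))\<^sup>2)"
    using le assms bergman_functionsD(3)
    by (intro set_integrable_bound[OF u] set_borel_measurable_continuous continuous_intros AE_I2)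
       auto
  then show "(\<lambda>z. F z - G z) \<in> bergman_functions"
    using assms by (auto simp: bergman_functions_def intro!: holomorphic_intros)
  have "(LINT z:\<DD>|lborel. (cmod (F z - G z))\<^sup>2) \<le> (LINT z:\<DD>|lborel. ?u z)"
    using i u le by (intro set_integral_mono)
  also have "\<dots> = 2 * (LINT z:\<DD>|lborel. (cmod (F z))\<^sup>2) + 2 * (LINT z:\<DD>|lborel. (cmod (G z))\<^sup>2)"
    using assms bergman_functionsD by (subst set_integral_add) auto
  finally show "(LINT z:\<DD>|lborel. (cmod (F z - G z))\<^sup>2)
       \<le> 2 * (LINT z:\<DD>|lborel. (cmod (F z))\<^sup>2) + 2 * (LINT z:\<DD>|lborel. (cmod (G z))\<^sup>2)" .
qed

lemma integral_disk_exhaustion: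
  fixes h :: "complex \<Rightarrow> 'a::{banach, second_countable_topology}"
  assumes "set_integrable lborel \<DD> h"
  shows "(\<lambda>n. LINT z:ball 0 (1 - inverse (real (Suc n)))|lborel. h z) \<longlonglongrightarrow> (LINT z:\<DD>|lborel. h z)"
proof -
  let ?B = "\<lambda>n. ball (0::complex) (1 - inverse (real (Suc n)))"
  have U: "(\<Union>n. ?B n) = \<DD>"
  proof (intro equalityI subsetI)
    fix z :: complex assume "z \<in> \<DD>"
    then have "0 < 1 - cmod z" by simp
    then obtain n where "inverse (real (Suc n)) < 1 - cmod z"
      using reals_Archimedean by blast
    then have "z \<in> ?B n" by simp
    then show "z \<in> (\<Union>n. ?B n)" by blast
  next
    fix z :: complex assume "z \<in> (\<Union>n. ?B n)"
    then obtain n where "cmod z < 1 - inverse (real (Suc n))" by auto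
    also have "\<dots> < 1" by simp
    finally show "z \<in> \<DD>" by simp
  qed
  have inc: "incseq ?B"
    by (intro incseq_SucI subset_ball) (simp add: field_simps)
  show ?thesis
    using set_integral_cont_up[of ?B lborel h] assms inc unfolding U by simp
qed

text \<open>
  Rotation by the angle \<open>\<pi> / n\<close> preserves the disk and changes the sign of \<open>z ^ n\<close>.
\<close>

lemma integral_power_disk_zero:
  assumes "n > 0"
  shows "(LINT z:\<DD>|lborel. z ^ n) = (0::complex)"
proof -
  let ?I = "LINT z:\<DD>|lborel. z ^ n"
  let ?c = "cis (pi / n)"
  have im: "(\<lambda>z. ?c * z) ` \<DD> = \<DD>"
  proof (intro equalityI subsetI)
    fix y :: complex assume "y \<in> \<DD>"
    then have "y = ?c * (cnj ?c * y)" "cnj ?c * y \<in> \<DD>"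
      by (simp_all add: norm_mult cis_cnj cis_mult flip: mult.assoc)
    then show "y \<in> (\<lambda>z. ?c * z) ` \<DD>" by blast
  qed (auto simp: norm_mult)
  have "?I = (LINT z:\<DD>|lborel. (cmod (deriv (\<lambda>z. ?c * z) z))\<^sup>2 *\<^sub>R (?c * z) ^ n)"
    using holomorphic_change_of_variables(2)[of \<DD> "\<lambda>z. ?c * z" "\<lambda>z. z ^ n"] unfolding im
    by (rule, auto intro!: holomorphic_intros continuous_intros inj_onI set_integrable_bounded_continuous[of _ 1]
       simp: norm_power power_le_one)
  also have "\<dots> = (LINT z:\<DD>|lborel. ?c ^ n * z ^ n)"
    by (simp add: power_mult_distrib)
  also have "\<dots> = ?c ^ n * ?I" by simp
  also have "?c ^ n = -1" using assms by (simp add: Complex.DeMoivre)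
  finally show ?thesis by simp
qed

text \<open>
  Only the constant term of the Taylor series survives integration; the series may be integrated
  termwise because it converges absolutely beyond the unit circle.
\<close>

lemma mean_value_disk_of_larger_disk:
  fixes H :: "complex \<Rightarrow> complex"
  assumes H: "H holomorphic_on ball 0 R" and R: "R > 1"
  shows "(LINT z:\<DD>|lborel. H z) = pi * H 0"
proof -
  define a where "a n = (deriv ^^ n) H 0 / fact n" for n
  have s: "(\<lambda>n. a n * z ^ n) sums H z" if "cmod z < R" for z
    using holomorphic_power_series[OF H, of z] that by (simp add: a_def)
  obtain R' where R': "1 < R'" "R' < R" using R dense by blast
  have "summable (\<lambda>n. a n * (of_real R') ^ n)"
    using s[of "of_real R'"] R' by (auto intro: sums_summable)
  then have sa: "summable (\<lambda>n. cmod (a n))"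
    using powser_insidea[of a "of_real R'" 1] R' by simp
  let ?f = "\<lambda>n z. indicator \<DD> z *\<^sub>R (a n * z ^ n)"
  have int: "integrable lborel (?f n)" for n
    by (rule set_integrable_bounded_continuous[of _ "cmod (a n)", unfolded set_integrable_def])
       (auto simp: norm_mult norm_power mult_left_le power_le_one intro!: continuous_intros)
  have nb: "norm (?f n z) \<le> indicator \<DD> z * cmod (a n)" for n z
    by (auto simp: indicator_def norm_mult norm_power mult_left_le power_le_one)
  have "(\<lambda>n. integral\<^sup>L lborel (?f n)) sums (LINT z|lborel. (\<Sum>n. ?f n z))"
  proof (rule sums_integral[OF int])
    show "AE z in lborel. summable (\<lambda>n. norm (?f n z))"
      by (intro AE_I2 summable_comparison_test'[OF sa, of 0])
        (auto simp: indicator_def norm_mult norm_power mult_left_le power_le_one)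
    have le: "(LINT z|lborel. norm (?f n z)) \<le> pi * cmod (a n)" for n
    proof -
      have "(LINT z|lborel. norm (?f n z)) \<le> (LINT z|lborel. indicator \<DD> z *\<^sub>R cmod (a n))"
        using nb int finite_measure_disk(2)
        by (intro integral_mono integrable_norm integrable_scaleR_left)
           (auto simp: integrable_indicator_iff)
      also have "\<dots> = pi * cmod (a n)"
        using set_integral_const[of \<DD> lborel "cmod (a n)"] measure_lborel_ball[of 1 0]
        by (simp add: set_lebesgue_integral_def)
      finally show ?thesis .
    qed
    show "summable (\<lambda>n. LINT z|lborel. norm (?f n z))"
      by (rule summable_comparison_test'[OF summable_mult[OF sa, of pi], of 0]) (use le in auto)
  qed
  also have "(\<lambda>z. \<Sum>n. ?f n z) = (\<lambda>z. indicator \<DD> z *\<^sub>R H z)"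
    using s R by (auto simp: fun_eq_iff indicator_def intro!: sums_unique[symmetric])
  finally have "(\<lambda>n. LINT z:\<DD>|lborel. a n * z ^ n) sums (LINT z:\<DD>|lborel. H z)"
    unfolding set_lebesgue_integral_def .
  moreover have "(\<lambda>n. LINT z:\<DD>|lborel. a n * z ^ n) sums (LINT z:\<DD>|lborel. a 0 * z ^ 0)"
    using sums_finite[of "{0}" "\<lambda>n. LINT z:\<DD>|lborel. a n * z ^ n"] integral_power_disk_zero by simp
  moreover have "(LINT z:\<DD>|lborel. a 0 * z ^ 0) = pi * H 0"
    using set_integral_const[of \<DD> lborel "a 0"] measure_lborel_ball[of 1 0]
    by (simp add: a_def scaleR_conv_of_real)
  ultimately show ?thesis using sums_unique2 by metis
qed

text \<open>
  A function that is merely integrable is dilated first, and the radius then tends to 1.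
\<close>

lemma mean_value_disk:
  fixes H :: "complex \<Rightarrow> complex"
  assumes H: "H holomorphic_on \<DD>" and i: "set_integrable lborel \<DD> H"
  shows "(LINT z:\<DD>|lborel. H z) = pi * H 0"
proof (rule LIMSEQ_unique[OF integral_disk_exhaustion[OF i]])
  have eq: "(LINT z:ball 0 s|lborel. H z) = of_real (s\<^sup>2) * (pi * H 0)" if s: "0 < s" "s < 1" for s
  proof -
    let ?m = "\<lambda>z. of_real s * z"
    have im: "?m ` \<DD> = ball 0 s"
    proof (intro equalityI subsetI)
      fix y :: complex assume "y \<in> ball 0 s"
      then have "y = ?m (y / of_real s)" "y / of_real s \<in> \<DD>"
        using s by (simp_all add: norm_divide)
      then show "y \<in> ?m ` \<DD>" by blast
    qed (use s in \<open>auto simp: norm_mult\<close>)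
    have sub: "?m z \<in> \<DD>" if "cmod z < 1 / s" for z
      using that s by (auto simp: norm_mult field_simps)
    have hol: "(\<lambda>z. H (?m z)) holomorphic_on ball 0 (1 / s)"
      using sub by (intro holomorphic_on_compose_gen[of ?m _ H \<DD>, unfolded o_def] H holomorphic_intros) auto
    have i: "set_integrable lborel (?m ` \<DD>) H"
      unfolding im by (rule set_integrable_subset[OF i]) (use s in auto)
    have "(LINT z:?m ` \<DD>|lborel. H z) = (LINT z:\<DD>|lborel. (cmod (deriv ?m z))\<^sup>2 *\<^sub>R H (?m z))"
      using s H i
      by (intro holomorphic_change_of_variables(2) holomorphic_intros)
         (auto intro!: inj_onI continuous_on_subset[OF holomorphic_on_imp_continuous_on[OF H]] simp: im)
    also have "\<dots> = s\<^sup>2 *\<^sub>R (LINT z:\<DD>|lborel. H (?m z))"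
      using s by simp
    also have "(LINT z:\<DD>|lborel. H (?m z)) = pi * H 0"
      using mean_value_disk_of_larger_disk[OF hol] s by simp
    finally show ?thesis unfolding im by (simp add: scaleR_conv_of_real)
  qed
  have "(\<lambda>n. of_real ((1 - inverse (real (Suc n)))\<^sup>2) * (pi * H 0)) \<longlonglongrightarrow> of_real ((1 - 0)\<^sup>2) * (pi * H 0)"
    by (intro tendsto_intros LIMSEQ_inverse_real_of_nat)
  moreover have "\<forall>\<^sub>F n in sequentially. of_real ((1 - inverse (real (Suc n)))\<^sup>2) * (pi * H 0)
       = (LINT z:ball 0 (1 - inverse (real (Suc n)))|lborel. H z)"
    using eventually_gt_at_top[of 0]
    by eventually_elim (rule eq[symmetric], auto simp: inverse_less_1_iff)
  ultimately show "(\<lambda>n. LINT z:ball 0 (1 - inverse (real (Suc n)))|lborel. H z) \<longlonglongrightarrow> pi * H 0"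
    by (auto elim: Lim_transform_eventually)
qed

section \<open>The Bergman kernel\<close>

lemma holomorphic_change_of_variables_real:
  fixes h :: "complex \<Rightarrow> real"
  assumes S: "open S" and m: "m holomorphic_on S" "inj_on m S" and h: "continuous_on (m ` S) h"
    and i: "set_integrable lborel (m ` S) h"
  shows "set_integrable lborel S (\<lambda>z. (cmod (deriv m z))\<^sup>2 * h (m z))"
    and "(LINT z:m ` S|lborel. h z) = (LINT z:S|lborel. (cmod (deriv m z))\<^sup>2 * h (m z))"
proof -
  let ?h = "\<lambda>z. complex_of_real (h z)"
  let ?k = "\<lambda>z. (cmod (deriv m z))\<^sup>2 * h (m z)"
  have c: "continuous_on (m ` S) ?h" using h by (intro continuous_intros)
  have of_real: "set_integrable lborel A (\<lambda>z. complex_of_real (g z)) \<longleftrightarrow> set_integrable lborel A g"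
    for A :: "complex set" and g
    unfolding set_integrable_def
    using complex_of_real_integrable_eq[of lborel "\<lambda>x. indicator A x * g x"]
    by (simp add: scaleR_conv_of_real)
  note cov = holomorphic_change_of_variables[OF S m c]
  have eq: "(\<lambda>z. (cmod (deriv m z))\<^sup>2 *\<^sub>R ?h (m z)) = (\<lambda>z. complex_of_real (?k z))"
    by (simp add: scaleR_conv_of_real)
  show "set_integrable lborel S ?k"
    using cov(1) i unfolding eq of_real by simp
  have "complex_of_real (LINT z:m ` S|lborel. h z) = complex_of_real (LINT z:S|lborel. ?k z)"
    using cov(2) i unfolding eq of_real by (simp only: set_integral_complex_of_real)
  then show "(LINT z:m ` S|lborel. h z) = (LINT z:S|lborel. ?k z)"
    by (simp only: of_real_eq_iff)
qed

lemma set_integrable_mult_bounded: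
  fixes F K :: "complex \<Rightarrow> complex"
  assumes "set_integrable lborel S F" "continuous_on S F" "continuous_on S K"
    "\<And>z. z \<in> S \<Longrightarrow> cmod (K z) \<le> B" "S \<in> sets borel"
  shows "set_integrable lborel S (\<lambda>z. F z * K z)"
proof (rule set_integrable_bound)
  show "set_integrable lborel S (\<lambda>z. of_real B * F z)"
    using assms by (intro set_integrable_mult_right)
  show "set_borel_measurable lborel S (\<lambda>z. F z * K z)"
    using assms by (intro set_borel_measurable_continuous continuous_on_mult)
  have "cmod (F z * K z) \<le> cmod (of_real B * F z)" if "z \<in> S" for z
  proof -
    have "cmod (K z) \<le> \<bar>B\<bar>" using assms(4)[OF that] by simp
    then have "cmod (K z) * cmod (F z) \<le> \<bar>B\<bar> * cmod (F z)"
      by (rule mult_right_mono) simp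
    then show ?thesis by (simp add: norm_mult mult.commute)
  qed
  then show "AE x in lborel. x \<in> S \<longrightarrow> cmod (F x * K x) \<le> cmod (of_real B * F x)" by simp
qed

lemma kernel_denominator_bound:
  assumes "cmod w \<le> q" "q < 1" "cmod z \<le> 1"
  shows "1 - w * cnj z \<noteq> 0" "cmod (1 / (1 - w * cnj z)) \<le> 1 / (1 - q)"
proof -
  have "cmod (w * cnj z) \<le> q"
    using assms by (simp add: norm_mult) (metis mult_left_le norm_ge_zero order_trans)
  then have le: "1 - q \<le> cmod (1 - w * cnj z)"
    using norm_triangle_ineq2[of 1 "w * cnj z"] by simp
  with assms(2) show "1 - w * cnj z \<noteq> 0" by auto
  show "cmod (1 / (1 - w * cnj z)) \<le> 1 / (1 - q)"
    using le assms(2) by (simp add: norm_divide divide_left_mono mult_pos_pos frac_le)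
qed

text \<open>
  The substitution \<open>z = \<alpha> u\<close>, where \<open>\<alpha>\<close> is the automorphism of the disk with \<open>\<alpha> 0 = w\<close>, turns the
  integrand into \<open>F (\<alpha> u) * \<alpha>' u / (1 - |w|\<^sup>2)\<close>: the kernel absorbs exactly the conjugate half of the
  Jacobian \<open>|\<alpha>'|\<^sup>2\<close>.  The mean value property then evaluates the integral at \<open>u = 0\<close>.
\<close>

lemma bergman_reproducing:
  fixes F :: "complex \<Rightarrow> complex"
  assumes F: "F holomorphic_on \<DD>" "set_integrable lborel \<DD> F" and w: "w \<in> \<DD>"
  shows "(LINT z:\<DD>|lborel. F z / (1 - w * cnj z)\<^sup>2) = pi * F w"
proof -
  let ?m = "moebius 1 w (cnj w) 1"
  let ?h = "\<lambda>z. F z / (1 - w * cnj z)\<^sup>2"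
  define k where "k = 1 - w * cnj w"
  have w1: "cmod w < 1" using w by simp
  have kr: "k = of_real (1 - (cmod w)\<^sup>2)" by (simp only: k_def of_real_diff of_real_1 complex_norm_square)
  have pos: "1 - (cmod w)\<^sup>2 > 0" using w1 by (simp add: abs_square_less_1)
  have k0: "k \<noteq> 0" unfolding kr using pos by (metis less_irrefl of_real_eq_0_iff)
  have nz: "cnj w * u + 1 \<noteq> 0" if "u \<in> \<DD>" for u
    using moebius_denominator_nonzero[of "cnj w" 1 u] w1 that by simp
  have nk: "cmod k = 1 - (cmod w)\<^sup>2" unfolding kr norm_of_real using pos by simp
  have im: "?m ` \<DD> = \<DD>"
    using moebius_image_disk[of "cnj w" 1 1 w] w1 k0 pos nk by (simp add: k_def)
  have mh: "?m holomorphic_on \<DD>" using nz by (rule moebius_holomorphic)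
  have mi: "inj_on ?m \<DD>" using nz k0 by (intro moebius_inj_on) (auto simp: k_def)
  have ch: "continuous_on \<DD> F" using F(1) holomorphic_on_imp_continuous_on by blast
  have hK: "?h = (\<lambda>z. F z * (1 / (1 - w * cnj z))\<^sup>2)" by (auto simp: power_divide)
  have K: "continuous_on \<DD> (\<lambda>z. (1 / (1 - w * cnj z))\<^sup>2)"
    using kernel_denominator_bound(1)[of w "cmod w"] w1 by (intro continuous_intros) auto
  have bK: "cmod ((1 / (1 - w * cnj z))\<^sup>2) \<le> (1 / (1 - cmod w))\<^sup>2" if "z \<in> \<DD>" for z
    unfolding norm_power using kernel_denominator_bound(2)[of w "cmod w" z] w1 that
    by (intro power_mono) auto
  have hi: "set_integrable lborel \<DD> ?h"
    unfolding hK by (rule set_integrable_mult_bounded[OF F(2) ch K bK]) auto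
  have hc: "continuous_on \<DD> ?h" unfolding hK using ch K by (intro continuous_on_mult)
  \<comment> \<open>The kernel cancels the conjugate of the derivative up to the constant \<open>k\<close>.\<close>
  have eq: "(cmod (deriv ?m u))\<^sup>2 *\<^sub>R ?h (?m u) = F (?m u) * deriv ?m u / k" if u: "u \<in> \<DD>" for u
  proof -
    have nz': "w * cnj u + 1 \<noteq> 0"
    proof
      assume "w * cnj u + 1 = 0"
      then have "cnj (w * cnj u + 1) = 0" by simp
      then show False using nz[OF u] by simp
    qed
    have d: "deriv ?m u = k / (cnj w * u + 1)\<^sup>2"
      using deriv_moebius[OF nz[OF u], of 1 w] by (simp add: k_def)
    have ck: "cnj k = k" by (simp add: k_def mult.commute)
    have one: "1 - w * cnj (?m u) = k / (w * cnj u + 1)"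
      using nz' by (simp add: moebius_def k_def field_simps)
    have "of_real ((cmod (deriv ?m u))\<^sup>2) = deriv ?m u * (k / (w * cnj u + 1)\<^sup>2)"
      unfolding complex_norm_square d by (simp add: ck)
    then show ?thesis unfolding one scaleR_conv_of_real
      using nz' k0 by (simp add: power_divide) (simp add: power2_eq_square)
  qed
  have "(LINT z:\<DD>|lborel. ?h z) = (LINT u:\<DD>|lborel. (cmod (deriv ?m u))\<^sup>2 *\<^sub>R ?h (?m u))"
    using holomorphic_change_of_variables(2)[OF open_ball mh mi, of ?h] hc hi unfolding im by blast
  also have "\<dots> = (LINT u:\<DD>|lborel. F (?m u) * deriv ?m u / k)"
    by (rule set_lebesgue_integral_cong) (use eq in auto)
  also have "\<dots> = pi * (F (?m 0) * deriv ?m 0 / k)"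
  proof (rule mean_value_disk)
    have "(\<lambda>u. F (?m u)) holomorphic_on \<DD>"
      using holomorphic_on_compose_gen[OF mh F(1)] im by (auto simp: o_def)
    then show "(\<lambda>u. F (?m u) * deriv ?m u / k) holomorphic_on \<DD>"
      using mh by (intro holomorphic_intros holomorphic_deriv) (auto simp: k0)
    have "set_integrable lborel \<DD> (\<lambda>u. (cmod (deriv ?m u))\<^sup>2 *\<^sub>R ?h (?m u))"
      using holomorphic_change_of_variables(1)[OF open_ball mh mi, of ?h] hc hi unfolding im by blast
    then show "set_integrable lborel \<DD> (\<lambda>u. F (?m u) * deriv ?m u / k)"
      by (subst set_integrable_cong[OF refl refl eq[symmetric]])
  qed
  also have "F (?m 0) * deriv ?m 0 / k = F w"
    using deriv_moebius[of "cnj w" 0 1 1 w] k0 by (simp add: moebius_def k_def)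
  finally show ?thesis .
qed

text \<open>
  The derivative of \<open>f \<circ> m\<close> is the weighted composition of \<open>f'\<close>.  Since \<open>m\<close> is univalent, its
  energy is the energy of \<open>f\<close> over the image of \<open>m\<close>, and composition does not increase energy.
\<close>

lemma bergman_weighted_composition:
  assumes F: "F \<in> bergman_functions" and m: "m holomorphic_on \<DD>" "inj_on m \<DD>" "m ` \<DD> \<subseteq> \<DD>"
  shows "(\<lambda>z. F (m z) * deriv m z) \<in> bergman_functions"
    and "(LINT z:\<DD>|lborel. (cmod (F (m z) * deriv m z))\<^sup>2) = (LINT z:m ` \<DD>|lborel. (cmod (F z))\<^sup>2)"
    and "(LINT z:\<DD>|lborel. (cmod (F (m z) * deriv m z))\<^sup>2) \<le> (LINT z:\<DD>|lborel. (cmod (F z))\<^sup>2)"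
proof -
  have o: "open (m ` \<DD>)" using open_mapping_thm3[OF m(1) _ m(2)] by simp
  have c: "continuous_on (m ` \<DD>) (\<lambda>z. (cmod (F z))\<^sup>2)"
    by (intro continuous_intros continuous_on_subset[OF bergman_functionsD(3)[OF F] m(3)])
  have i: "set_integrable lborel (m ` \<DD>) (\<lambda>z. (cmod (F z))\<^sup>2)"
    by (rule set_integrable_subset[OF bergman_functionsD(2)[OF F]]) (use o m(3) in auto)
  have eq: "(\<lambda>z. (cmod (F (m z) * deriv m z))\<^sup>2) = (\<lambda>z. (cmod (deriv m z))\<^sup>2 * (cmod (F (m z)))\<^sup>2)"
    by (auto simp: norm_mult power_mult_distrib)
  note cov = holomorphic_change_of_variables_real[OF open_ball m(1,2) c i]
  have "(\<lambda>z. F (m z)) holomorphic_on \<DD>"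
    using holomorphic_on_compose_gen[OF m(1) bergman_functionsD(1)[OF F] m(3)] by (simp add: o_def)
  then show "(\<lambda>z. F (m z) * deriv m z) \<in> bergman_functions"
    using cov(1) m(1)
    by (auto simp: bergman_functions_def norm_mult power_mult_distrib mult.commute
        intro!: holomorphic_intros holomorphic_deriv)
  show eq2: "(LINT z:\<DD>|lborel. (cmod (F (m z) * deriv m z))\<^sup>2) = (LINT z:m ` \<DD>|lborel. (cmod (F z))\<^sup>2)"
    unfolding eq cov(2) ..
  show "(LINT z:\<DD>|lborel. (cmod (F (m z) * deriv m z))\<^sup>2) \<le> (LINT z:\<DD>|lborel. (cmod (F z))\<^sup>2)"
    unfolding eq2 unfolding set_lebesgue_integral_def
  proof (rule integral_mono)
    show "integrable lborel (\<lambda>z. indicator (m ` \<DD>) z *\<^sub>R (cmod (F z))\<^sup>2)"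
      using i by (simp add: set_integrable_def)
    show "integrable lborel (\<lambda>z. indicator \<DD> z *\<^sub>R (cmod (F z))\<^sup>2)"
      using bergman_functionsD(2)[OF F] by (simp add: set_integrable_def)
  qed (use m(3) in \<open>auto simp: indicator_def\<close>)
qed

section \<open>Weak convergence\<close>

text \<open>
  The square-integrable function \<open>G\<close> has little mass outside a smaller disk, where the bounded
  norms of \<open>H n\<close> suffice; on the smaller disk \<open>H n\<close> is uniformly small.
\<close>

lemma bergman_weak_null:
  fixes H :: "nat \<Rightarrow> complex \<Rightarrow> complex"
  assumes H: "\<And>n. H n \<in> bergman_functions" and G: "G \<in> bergman_functions"
    and M: "\<And>n. (LINT z:\<DD>|lborel. (cmod (H n z))\<^sup>2) \<le> M"
    and u: "\<And>s. 0 < s \<Longrightarrow> s < 1 \<Longrightarrow> uniform_limit (ball 0 s) H (\<lambda>_. 0) sequentially"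
  shows "(\<lambda>n. LINT z:\<DD>|lborel. H n z * cnj (G z)) \<longlonglongrightarrow> 0"
proof (rule tendsto_norm_zero_cancel, rule order_tendstoI)
  fix e :: real assume e: "0 < e"
  have "0 \<le> (LINT z:\<DD>|lborel. (cmod (H 0 z))\<^sup>2)"
    unfolding set_lebesgue_integral_def by (intro integral_nonneg_AE) auto
  with M[of 0] have M0: "0 \<le> M" by linarith
  \<comment> \<open>The terms of the bound below are at most \<open>e / 4\<close>, \<open>e / 2\<close> and \<open>e / 8\<close>.\<close>
  define t where "t = e / (M + 1)"
  have t: "t > 0" "t * M < e" using e M0 by (auto simp: t_def field_simps)
  define C where "C = (LINT z:\<DD>|lborel. cmod (G z))"
  have C0: "0 \<le> C"
    unfolding C_def set_lebesgue_integral_def by (intro integral_nonneg_AE) auto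
  define E where "E = (LINT z:\<DD>|lborel. (cmod (G z))\<^sup>2)"
  have iG2: "set_integrable lborel \<DD> (\<lambda>z. (cmod (G z))\<^sup>2)" using G by (rule bergman_functionsD)
  have iG: "set_integrable lborel \<DD> (\<lambda>z. cmod (G z))"
    using bergman_integrable[OF G] by (rule set_integrable_norm)
  have "(\<lambda>n. LINT z:ball 0 (1 - inverse (real (Suc n)))|lborel. (cmod (G z))\<^sup>2) \<longlonglongrightarrow> E"
    unfolding E_def by (rule integral_disk_exhaustion[OF iG2])
  then have "\<forall>\<^sub>F n in sequentially. E - t * e / 4 < (LINT z:ball 0 (1 - inverse (real (Suc n)))|lborel. (cmod (G z))\<^sup>2)"
    by (rule order_tendstoD(1)) (use t e in auto)
  then obtain N where "\<And>n. n \<ge> N \<Longrightarrow> E - t * e / 4 < (LINT z:ball 0 (1 - inverse (real (Suc n)))|lborel. (cmod (G z))\<^sup>2)"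
    unfolding eventually_sequentially by blast
  note N = this[of "Suc N", simplified]
  define s where "s = 1 - inverse (real (Suc (Suc N)))"
  have s: "0 < s" "s < 1" by (auto simp: s_def inverse_less_1_iff)
  have Es: "E - t * e / 4 < (LINT z:ball 0 s|lborel. (cmod (G z))\<^sup>2)"
    using N by (simp add: s_def)
  define E' where "E' = (LINT z:ball 0 s|lborel. (cmod (G z))\<^sup>2)"
  define \<delta> where "\<delta> = e / (4 * (C + 1))"
  have \<delta>: "\<delta> > 0" "\<delta> * C < e / 4" using e C0 by (auto simp: \<delta>_def field_simps)
  have "\<forall>\<^sub>F n in sequentially. \<forall>z\<in>ball 0 s. dist (H n z) 0 < \<delta>"
    using u[OF s] \<delta>(1) unfolding uniform_limit_iff by blast
  then show "\<forall>\<^sub>F n in sequentially. norm (LINT z:\<DD>|lborel. H n z * cnj (G z)) < e"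
  proof eventually_elim
    case (elim n)
    let ?B = "\<lambda>z. \<delta> * cmod (G z) + (t / 2 * (cmod (H n z))\<^sup>2
        + 1 / (2 * t) * ((cmod (G z))\<^sup>2 - indicator (ball 0 s) z * (cmod (G z))\<^sup>2))"
    have iH2: "set_integrable lborel \<DD> (\<lambda>z. (cmod (H n z))\<^sup>2)" using H by (rule bergman_functionsD)
    have iHG: "set_integrable lborel \<DD> (\<lambda>z. H n z * cnj (G z))"
      using H G by (rule bergman_product_integrable)
    have ind: "indicator \<DD> z *\<^sub>R (indicator (ball 0 s) z * (cmod (G z))\<^sup>2) = indicator (ball 0 s) z *\<^sub>R (cmod (G z))\<^sup>2" for z
      using s by (auto simp: indicator_def)
    have iI: "set_integrable lborel \<DD> (\<lambda>z. indicator (ball 0 s) z * (cmod (G z))\<^sup>2)"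
      unfolding set_integrable_def ind
      using set_integrable_subset[OF iG2, of "ball 0 s"] s subset_ball[of s 1 "0::complex"]
      by (simp add: set_integrable_def)
    have I: "(LINT z:\<DD>|lborel. indicator (ball 0 s) z * (cmod (G z))\<^sup>2) = E'"
      unfolding set_lebesgue_integral_def ind E'_def ..
    have bd: "cmod (H n z * cnj (G z)) \<le> ?B z" if z: "z \<in> \<DD>" for z
    proof (cases "z \<in> ball 0 s")
      case True
      then have "cmod (H n z) \<le> \<delta>" using elim by (auto simp: less_imp_le)
      then have "cmod (H n z) * cmod (G z) \<le> \<delta> * cmod (G z)" by (rule mult_right_mono) simp
      moreover have "0 \<le> t / 2 * (cmod (H n z))\<^sup>2" using t by simp
      ultimately show ?thesis using True by (simp add: norm_mult)
    next
      case False
      have "cmod (H n z) * cmod (G z) \<le> (t * (cmod (H n z))\<^sup>2 + (cmod (G z))\<^sup>2 / t) / 2"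
        using t(1) by (rule mult_le_weighted_squares)
      moreover have "0 \<le> \<delta> * cmod (G z)" using \<delta> by simp
      ultimately show ?thesis using False by (simp add: norm_mult field_simps)
    qed
    have iB: "set_integrable lborel \<DD> ?B"
      by (intro set_integral_add set_integral_diff set_integrable_mult_right iG iH2 iG2 iI)
    have "norm (LINT z:\<DD>|lborel. H n z * cnj (G z)) \<le> (LINT z:\<DD>|lborel. norm (H n z * cnj (G z)))"
      using iHG by (rule set_integral_norm_bound)
    also have "\<dots> \<le> (LINT z:\<DD>|lborel. ?B z)"
      by (intro set_integral_mono set_integrable_norm iHG iB bd)
    also have "\<dots> = \<delta> * C + (t / 2 * (LINT z:\<DD>|lborel. (cmod (H n z))\<^sup>2) + 1 / (2 * t) * (E - E'))"
      by (simp add: set_integral_add(2) set_integral_diff(2) set_integral_add(1) set_integral_diff(1)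
          iG iH2 iG2 iI I C_def E_def del: times_divide_eq_left)
    also have "\<dots> < e"
    proof -
      have "t / 2 * (LINT z:\<DD>|lborel. (cmod (H n z))\<^sup>2) \<le> t / 2 * M"
        using M t by (intro mult_left_mono) auto
      moreover have "1 / (2 * t) * (E - E') \<le> 1 / (2 * t) * (t * e / 4)"
        using Es t by (intro mult_left_mono) (auto simp: E'_def)
      moreover have "1 / (2 * t) * (t * e / 4) = e / 8" using t by simp
      ultimately show ?thesis using \<delta>(2) t e by linarith
    qed
    finally show ?case .
  qed
next
  fix e :: real assume "e < 0"
  then show "\<forall>\<^sub>F n in sequentially. e < norm (LINT z:\<DD>|lborel. H n z * cnj (G z))"
    by (intro always_eventually allI) (meson less_le_trans norm_ge_zero)
qed

lemma bergman_weak_limit: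
  fixes F :: "nat \<Rightarrow> complex \<Rightarrow> complex"
  assumes F: "\<And>n. F n \<in> bergman_functions" "F0 \<in> bergman_functions" and G: "G \<in> bergman_functions"
    and M: "\<And>n. (LINT z:\<DD>|lborel. (cmod (F n z))\<^sup>2) \<le> M"
    and u: "\<And>s. 0 < s \<Longrightarrow> s < 1 \<Longrightarrow> uniform_limit (ball 0 s) F F0 sequentially"
  shows "(\<lambda>n. LINT z:\<DD>|lborel. F n z * cnj (G z)) \<longlonglongrightarrow> (LINT z:\<DD>|lborel. F0 z * cnj (G z))"
proof -
  have "(\<lambda>n. LINT z:\<DD>|lborel. (F n z - F0 z) * cnj (G z)) \<longlonglongrightarrow> 0"
  proof (rule bergman_weak_null[OF _ G])
    show "(LINT z:\<DD>|lborel. (cmod (F n z - F0 z))\<^sup>2) \<le> 2 * M + 2 * (LINT z:\<DD>|lborel. (cmod (F0 z))\<^sup>2)" for n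
      using bergman_diff(2)[OF F(1)[of n] F(2)] M[of n] by linarith
    show "uniform_limit (ball 0 s) (\<lambda>n z. F n z - F0 z) (\<lambda>_. 0) sequentially" if "0 < s" "s < 1" for s
      using u[OF that] by (simp add: uniform_limit_iff dist_norm)
  qed (use bergman_diff(1) F in auto)
  also have "(\<lambda>n. LINT z:\<DD>|lborel. (F n z - F0 z) * cnj (G z))
     = (\<lambda>n. (LINT z:\<DD>|lborel. F n z * cnj (G z)) - (LINT z:\<DD>|lborel. F0 z * cnj (G z)))"
    by (simp add: left_diff_distrib set_integral_diff(2) bergman_product_integrable F G)
  finally show ?thesis by (rule LIM_zero_cancel)
qed

section \<open>Linear fractional self-maps and the Krein adjoint\<close>

text \<open>
  A bounded kernel makes the double integral absolutely convergent for integrable \<open>u\<close> and \<open>v\<close>.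
\<close>

lemma (in pair_sigma_finite) kernel_Fubini:
  fixes u :: "'a \<Rightarrow> complex" and v :: "'b \<Rightarrow> complex" and k :: "'a \<times> 'b \<Rightarrow> complex"
  assumes u: "integrable M1 u" and v: "integrable M2 v"
    and k: "k \<in> borel_measurable (M1 \<Otimes>\<^sub>M M2)" "\<And>p. cmod (k p) \<le> C"
  shows "(\<integral>x. u x * (\<integral>y. v y * k (x, y) \<partial>M2) \<partial>M1) = (\<integral>y. v y * (\<integral>x. u x * k (x, y) \<partial>M1) \<partial>M2)"
proof -
  note [measurable] = borel_measurable_integrable[OF u] borel_measurable_integrable[OF v] k(1)
  have C: "0 \<le> C" using k(2) norm_ge_zero order_trans by blast
  have "integrable (M1 \<Otimes>\<^sub>M M2) (\<lambda>p. of_real C * (u (fst p) * v (snd p)))"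
  proof (rule Fubini_integrable)
    have "(\<lambda>x. \<integral>y. norm (of_real C * (u (fst (x, y)) * v (snd (x, y)))) \<partial>M2)
        = (\<lambda>x. \<bar>C\<bar> * (\<integral>y. norm (v y) \<partial>M2) * norm (u x))"
      by (simp add: norm_mult mult_ac)
    then show "integrable M1 (\<lambda>x. \<integral>y. norm (of_real C * (u (fst (x, y)) * v (snd (x, y)))) \<partial>M2)"
      using u by simp
    show "AE x in M1. integrable M2 (\<lambda>y. of_real C * (u (fst (x, y)) * v (snd (x, y))))"
      using v by simp
  qed measurable
  then have "integrable (M1 \<Otimes>\<^sub>M M2) (\<lambda>p. u (fst p) * v (snd p) * k p)"
  proof (rule Bochner_Integration.integrable_bound)
    have "cmod (u (fst p) * v (snd p)) * cmod (k p) \<le> cmod (u (fst p) * v (snd p)) * C" for p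
      using k(2) by (rule mult_left_mono) simp
    then show "AE p in M1 \<Otimes>\<^sub>M M2. cmod (u (fst p) * v (snd p) * k p) \<le> cmod (of_real C * (u (fst p) * v (snd p)))"
      using C by (simp add: norm_mult mult_ac)
  qed measurable
  then have "integrable (M1 \<Otimes>\<^sub>M M2) (case_prod (\<lambda>x y. u x * v y * k (x, y)))"
    by (simp add: case_prod_unfold)
  from Fubini_integral[OF this]
  have "(\<integral>x. (\<integral>y. u x * v y * k (x, y) \<partial>M2) \<partial>M1) = (\<integral>y. (\<integral>x. u x * v y * k (x, y) \<partial>M1) \<partial>M2)" ..
  moreover have "(\<integral>y. u x * v y * k (x, y) \<partial>M2) = u x * (\<integral>y. v y * k (x, y) \<partial>M2)" for x
    by (simp add: mult.assoc)
  moreover have "(\<integral>x. u x * v y * k (x, y) \<partial>M1) = v y * (\<integral>x. u x * k (x, y) \<partial>M1)" for y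
    by (simp add: mult.assoc mult.left_commute[of _ "v y"])
  ultimately show ?thesis by simp
qed

text \<open>
  The coefficients of a linear fractional self-map of the disk.  Comparing numerator and
  denominator, instead of speaking about the quotient, makes the condition pass to the closed disk by
  continuity and rules out poles there: at a pole on the circle the numerator would vanish as well,
  against the determinant condition.
\<close>

locale disk_moebius =
  fixes a b c d :: complex
  assumes det: "a * d - b * c \<noteq> 0"
    and self_map: "cmod z < 1 \<Longrightarrow> cmod (a * z + b) < cmod (c * z + d)"
begin

lemma numerator_le_denominator:
  assumes "cmod z \<le> 1"
  shows "cmod (a * z + b) \<le> cmod (c * z + d)"
proof -
  have "z \<in> closure \<DD>" using assms by simp
  then have "cmod (a * z + b) - cmod (c * z + d) \<le> 0"
    by (rule continuous_le_on_closure[rotated 1])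
       (auto intro!: continuous_intros less_imp_le self_map)
  then show ?thesis by simp
qed

lemma denominator_nonzero:
  assumes "cmod z \<le> 1"
  shows "c * z + d \<noteq> 0"
proof
  assume 0: "c * z + d = 0"
  then have "a * z + b = 0" using numerator_le_denominator[OF assms] by simp
  then have "b = - a * z" "d = - c * z" using 0 by (simp_all add: add_eq_0_iff2)
  then show False using det by simp
qed

lemma c_less_d: "cmod c < cmod d"
proof (rule ccontr)
  assume "\<not> cmod c < cmod d"
  then have le: "cmod d \<le> cmod c" by simp
  have "c \<noteq> 0" using le det by auto
  then have "c * (- d / c) + d = 0" by simp
  moreover have "cmod (- d / c) \<le> 1" using le \<open>c \<noteq> 0\<close> by (simp add: norm_divide divide_le_eq)
  ultimately show False using denominator_nonzero by blast
qed

text \<open>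
  \<open>\<sigma>\<close> is the Krein adjoint \<open>\<rho> \<circ> \<psi>\<^sup>-\<^sup>1 \<circ> \<rho>\<close> of \<open>\<psi>\<close>, where \<open>\<rho>\<close> is the reflection \<open>z \<mapsto> 1 / cnj z\<close> in the
  circle.
\<close>

abbreviation \<psi> where "\<psi> \<equiv> moebius a b c d"
abbreviation \<sigma> where "\<sigma> \<equiv> moebius (cnj a) (- cnj c) (- cnj b) (cnj d)"

lemma maps_disk: "cmod z < 1 \<Longrightarrow> cmod (\<psi> z) < 1"
  using self_map[of z] denominator_nonzero[of z] by (simp add: moebius_def norm_divide)

lemma maps_cdisk: "cmod z \<le> 1 \<Longrightarrow> cmod (\<psi> z) \<le> 1"
  using numerator_le_denominator[of z] denominator_nonzero[of z] by (simp add: moebius_def norm_divide)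

lemma holomorphic: "\<psi> holomorphic_on \<DD>"
  using denominator_nonzero by (intro moebius_holomorphic) simp

lemma inj: "inj_on \<psi> \<DD>"
  using denominator_nonzero det by (intro moebius_inj_on) auto

lemma image_subset: "\<psi> ` \<DD> \<subseteq> \<DD>"
  using maps_disk by auto

lemma deriv: "cmod z \<le> 1 \<Longrightarrow> deriv \<psi> z = (a * d - b * c) / (c * z + d)\<^sup>2"
  using denominator_nonzero by (simp add: deriv_moebius)

text \<open>
  If \<open>|\<sigma> z| \<ge> 1\<close> with \<open>|z| < 1\<close>, then, with \<open>u = cnj z\<close>, some \<open>x\<close> of the closed disk solves
  \<open>x * (a * u - c) = d - b * u\<close>, that is \<open>\<psi> x * u = 1\<close>.  This contradicts \<open>|\<psi> x| \<le> 1\<close>.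
\<close>

lemma krein_adjoint: "disk_moebius (cnj a) (- cnj c) (- cnj b) (cnj d)"
proof
  have "cnj a * cnj d - - cnj c * - cnj b = cnj (a * d - b * c)" by (simp add: mult.commute)
  then show "cnj a * cnj d - - cnj c * - cnj b \<noteq> 0" using det by (metis complex_cnj_zero_iff)
next
  fix z :: complex assume z: "cmod z < 1"
  define u where "u = cnj z"
  have u: "cmod u < 1" using z by (simp add: u_def)
  have ne: "x * (a * u - c) \<noteq> d - b * u" if "cmod x \<le> 1" for x
  proof
    assume "x * (a * u - c) = d - b * u"
    then have eq: "(a * x + b) * u = c * x + d" by (simp add: algebra_simps)
    have "cmod ((a * x + b) * u) < cmod (c * x + d)"
    proof (cases "a * x + b = 0")
      case False
      then have "cmod (a * x + b) * cmod u < cmod (a * x + b) * 1"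
        using u by (intro mult_strict_left_mono) auto
      also have "\<dots> \<le> cmod (c * x + d)" using numerator_le_denominator[OF that] by simp
      finally show ?thesis by (simp add: norm_mult)
    qed (use denominator_nonzero[OF that] in auto)
    then show False using eq by simp
  qed
  have "cmod (a * u - c) < cmod (d - b * u)"
  proof (rule ccontr)
    assume n: "\<not> cmod (a * u - c) < cmod (d - b * u)"
    then have "a * u - c \<noteq> 0" using ne[of 0] by auto
    then have "cmod ((d - b * u) / (a * u - c)) \<le> 1" "(d - b * u) / (a * u - c) * (a * u - c) = d - b * u"
      using n by (auto simp: norm_divide divide_le_eq)
    then show False using ne by blast
  qed
  moreover have "cnj a * z + - cnj c = cnj (a * u - c)" "- cnj b * z + cnj d = cnj (d - b * u)"
    by (simp_all add: u_def)
  ultimately show "cmod (cnj a * z + - cnj c) < cmod (- cnj b * z + cnj d)"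
    by (simp only: complex_mod_cnj)
qed

lemma scaled:
  assumes "0 < r" "r \<le> 1"
  shows "disk_moebius (of_real r * a) (of_real r * b) c d"
proof
  have "of_real r * a * d - of_real r * b * c = of_real r * (a * d - b * c)" by (simp add: algebra_simps)
  then show "of_real r * a * d - of_real r * b * c \<noteq> 0" using det assms by simp
next
  fix z :: complex assume z: "cmod z < 1"
  have "cmod (of_real r * a * z + of_real r * b) = r * cmod (a * z + b)"
    using assms by (simp add: mult.assoc norm_mult flip: distrib_left)
  also have "\<dots> \<le> 1 * cmod (a * z + b)" using assms by (intro mult_right_mono) auto
  also have "\<dots> < cmod (c * z + d)" using self_map[OF z] by simp
  finally show "cmod (of_real r * a * z + of_real r * b) < cmod (c * z + d)" .
qed

text \<open>
  The two sides are the image of the Bergman kernel at \<open>w\<close> under the formal adjoint of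
  \<open>F \<mapsto> (F \<circ> \<psi>) * \<psi>'\<close>, and its image under \<open>G \<mapsto> (G \<circ> \<sigma>) * \<sigma>'\<close>.  Their equality is what singles
  out the Krein adjoint.
\<close>

lemma kernel_identity:
  assumes z: "cmod z < 1" and w: "cmod w < 1"
  shows "cnj (deriv \<psi> w) / (1 - cnj (\<psi> w) * z)\<^sup>2 = deriv \<sigma> z / (1 - \<sigma> z * cnj w)\<^sup>2"
proof -
  interpret s: disk_moebius "cnj a" "- cnj c" "- cnj b" "cnj d" by (rule krein_adjoint)
  define D where "D = cnj (a * d - b * c)"
  define p where "p = cnj c * cnj w + cnj d"
  define q where "q = cnj d - cnj b * z"
  have p: "p \<noteq> 0"
    using denominator_nonzero[of w] w by (metis p_def complex_cnj_add complex_cnj_mult complex_cnj_zero_iff less_imp_le)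
  have q: "q \<noteq> 0" using s.denominator_nonzero[of z] z by (simp add: q_def)
  have 1: "1 - cnj (\<psi> w) * z = (p - (cnj a * cnj w + cnj b) * z) / p"
    using p by (simp add: moebius_def p_def diff_divide_distrib)
  have 2: "1 - \<sigma> z * cnj w = (q - (cnj a * z - cnj c) * cnj w) / q"
    using q by (simp add: moebius_def q_def field_simps)
  have 3: "p - (cnj a * cnj w + cnj b) * z = q - (cnj a * z - cnj c) * cnj w"
    by (simp add: p_def q_def algebra_simps)
  have 4: "cnj (deriv \<psi> w) = D / p\<^sup>2" using deriv[of w] w by (simp add: D_def p_def)
  have 5: "deriv \<sigma> z = D / q\<^sup>2" using s.deriv[of z] z by (simp add: D_def q_def mult.commute)
  show ?thesis unfolding 1 2 3 4 5 using p q by (simp add: power_divide)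
qed

text \<open>
  When \<open>\<psi>\<close> stays away from the circle, the kernel at \<open>\<psi> w\<close> is bounded.  Writing \<open>F (\<psi> w)\<close> by the
  reproducing formula and exchanging the integrals leaves an integral in \<open>w\<close>, which the kernel
  identity turns into the reproducing formula for \<open>G\<close> at \<open>\<sigma> z\<close>.
\<close>

lemma adjoint_identity_strict:
  assumes F: "F \<in> bergman_functions" and G: "G \<in> bergman_functions"
    and q: "q < 1" "\<And>z. cmod z < 1 \<Longrightarrow> cmod (\<psi> z) \<le> q"
  shows "(LINT w:\<DD>|lborel. F (\<psi> w) * deriv \<psi> w * cnj (G w))
       = (LINT z:\<DD>|lborel. F z * cnj (G (\<sigma> z) * deriv \<sigma> z))"
proof -
  interpret s: disk_moebius "cnj a" "- cnj c" "- cnj b" "cnj d" by (rule krein_adjoint)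
  let ?k = "\<lambda>p. indicator (\<DD> \<times> \<DD>) p *\<^sub>R (1 / (1 - \<psi> (fst p) * cnj (snd p)))\<^sup>2"
  define u where "u = (\<lambda>w. indicator \<DD> w *\<^sub>R (deriv \<psi> w * cnj (G w)))"
  define v where "v = (\<lambda>z. indicator \<DD> z *\<^sub>R F z)"
  have "(\<lambda>w. 1 * deriv \<psi> w) \<in> bergman_functions"
    using bergman_weighted_composition(1)[OF _ holomorphic inj image_subset, of "\<lambda>_. 1"]
      bounded_holomorphic_in_bergman[of "\<lambda>_. 1" 1] by simp
  then have dp: "deriv \<psi> \<in> bergman_functions" by simp
  have u: "integrable lborel u"
    using bergman_product_integrable[OF dp G] by (simp add: u_def set_integrable_def)
  have v: "integrable lborel v"
    using bergman_integrable[OF F] by (simp add: v_def set_integrable_def)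
  have bound: "cmod (1 / (1 - \<psi> w * cnj z)) \<le> 1 / (1 - q)" "1 - \<psi> w * cnj z \<noteq> 0"
    if "cmod w < 1" "cmod z < 1" for w z
    using kernel_denominator_bound[of "\<psi> w" q z] q that by auto
  have q1: "0 < 1 / (1 - q)" using q by simp
  have k_meas: "?k \<in> borel_measurable (lborel \<Otimes>\<^sub>M lborel)"
  proof -
    have "continuous_on (\<DD> \<times> \<DD>) (\<lambda>p. (1 / (1 - \<psi> (fst p) * cnj (snd p)))\<^sup>2)"
      using bound(2)
      by (intro continuous_intros continuous_on_compose2[OF holomorphic_on_imp_continuous_on[OF holomorphic]]) auto
    then have "?k \<in> borel_measurable borel"
      by (intro borel_measurable_continuous_on_indicator) (auto intro!: borel_open open_Times)
    then show ?thesis by (simp add: lborel_prod)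
  qed
  have k_bound: "cmod (?k p) \<le> (1 / (1 - q))\<^sup>2" for p
  proof (cases "p \<in> \<DD> \<times> \<DD>")
    case True
    then have "cmod (1 / (1 - \<psi> (fst p) * cnj (snd p))) \<le> 1 / (1 - q)" by (intro bound(1)) auto
    then have "(cmod (1 / (1 - \<psi> (fst p) * cnj (snd p))))\<^sup>2 \<le> (1 / (1 - q))\<^sup>2" by (intro power_mono) auto
    then show ?thesis using True by (simp only: norm_scaleR norm_power) simp
  qed simp
  note fub = lborel_pair.kernel_Fubini[OF u v k_meas k_bound]
  have in1: "u w * (\<integral>z. v z * ?k (w, z) \<partial>lborel) = indicator \<DD> w *\<^sub>R (pi * (F (\<psi> w) * deriv \<psi> w * cnj (G w)))" for w
  proof (cases "w \<in> \<DD>")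
    case True
    have "(\<integral>z. v z * ?k (w, z) \<partial>lborel) = (LINT z:\<DD>|lborel. F z / (1 - \<psi> w * cnj z)\<^sup>2)"
      unfolding set_lebesgue_integral_def
      by (rule Bochner_Integration.integral_cong) (use True in \<open>auto simp: v_def indicator_def power_divide\<close>)
    also have "\<dots> = pi * F (\<psi> w)"
      using True maps_disk by (intro bergman_reproducing bergman_functionsD[OF F] bergman_integrable[OF F]) auto
    finally show ?thesis using True by (simp add: u_def)
  qed (simp add: u_def)
  have in2: "v z * (\<integral>w. u w * ?k (w, z) \<partial>lborel) = indicator \<DD> z *\<^sub>R (pi * (F z * cnj (G (\<sigma> z) * deriv \<sigma> z)))" for z
  proof (cases "z \<in> \<DD>")
    case True
    then have z: "cmod z < 1" by simp
    have "cnj (\<integral>w. u w * ?k (w, z) \<partial>lborel) = (\<integral>w. cnj (u w * ?k (w, z)) \<partial>lborel)"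
      by (rule Bochner_Integration.integral_cnj[symmetric])
    also have "\<dots> = (LINT w:\<DD>|lborel. deriv \<sigma> z * (G w / (1 - \<sigma> z * cnj w)\<^sup>2))"
      unfolding set_lebesgue_integral_def
    proof (rule Bochner_Integration.integral_cong[OF refl])
      fix w
      show "cnj (u w * ?k (w, z)) = indicator \<DD> w *\<^sub>R (deriv \<sigma> z * (G w / (1 - \<sigma> z * cnj w)\<^sup>2))"
      proof (cases "w \<in> \<DD>")
        case w: True
        then have "cnj (u w * ?k (w, z)) = G w * (cnj (deriv \<psi> w) / (1 - cnj (\<psi> w) * z)\<^sup>2)"
          using True by (simp add: u_def power_divide)
        also have "\<dots> = G w * (deriv \<sigma> z / (1 - \<sigma> z * cnj w)\<^sup>2)"
          using kernel_identity[of z w] z w by simp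
        finally show ?thesis using w by simp
      qed (simp add: u_def)
    qed
    also have "\<dots> = deriv \<sigma> z * (pi * G (\<sigma> z))"
      using z s.maps_disk bergman_reproducing[OF bergman_functionsD(1)[OF G] bergman_integrable[OF G], of "\<sigma> z"]
      by (simp del: times_divide_eq_right)
    finally have "cnj (cnj (\<integral>w. u w * ?k (w, z) \<partial>lborel)) = cnj (deriv \<sigma> z * (pi * G (\<sigma> z)))"
      by (rule arg_cong)
    then have "(\<integral>w. u w * ?k (w, z) \<partial>lborel) = cnj (deriv \<sigma> z * (pi * G (\<sigma> z)))"
      by (simp only: complex_cnj_cnj)
    then show ?thesis using True by (simp add: v_def)
  qed (simp add: v_def)
  have "(LINT w:\<DD>|lborel. pi * (F (\<psi> w) * deriv \<psi> w * cnj (G w)))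
      = (LINT z:\<DD>|lborel. pi * (F z * cnj (G (\<sigma> z) * deriv \<sigma> z)))"
    using fub unfolding in1 in2 unfolding set_lebesgue_integral_def .
  then show ?thesis by simp
qed

end

section \<open>The adjoint identity\<close>

lemma set_integral_cnj:
  "(LINT z:S|M. cnj (f z)) = cnj (LINT z:S|M. f z)"
  by (simp add: set_lebesgue_integral_def flip: Bochner_Integration.integral_cnj)

text \<open>
  A sequence in the open interval from 0 to 1 that tends to 1.  It serves both to approximate
  functions by their dilations and to let peak functions concentrate at a point of the circle.
\<close>

definition dilation_radius :: "nat \<Rightarrow> real"
  where "dilation_radius n = 1 - inverse (real (Suc (Suc n)))"

lemma dilation_radius: "0 < dilation_radius n" "dilation_radius n < 1"
  by (auto simp: dilation_radius_def inverse_less_1_iff)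

lemma dilation_radius_tendsto: "dilation_radius \<longlonglongrightarrow> 1"
  unfolding dilation_radius_def [abs_def]
  using tendsto_diff[OF tendsto_const[of 1] LIMSEQ_Suc[OF LIMSEQ_inverse_real_of_nat]] by simp

lemma dilation_uniform_limit:
  fixes H :: "complex \<Rightarrow> complex"
  assumes H: "continuous_on \<DD> H" and s: "s < 1"
  shows "uniform_limit (cball 0 s) (\<lambda>n z. H (of_real (dilation_radius n) * z) * of_real (dilation_radius n)) H sequentially"
  unfolding uniform_limit_iff
proof (intro allI impI)
  fix e :: real assume e: "e > 0"
  \<comment> \<open>The dilations and their limit are the sections of one function, continuous on a compact set.\<close>
  let ?\<Phi> = "\<lambda>p. H (of_real (fst p) * snd p) * of_real (fst p)"
  let ?K = "{0..1::real} \<times> cball (0::complex) s"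
  have "of_real t * z \<in> \<DD>" if "t \<in> {0..1}" "z \<in> cball 0 s" for t z
  proof -
    have "cmod (of_real t * z) = t * cmod z" using that by (simp add: norm_mult)
    also have "\<dots> \<le> 1 * cmod z" using that by (intro mult_right_mono) auto
    finally show ?thesis using that s by auto
  qed
  then have "continuous_on ?K ?\<Phi>"
    by (intro continuous_intros continuous_on_compose2[OF H]) auto
  then have "uniformly_continuous_on ?K ?\<Phi>"
    by (intro compact_uniformly_continuous compact_Times) auto
  then obtain \<delta> where \<delta>: "\<delta> > 0" "\<And>p q. p \<in> ?K \<Longrightarrow> q \<in> ?K \<Longrightarrow> dist q p < \<delta> \<Longrightarrow> dist (?\<Phi> q) (?\<Phi> p) < e"
    unfolding uniformly_continuous_on_def using e by meson
  have "\<forall>\<^sub>F n in sequentially. dist (dilation_radius n) 1 < \<delta>"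
    using dilation_radius_tendsto \<delta>(1) by (rule tendstoD)
  then show "\<forall>\<^sub>F n in sequentially. \<forall>z\<in>cball 0 s. dist (H (of_real (dilation_radius n) * z) * of_real (dilation_radius n)) (H z) < e"
  proof eventually_elim
    case (elim n)
    show ?case
    proof
      fix z :: complex assume "z \<in> cball 0 s"
      then show "dist (H (of_real (dilation_radius n) * z) * of_real (dilation_radius n)) (H z) < e"
        using \<delta>(2)[of "(1, z)" "(dilation_radius n, z)"] elim dilation_radius[of n]
        by (simp add: dist_Pair_Pair)
    qed
  qed
qed

lemma dilation_bergman:
  assumes "H \<in> bergman_functions"
  shows "(\<lambda>z. H (of_real (dilation_radius n) * z) * of_real (dilation_radius n)) \<in> bergman_functions"
    and "(LINT z:\<DD>|lborel. (cmod (H (of_real (dilation_radius n) * z) * of_real (dilation_radius n)))\<^sup>2)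
       \<le> (LINT z:\<DD>|lborel. (cmod (H z))\<^sup>2)"
proof -
  let ?r = "dilation_radius n"
  have m: "(\<lambda>z. of_real ?r * z) holomorphic_on \<DD>" "inj_on (\<lambda>z. of_real ?r * z) \<DD>"
    using dilation_radius[of n] by (auto intro!: holomorphic_intros inj_onI)
  have "cmod (of_real ?r * z) < 1" if "cmod z < 1" for z
  proof -
    have "?r * cmod z \<le> 1 * cmod z" using dilation_radius[of n] by (intro mult_right_mono) auto
    then show ?thesis using that dilation_radius[of n] by (simp add: norm_mult)
  qed
  then have im: "(\<lambda>z. of_real ?r * z) ` \<DD> \<subseteq> \<DD>" by auto
  have d: "deriv (\<lambda>z. of_real ?r * z) z = of_real ?r" for z by simp
  show "(\<lambda>z. H (of_real ?r * z) * of_real ?r) \<in> bergman_functions"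
    "(LINT z:\<DD>|lborel. (cmod (H (of_real ?r * z) * of_real ?r))\<^sup>2) \<le> (LINT z:\<DD>|lborel. (cmod (H z))\<^sup>2)"
    using bergman_weighted_composition(1,3)[OF assms m im] unfolding d by auto
qed

text \<open>
  The difference \<open>f w - f 0\<close> is the integral of \<open>w * f' (t * w)\<close> over \<open>t\<close> from 0 to 1.  The Bergman
  formula for \<open>f' (t * w)\<close> and an exchange of integrals leave the kernel
  \<open>w / (1 - t * w * cnj z)\<^sup>2\<close> to be integrated in \<open>t\<close>; its primitive is
  \<open>t * w / (1 - t * w * cnj z)\<close>.
\<close>

lemma dirichlet_reproducing:
  fixes f :: "complex \<Rightarrow> complex"
  assumes f: "f holomorphic_on \<DD>" and f': "deriv f \<in> bergman_functions" and w: "cmod w < 1"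
  shows "(LINT z:\<DD>|lborel. deriv f z * (w / (1 - w * cnj z))) = pi * (f w - f 0)"
proof -
  define u where "u = (\<lambda>t::real. indicator {0..1} t *\<^sub>R w)"
  define v where "v = (\<lambda>z. indicator \<DD> z *\<^sub>R deriv f z)"
  let ?k = "\<lambda>p. indicator ({0..1} \<times> \<DD>) p *\<^sub>R (1 / (1 - of_real (fst p) * w * cnj (snd p)))\<^sup>2"
  have tw: "cmod (of_real t * w) \<le> cmod w" if "t \<in> {0..1}" for t
    using that by (simp add: norm_mult mult_left_le_one_le)
  have tD: "of_real t * w \<in> \<DD>" if "t \<in> {0..1}" for t
    using tw[OF that] w by simp
  have bound: "1 - of_real t * w * cnj z \<noteq> 0" "cmod (1 / (1 - of_real t * w * cnj z)) \<le> 1 / (1 - cmod w)"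
    if "t \<in> {0..1}" "cmod z < 1" for t z
    using kernel_denominator_bound[of "of_real t * w" "cmod w" z] tw[OF that(1)] w that by auto
  have u: "integrable lborel u"
    unfolding u_def by (intro integrable_scaleR_left) (simp add: integrable_indicator_iff)
  have v: "integrable lborel v"
    using bergman_integrable[OF f'] by (simp add: v_def set_integrable_def)
  have k_meas: "?k \<in> borel_measurable (lborel \<Otimes>\<^sub>M lborel)"
  proof -
    have "continuous_on ({0..1} \<times> \<DD>) (\<lambda>p. (1 / (1 - of_real (fst p) * w * cnj (snd p)))\<^sup>2)"
      using bound(1) by (intro continuous_intros) auto
    then have "?k \<in> borel_measurable borel"
      by (intro borel_measurable_continuous_on_indicator borel_Times) auto
    then show ?thesis by (simp add: lborel_prod)
  qed
  have k_bound: "cmod (?k p) \<le> (1 / (1 - cmod w))\<^sup>2" for p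
  proof (cases "p \<in> {0..1} \<times> \<DD>")
    case True
    then have "cmod (1 / (1 - of_real (fst p) * w * cnj (snd p))) \<le> 1 / (1 - cmod w)" by (intro bound(2)) auto
    then have "(cmod (1 / (1 - of_real (fst p) * w * cnj (snd p))))\<^sup>2 \<le> (1 / (1 - cmod w))\<^sup>2"
      by (intro power_mono) auto
    then show ?thesis using True by (simp only: norm_scaleR norm_power) simp
  qed simp
  note fub = lborel_pair.kernel_Fubini[OF u v k_meas k_bound]
  have in1: "u t * (\<integral>z. v z * ?k (t, z) \<partial>lborel) = indicator {0..1} t *\<^sub>R (pi * (w * deriv f (of_real t * w)))" for t
  proof (cases "t \<in> {0..1}")
    case True
    have "(\<integral>z. v z * ?k (t, z) \<partial>lborel) = (LINT z:\<DD>|lborel. deriv f z / (1 - of_real t * w * cnj z)\<^sup>2)"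
      unfolding set_lebesgue_integral_def
      by (rule Bochner_Integration.integral_cong) (use True in \<open>auto simp: v_def indicator_def power_divide\<close>)
    also have "\<dots> = pi * deriv f (of_real t * w)"
      by (intro bergman_reproducing bergman_functionsD[OF f'] bergman_integrable[OF f'] tD[OF True])
    finally show ?thesis using True by (simp add: u_def)
  qed (simp add: u_def)
  have in2: "v z * (\<integral>t. u t * ?k (t, z) \<partial>lborel) = indicator \<DD> z *\<^sub>R (deriv f z * (w / (1 - w * cnj z)))" for z
  proof (cases "z \<in> \<DD>")
    case True
    then have z: "cmod z < 1" by simp
    have "(\<integral>t. u t * ?k (t, z) \<partial>lborel) = (\<integral>t. indicator {0..1} t *\<^sub>R (w / (1 - of_real t * w * cnj z)\<^sup>2) \<partial>lborel)"
      by (rule Bochner_Integration.integral_cong) (use True in \<open>auto simp: u_def indicator_def power_divide\<close>)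
    also have "\<dots> = of_real 1 * w / (1 - of_real 1 * w * cnj z) - of_real 0 * w / (1 - of_real 0 * w * cnj z)"
    proof (rule integral_FTC_atLeastAtMost)
      fix t :: real assume t: "0 \<le> t" "t \<le> 1"
      then have nz: "1 - of_real t * w * cnj z \<noteq> 0" using bound(1)[of t z] z by simp
      have "((\<lambda>x. x * w / (1 - x * w * cnj z)) has_field_derivative w / (1 - of_real t * w * cnj z)\<^sup>2) (at (of_real t))"
        by (rule derivative_eq_intros refl nz)+ (use nz in \<open>simp add: field_simps power2_eq_square\<close>)
      then show "((\<lambda>t. of_real t * w / (1 - of_real t * w * cnj z)) has_vector_derivative w / (1 - of_real t * w * cnj z)\<^sup>2) (at t within {0..1})"
        by (rule has_vector_derivative_real_field[THEN has_vector_derivative_at_within])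
    next
      show "continuous_on {0..1} (\<lambda>t. w / (1 - of_real t * w * cnj z)\<^sup>2)"
        using bound(1) z by (intro continuous_intros) auto
    qed simp
    finally show ?thesis using True by (simp add: v_def)
  qed (simp add: v_def)
  have "(\<integral>t. indicator {0..1} t *\<^sub>R (pi * (w * deriv f (of_real t * w))) \<partial>lborel)
      = (LINT z:\<DD>|lborel. deriv f z * (w / (1 - w * cnj z)))"
    using fub unfolding in1 in2 unfolding set_lebesgue_integral_def .
  moreover have "(\<integral>t. indicator {0..1} t *\<^sub>R (pi * (w * deriv f (of_real t * w))) \<partial>lborel)
      = pi * f (of_real 1 * w) - pi * f (of_real 0 * w)"
  proof (rule integral_FTC_atLeastAtMost)
    fix t :: real assume t: "0 \<le> t" "t \<le> 1"
    then have "(f has_field_derivative deriv f (of_real t * w)) (at (of_real t * w))"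
      using tD[of t] by (intro holomorphic_derivI[OF f]) auto
    then have "((\<lambda>x. f (x * w)) has_field_derivative deriv f (of_real t * w) * w) (at (of_real t))"
      by (rule DERIV_chain2) (auto intro!: derivative_eq_intros)
    then have "((\<lambda>x. pi * f (x * w)) has_field_derivative pi * (w * deriv f (of_real t * w))) (at (of_real t))"
      by (auto intro!: derivative_eq_intros)
    then show "((\<lambda>t. pi * f (of_real t * w)) has_vector_derivative pi * (w * deriv f (of_real t * w))) (at t within {0..1})"
      by (rule has_vector_derivative_real_field[THEN has_vector_derivative_at_within])
  next
    have "continuous_on \<DD> (deriv f)" using f' by (rule bergman_functionsD)
    moreover have "continuous_on {0..1::real} (\<lambda>t. of_real t * w)"
      by (intro continuous_intros)
    ultimately have "continuous_on {0..1} (\<lambda>t. deriv f (of_real t * w))"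
      by (rule continuous_on_compose2) (use tD in blast)
    then show "continuous_on {0..1} (\<lambda>t. pi * (w * deriv f (of_real t * w)))"
      by (intro continuous_on_mult continuous_on_const)
  qed simp
  ultimately show ?thesis by (simp add: right_diff_distrib)
qed

context disk_moebius
begin

text \<open>
  The strict version applies to \<open>r * \<psi>\<close> for \<open>r < 1\<close>, whose Krein adjoint is \<open>\<sigma>\<close> evaluated at
  \<open>r * z\<close>.  Both sides then contain a dilation, of \<open>F\<close> on the left and of \<open>(G \<circ> \<sigma>) * \<sigma>'\<close> on the
  right.  Dilations are bounded in norm and converge locally uniformly, hence weakly, as \<open>r\<close> tends
  to 1.  The limit avoids estimating the double integral when \<open>\<psi>\<close> touches the circle, where the kernel is
  unbounded.
\<close>

lemma adjoint_identity:
  assumes F: "F \<in> bergman_functions" and G: "G \<in> bergman_functions"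
  shows "(LINT w:\<DD>|lborel. F (\<psi> w) * deriv \<psi> w * cnj (G w))
       = (LINT z:\<DD>|lborel. F z * cnj (G (\<sigma> z) * deriv \<sigma> z))"
proof -
  interpret s: disk_moebius "cnj a" "- cnj c" "- cnj b" "cnj d" by (rule krein_adjoint)
  let ?r = "\<lambda>n. complex_of_real (dilation_radius n)"
  let ?F = "\<lambda>n w. F (?r n * \<psi> w) * ?r n * deriv \<psi> w"
  let ?G = "\<lambda>z. G (\<sigma> z) * deriv \<sigma> z"
  have W: "?G \<in> bergman_functions"
    by (rule bergman_weighted_composition(1)[OF G s.holomorphic s.inj s.image_subset])
  note WF = bergman_weighted_composition[OF _ holomorphic inj image_subset]
  have eq: "(LINT w:\<DD>|lborel. ?F n w * cnj (G w))
      = cnj (LINT z:\<DD>|lborel. (?G (?r n * z) * ?r n) * cnj (F z))" for n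
  proof -
    interpret r: disk_moebius "?r n * a" "?r n * b" c d
      using dilation_radius[of n] by (intro scaled) auto
    have 1: "r.\<psi> w = ?r n * \<psi> w" for w by (simp add: moebius_def algebra_simps)
    have 2: "deriv r.\<psi> w = ?r n * deriv \<psi> w" if "cmod w < 1" for w
    proof -
      have "deriv r.\<psi> w = (?r n * a * d - ?r n * b * c) / (c * w + d)\<^sup>2" "deriv \<psi> w = (a * d - b * c) / (c * w + d)\<^sup>2"
        using that r.deriv deriv by auto
      then show ?thesis by (simp only:) (simp add: algebra_simps)
    qed
    have 3: "r.\<sigma> z = \<sigma> (?r n * z)" for z by (simp add: moebius_def mult_ac)
    have 4: "deriv r.\<sigma> z = ?r n * deriv \<sigma> (?r n * z)" if z: "cmod z < 1" for z
    proof -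
      interpret rs: disk_moebius "cnj (?r n * a)" "- cnj c" "- cnj (?r n * b)" "cnj d"
        by (rule r.krein_adjoint)
      have "cmod (?r n * z) \<le> 1"
        using z dilation_radius[of n] by (simp add: norm_mult mult_le_one)
      then show ?thesis using z rs.deriv[of z] s.deriv[of "?r n * z"]
        by (simp add: algebra_simps)
    qed
    have "(LINT w:\<DD>|lborel. ?F n w * cnj (G w)) = (LINT w:\<DD>|lborel. F (r.\<psi> w) * deriv r.\<psi> w * cnj (G w))"
      by (rule set_lebesgue_integral_cong) (auto simp: 1 2)
    also have "\<dots> = (LINT z:\<DD>|lborel. F z * cnj (G (r.\<sigma> z) * deriv r.\<sigma> z))"
    proof (rule r.adjoint_identity_strict[OF F G, of "dilation_radius n"])
      show "cmod (r.\<psi> z) \<le> dilation_radius n" if "cmod z < 1" for z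
        unfolding 1 using maps_disk[OF that] dilation_radius[of n] by (simp add: norm_mult mult_left_le)
    qed (rule dilation_radius)
    also have "\<dots> = (LINT z:\<DD>|lborel. cnj ((?G (?r n * z) * ?r n) * cnj (F z)))"
    proof (rule set_lebesgue_integral_cong)
      show "\<forall>z. z \<in> \<DD> \<longrightarrow> F z * cnj (G (r.\<sigma> z) * deriv r.\<sigma> z) = cnj ((?G (?r n * z) * ?r n) * cnj (F z))"
      proof (intro allI impI)
        fix z assume "z \<in> \<DD>"
        then have "cmod z < 1" by simp
        show "F z * cnj (G (r.\<sigma> z) * deriv r.\<sigma> z) = cnj ((?G (?r n * z) * ?r n) * cnj (F z))"
          unfolding 3 4[OF \<open>cmod z < 1\<close>] by simp
      qed
    qed simp
    also have "\<dots> = cnj (LINT z:\<DD>|lborel. (?G (?r n * z) * ?r n) * cnj (F z))"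
      by (rule set_integral_cnj)
    finally show ?thesis .
  qed
  have "(\<lambda>n. LINT z:\<DD>|lborel. (?G (?r n * z) * ?r n) * cnj (F z)) \<longlonglongrightarrow> (LINT z:\<DD>|lborel. ?G z * cnj (F z))"
    by (rule bergman_weak_limit[OF dilation_bergman(1)[OF W] W F dilation_bergman(2)[OF W]])
       (use dilation_uniform_limit[OF bergman_functionsD(3)[OF W]] in
         \<open>auto intro: uniform_limit_on_subset[OF _ ball_subset_cball]\<close>)
  then have "(\<lambda>n. LINT w:\<DD>|lborel. ?F n w * cnj (G w)) \<longlonglongrightarrow> cnj (LINT z:\<DD>|lborel. ?G z * cnj (F z))"
    unfolding eq by (rule tendsto_cnj)
  moreover have "(\<lambda>n. LINT w:\<DD>|lborel. ?F n w * cnj (G w)) \<longlonglongrightarrow> (LINT w:\<DD>|lborel. F (\<psi> w) * deriv \<psi> w * cnj (G w))"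
  proof (rule bergman_weak_limit[OF WF(1)[OF dilation_bergman(1)[OF F]] WF(1)[OF F] G
        order_trans[OF WF(3)[OF dilation_bergman(1)[OF F]] dilation_bergman(2)[OF F]]])
    fix s :: real assume s: "0 < s" "s < 1"
    have sub: "cball 0 s \<subseteq> \<DD>" using s by auto
    have cont: "continuous_on (cball 0 s) \<psi>" "continuous_on (cball 0 s) (deriv \<psi>)"
      using continuous_on_subset[OF _ sub] holomorphic_on_imp_continuous_on holomorphic
        holomorphic_deriv[OF holomorphic] by auto
    have "compact ((\<lambda>z. cmod (\<psi> z)) ` cball 0 s)"
      using cont by (intro compact_continuous_image continuous_intros) auto
    moreover have "(\<lambda>z. cmod (\<psi> z)) ` cball 0 s \<noteq> {}" using s by auto
    ultimately obtain z0 where z0: "z0 \<in> cball 0 s" "\<And>z. z \<in> cball 0 s \<Longrightarrow> cmod (\<psi> z) \<le> cmod (\<psi> z0)"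
      using compact_attains_sup[of "(\<lambda>z. cmod (\<psi> z)) ` cball 0 s"] by auto
    have u: "uniform_limit (cball 0 (cmod (\<psi> z0))) (\<lambda>n z. F (?r n * z) * ?r n) F sequentially"
      using z0(1) sub maps_disk by (intro dilation_uniform_limit bergman_functionsD[OF F]) auto
    have "uniform_limit (cball 0 s) (\<lambda>n w. F (?r n * \<psi> w) * ?r n) (\<lambda>w. F (\<psi> w)) sequentially"
      by (rule uniform_limit_compose'[OF u]) (use z0 in auto)
    then have "uniform_limit (cball 0 s) ?F (\<lambda>w. F (\<psi> w) * deriv \<psi> w) sequentially"
    proof (rule uniform_lim_mult[OF _ uniform_limit_const])
      have "continuous_on (cball 0 s) (\<lambda>w. F (\<psi> w))"
        using sub maps_disk by (intro continuous_on_compose2[OF bergman_functionsD(3)[OF F] cont(1)]) auto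
      then show "bounded ((\<lambda>w. F (\<psi> w)) ` cball 0 s)"
        by (intro compact_imp_bounded compact_continuous_image) auto
      show "bounded (deriv \<psi> ` cball 0 s)"
        using cont by (intro compact_imp_bounded compact_continuous_image) auto
    qed
    then show "uniform_limit (ball 0 s) ?F (\<lambda>w. F (\<psi> w) * deriv \<psi> w) sequentially"
      by (rule uniform_limit_on_subset[OF _ ball_subset_cball])
  qed
  ultimately have "(LINT w:\<DD>|lborel. F (\<psi> w) * deriv \<psi> w * cnj (G w)) = cnj (LINT z:\<DD>|lborel. ?G z * cnj (F z))"
    by (rule LIMSEQ_unique[rotated])
  also have "\<dots> = (LINT z:\<DD>|lborel. cnj (?G z * cnj (F z)))"
    by (rule set_integral_cnj[symmetric])
  also have "\<dots> = (LINT z:\<DD>|lborel. F z * cnj (G (\<sigma> z) * deriv \<sigma> z))"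
    by (simp add: mult_ac)
  finally show ?thesis .
qed

end

section \<open>The Dirichlet space and its reproducing kernel\<close>

lemma dirichlet_fun_holomorphic: "dirichlet_fun f holomorphic_on \<DD>"
  and dirichlet_fun_outside: "z \<notin> \<DD> \<Longrightarrow> dirichlet_fun f z = 0"
  using dirichlet_fun[of f] by (auto simp: dirichlet_functions_def)

lemma deriv_dirichlet_fun_bergman: "deriv (dirichlet_fun f) \<in> bergman_functions"
  using dirichlet_fun[of f] by (auto simp: dirichlet_functions_def bergman_functions_def intro: holomorphic_deriv)

lemma dirichlet_eqI:
  assumes "\<And>z. cmod z < 1 \<Longrightarrow> dirichlet_fun f z = dirichlet_fun g z"
  shows "f = g"
proof -
  have "dirichlet_fun f z = dirichlet_fun g z" for z
    using assms dirichlet_fun_outside by (cases "z \<in> \<DD>") auto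
  then show ?thesis by (metis dirichlet_fun_inject ext)
qed

lemma dirichlet_fun_simps [simp]:
  "dirichlet_fun (f + g) z = dirichlet_fun f z + dirichlet_fun g z"
  "dirichlet_fun (f - g) z = dirichlet_fun f z - dirichlet_fun g z"
  "dirichlet_fun (scale_dirichlet c f) z = c * dirichlet_fun f z"
  "dirichlet_fun (r *\<^sub>R f) z = r *\<^sub>R dirichlet_fun f z"
  "dirichlet_fun 0 z = 0"
  by (simp_all add: plus_dirichlet.rep_eq minus_dirichlet.rep_eq scale_dirichlet.rep_eq
      scaleR_dirichlet.rep_eq zero_dirichlet.rep_eq)

lemma dirichlet_fun_differentiable: "cmod z < 1 \<Longrightarrow> dirichlet_fun f field_differentiable at z"
  using dirichlet_fun_holomorphic[of f] by (auto intro: holomorphic_on_imp_differentiable_at)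

lemma deriv_dirichlet_fun_simps:
  assumes "cmod z < 1"
  shows "deriv (dirichlet_fun (f + g)) z = deriv (dirichlet_fun f) z + deriv (dirichlet_fun g) z"
    "deriv (dirichlet_fun (f - g)) z = deriv (dirichlet_fun f) z - deriv (dirichlet_fun g) z"
    "deriv (dirichlet_fun (scale_dirichlet c f)) z = c * deriv (dirichlet_fun f) z"
  using assms
  by (simp_all add: plus_dirichlet.rep_eq minus_dirichlet.rep_eq scale_dirichlet.rep_eq
      dirichlet_fun_differentiable deriv_add deriv_diff deriv_cmult)

text \<open>
  The values outside the disk are cut off, so that functions given by a formula on the plane can be
  regarded as elements of the Dirichlet space.
\<close>

definition dirichlet_of :: "(complex \<Rightarrow> complex) \<Rightarrow> dirichlet"
  where "dirichlet_of f = Abs_dirichlet (\<lambda>z. if z \<in> \<DD> then f z else 0)"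

lemma deriv_cong_disk:
  assumes "\<And>z. cmod z < 1 \<Longrightarrow> f z = g z" "cmod z < 1"
  shows "deriv f z = deriv g z"
proof (rule deriv_cong_ev)
  have "\<forall>\<^sub>F w in nhds z. w \<in> \<DD>" using assms(2) by (intro eventually_nhds_in_open) auto
  then show "\<forall>\<^sub>F w in nhds z. f w = g w" by eventually_elim (use assms(1) in auto)
qed simp

lemma dirichlet_of:
  assumes f: "f holomorphic_on \<DD>" and f': "deriv f \<in> bergman_functions"
  shows "cmod z < 1 \<Longrightarrow> dirichlet_fun (dirichlet_of f) z = f z"
    and "cmod z < 1 \<Longrightarrow> deriv (dirichlet_fun (dirichlet_of f)) z = deriv f z"
proof -
  let ?f = "\<lambda>z. if z \<in> \<DD> then f z else 0"
  have d: "deriv ?f z = deriv f z" if "cmod z < 1" for z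
    using that by (intro deriv_cong_disk) auto
  have h: "?f holomorphic_on \<DD>"
    using f by (rule holomorphic_transform) simp
  have "set_integrable lborel \<DD> (\<lambda>z. (cmod (deriv ?f z))\<^sup>2) \<longleftrightarrow> set_integrable lborel \<DD> (\<lambda>z. (cmod (deriv f z))\<^sup>2)"
    by (rule set_integrable_cong[OF refl refl]) (subst d, auto)
  then have "?f \<in> dirichlet_functions"
    using h f' by (auto simp: dirichlet_functions_def bergman_functions_def)
  then have eq: "dirichlet_fun (dirichlet_of f) = ?f"
    by (simp add: dirichlet_of_def Abs_dirichlet_inverse)
  show "dirichlet_fun (dirichlet_of f) z = f z" if "cmod z < 1"
    using that by (simp add: eq)
  show "deriv (dirichlet_fun (dirichlet_of f)) z = deriv f z" if "cmod z < 1"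
    unfolding eq by (rule d[OF that])
qed

lemma dirichlet_cinner_eq:
  "dirichlet_cinner f g = dirichlet_fun f 0 * cnj (dirichlet_fun g 0)
     + (1 / pi) *\<^sub>R (LINT z:\<DD>|lborel. deriv (dirichlet_fun f) z * cnj (deriv (dirichlet_fun g) z))"
  by (rule dirichlet_cinner.rep_eq)

lemma dirichlet_cinner_add_right:
  "dirichlet_cinner f (g + h) = dirichlet_cinner f g + dirichlet_cinner f h"
proof -
  have "(LINT z:\<DD>|lborel. deriv (dirichlet_fun f) z * cnj (deriv (dirichlet_fun (g + h)) z))
     = (LINT z:\<DD>|lborel. deriv (dirichlet_fun f) z * cnj (deriv (dirichlet_fun g) z)
          + deriv (dirichlet_fun f) z * cnj (deriv (dirichlet_fun h) z))"
    by (rule set_lebesgue_integral_cong) (auto simp: deriv_dirichlet_fun_simps distrib_left)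
  also have "\<dots> = (LINT z:\<DD>|lborel. deriv (dirichlet_fun f) z * cnj (deriv (dirichlet_fun g) z))
     + (LINT z:\<DD>|lborel. deriv (dirichlet_fun f) z * cnj (deriv (dirichlet_fun h) z))"
    by (intro set_integral_add bergman_product_integrable deriv_dirichlet_fun_bergman)
  finally show ?thesis
    by (simp add: dirichlet_cinner_eq algebra_simps)
qed

lemma dirichlet_cinner_scale:
  "dirichlet_cinner f (scale_dirichlet c g) = cnj c * dirichlet_cinner f g"
  "dirichlet_cinner (scale_dirichlet c f) g = c * dirichlet_cinner f g"
proof -
  have "(LINT z:\<DD>|lborel. deriv (dirichlet_fun f) z * cnj (deriv (dirichlet_fun (scale_dirichlet c g)) z))
     = (LINT z:\<DD>|lborel. cnj c * (deriv (dirichlet_fun f) z * cnj (deriv (dirichlet_fun g) z)))"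
    by (rule set_lebesgue_integral_cong) (auto simp: deriv_dirichlet_fun_simps)
  also have "\<dots> = cnj c * (LINT z:\<DD>|lborel. deriv (dirichlet_fun f) z * cnj (deriv (dirichlet_fun g) z))"
    by (rule set_integral_mult_right)
  finally show "dirichlet_cinner f (scale_dirichlet c g) = cnj c * dirichlet_cinner f g"
    by (simp add: dirichlet_cinner_eq algebra_simps scaleR_conv_of_real)
  have "(LINT z:\<DD>|lborel. deriv (dirichlet_fun (scale_dirichlet c f)) z * cnj (deriv (dirichlet_fun g) z))
     = (LINT z:\<DD>|lborel. c * (deriv (dirichlet_fun f) z * cnj (deriv (dirichlet_fun g) z)))"
    by (rule set_lebesgue_integral_cong) (auto simp: deriv_dirichlet_fun_simps)
  also have "\<dots> = c * (LINT z:\<DD>|lborel. deriv (dirichlet_fun f) z * cnj (deriv (dirichlet_fun g) z))"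
    by (rule set_integral_mult_right)
  finally show "dirichlet_cinner (scale_dirichlet c f) g = c * dirichlet_cinner f g"
    by (simp add: dirichlet_cinner_eq algebra_simps scaleR_conv_of_real)
qed

lemma norm_scale_dirichlet: "norm (scale_dirichlet c f) = cmod c * norm f"
proof -
  have "(norm (scale_dirichlet c f))\<^sup>2 = Re (c * cnj c * dirichlet_cinner f f)"
    by (simp add: dot_square_norm[symmetric] inner_dirichlet_def dirichlet_cinner_scale mult_ac)
  also have "c * cnj c = of_real ((cmod c)\<^sup>2)" by (rule complex_norm_square[symmetric])
  also have "Re (of_real ((cmod c)\<^sup>2) * dirichlet_cinner f f) = (cmod c * norm f)\<^sup>2"
    by (simp add: dot_square_norm[symmetric] inner_dirichlet_def power_mult_distrib del: of_real_power)
  finally show ?thesis by (rule power2_eq_imp_eq) auto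
qed

lemma norm_dirichlet_cinner_le: "cmod (dirichlet_cinner f g) \<le> norm f * norm g"
proof -
  define c where "c = dirichlet_cinner f g"
  \<comment> \<open>A unimodular factor makes the complex inner product real, where the real Cauchy-Schwarz
    inequality applies; for \<open>c = 0\<close> this \<open>u\<close> is 0, which does no harm.\<close>
  define u where "u = cnj (c / of_real (cmod c))"
  have "u * c = of_real (cmod c)"
  proof (cases "c = 0")
    case False
    have "cnj c * c = of_real (cmod c) * of_real (cmod c)"
      using complex_norm_square[of c] by (simp add: power2_eq_square mult.commute)
    then show ?thesis using False by (simp add: u_def)
  qed simp
  then have "cmod (dirichlet_cinner f g) = Re (u * dirichlet_cinner f g)"
    unfolding c_def[symmetric] by simp
  also have "\<dots> = inner (scale_dirichlet u f) g"
    by (simp add: inner_dirichlet_def dirichlet_cinner_scale)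
  also have "\<dots> \<le> norm (scale_dirichlet u f) * norm g" by (rule norm_cauchy_schwarz)
  also have "\<dots> \<le> norm f * norm g"
    by (simp add: norm_scale_dirichlet u_def norm_divide)
  finally show ?thesis .
qed

text \<open>
  The inner product with this function is evaluation at \<open>w\<close>: the constant term 1 reproduces the value
  at 0, and the logarithm has the derivative required by \<open>dirichlet_reproducing\<close>.
\<close>

definition dirichlet_kernel :: "complex \<Rightarrow> dirichlet"
  where "dirichlet_kernel w = dirichlet_of (\<lambda>z. 1 - Ln (1 - cnj w * z))"

lemma dirichlet_kernel_fun:
  assumes w: "cmod w < 1"
  shows "cmod z < 1 \<Longrightarrow> dirichlet_fun (dirichlet_kernel w) z = 1 - Ln (1 - cnj w * z)"
    and "cmod z < 1 \<Longrightarrow> deriv (dirichlet_fun (dirichlet_kernel w)) z = cnj w / (1 - cnj w * z)"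
proof -
  let ?k = "\<lambda>z. 1 - Ln (1 - cnj w * z)"
  have half: "1 - cnj w * z \<notin> \<real>\<^sub>\<le>\<^sub>0" if "cmod z < 1" for z
  proof -
    have "cmod (cnj w * z) < 1"
      using mult_left_le[of "cmod z" "cmod w"] w that by (simp add: norm_mult)
    then have "Re (cnj w * z) < 1" using complex_Re_le_cmod order_le_less_trans by blast
    then show ?thesis by (simp add: complex_nonpos_Reals_iff)
  qed
  have d: "(?k has_field_derivative cnj w / (1 - cnj w * z)) (at z)" if "cmod z < 1" for z
    using half[OF that] by (auto intro!: derivative_eq_intros simp: divide_inverse mult.commute)
  have hol: "?k holomorphic_on \<DD>"
    using half by (auto intro!: holomorphic_intros)
  have "deriv ?k \<in> bergman_functions"
  proof (rule bounded_holomorphic_in_bergman)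
    show "deriv ?k holomorphic_on \<DD>" using hol by (rule holomorphic_deriv) simp
    fix z assume "z \<in> \<DD>"
    then have "cmod (1 / (1 - cnj w * z)) \<le> 1 / (1 - cmod w)"
      using kernel_denominator_bound(2)[of "cnj w" "cmod w" "cnj z"] w by simp
    then have "cmod w * cmod (1 / (1 - cnj w * z)) \<le> 1 * (1 / (1 - cmod w))"
      using w by (intro mult_mono) auto
    then show "cmod (deriv ?k z) \<le> 1 / (1 - cmod w)"
      using DERIV_imp_deriv[OF d[of z]] \<open>z \<in> \<DD>\<close> by (simp add: norm_divide)
  qed
  note k = dirichlet_of[OF hol this, folded dirichlet_kernel_def]
  show "cmod z < 1 \<Longrightarrow> dirichlet_fun (dirichlet_kernel w) z = ?k z" by (rule k)
  show "cmod z < 1 \<Longrightarrow> deriv (dirichlet_fun (dirichlet_kernel w)) z = cnj w / (1 - cnj w * z)"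
    using k(2) DERIV_imp_deriv[OF d] by simp
qed

lemma dirichlet_cinner_kernel:
  assumes w: "cmod w < 1"
  shows "dirichlet_cinner f (dirichlet_kernel w) = dirichlet_fun f w"
proof -
  have "(LINT z:\<DD>|lborel. deriv (dirichlet_fun f) z * cnj (deriv (dirichlet_fun (dirichlet_kernel w)) z))
      = (LINT z:\<DD>|lborel. deriv (dirichlet_fun f) z * (w / (1 - w * cnj z)))"
    by (rule set_lebesgue_integral_cong) (auto simp: dirichlet_kernel_fun(2)[OF w])
  also have "\<dots> = pi * (dirichlet_fun f w - dirichlet_fun f 0)"
    by (rule dirichlet_reproducing[OF dirichlet_fun_holomorphic deriv_dirichlet_fun_bergman w])
  finally show ?thesis
    using dirichlet_kernel_fun(1)[OF w, of 0] by (simp add: dirichlet_cinner_eq scaleR_conv_of_real)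
qed

lemma dirichlet_evaluation_bound:
  "cmod w < 1 \<Longrightarrow> cmod (dirichlet_fun f w) \<le> norm f * norm (dirichlet_kernel w)"
  using norm_dirichlet_cinner_le[of f "dirichlet_kernel w"] by (simp add: dirichlet_cinner_kernel)

section \<open>Composition operators and their adjoints\<close>

lemma composition_operator_fun:
  assumes m: "m holomorphic_on \<DD>" "inj_on m \<DD>" "m ` \<DD> \<subseteq> \<DD>" and z: "cmod z < 1"
  shows "dirichlet_fun (composition_operator m f) z = dirichlet_fun f (m z)"
    and "deriv (dirichlet_fun (composition_operator m f)) z = deriv (dirichlet_fun f) (m z) * deriv m z"
proof -
  let ?h = "\<lambda>z. dirichlet_fun f (m z)"
  have h: "?h holomorphic_on \<DD>"
    using holomorphic_on_compose_gen[OF m(1) dirichlet_fun_holomorphic m(3)] by (simp add: o_def)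
  have d: "deriv ?h z = deriv (dirichlet_fun f) (m z) * deriv m z" if "cmod z < 1" for z
  proof -
    have "m field_differentiable at z" using m(1) that by (auto intro: holomorphic_on_imp_differentiable_at)
    moreover have "dirichlet_fun f field_differentiable at (m z)"
      using m(3) that by (intro dirichlet_fun_differentiable) (auto simp: image_subset_iff)
    ultimately show ?thesis using deriv_chain[of m z "dirichlet_fun f"] by (simp add: o_def)
  qed
  have W: "(\<lambda>z. deriv (dirichlet_fun f) (m z) * deriv m z) \<in> bergman_functions"
    by (rule bergman_weighted_composition(1)[OF deriv_dirichlet_fun_bergman m])
  have "set_integrable lborel \<DD> (\<lambda>z. (cmod (deriv ?h z))\<^sup>2)
     \<longleftrightarrow> set_integrable lborel \<DD> (\<lambda>z. (cmod (deriv (dirichlet_fun f) (m z) * deriv m z))\<^sup>2)"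
    by (rule set_integrable_cong) (simp_all add: d)
  then have "deriv ?h \<in> bergman_functions"
    using W h by (auto simp: bergman_functions_def intro: holomorphic_deriv)
  note c = dirichlet_of[OF h this, of z, OF z]
  have eq: "composition_operator m f = dirichlet_of ?h"
    by (simp add: composition_operator_def dirichlet_of_def)
  show "dirichlet_fun (composition_operator m f) z = ?h z"
    unfolding eq by (rule c)
  show "deriv (dirichlet_fun (composition_operator m f)) z = deriv (dirichlet_fun f) (m z) * deriv m z"
    unfolding eq c(2) by (rule d[OF z])
qed

lemma hilbert_adjoint_eqI:
  assumes "\<And>f g. dirichlet_cinner (T f) g = dirichlet_cinner f (S g)"
  shows "hilbert_adjoint T = S"
  unfolding hilbert_adjoint_def
proof (rule the_equality)
  fix S' assume S': "\<forall>f g. dirichlet_cinner (T f) g = dirichlet_cinner f (S' g)"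
  show "S' = S"
  proof
    fix g
    have "inner (S' g - S g) (S' g) = inner (S' g - S g) (S g)"
      unfolding inner_dirichlet_def using assms S' by metis
    then have "inner (S' g - S g) (S' g - S g) = 0" by (simp add: inner_diff_right)
    then show "S' g = S g" by simp
  qed
qed (use assms in auto)

definition dirichlet_one :: dirichlet
  where "dirichlet_one = dirichlet_of (\<lambda>_. 1)"

lemma dirichlet_one_fun:
  assumes "cmod z < 1"
  shows "dirichlet_fun dirichlet_one z = 1" "deriv (dirichlet_fun dirichlet_one) z = 0"
proof -
  have "deriv (\<lambda>_. 1 :: complex) = (\<lambda>_. 0)" by auto
  then have "deriv (\<lambda>_. 1 :: complex) \<in> bergman_functions"
    using bounded_holomorphic_in_bergman[of "\<lambda>_. 0" 0] by simp
  note d = dirichlet_of[OF _ this, folded dirichlet_one_def]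
  show "dirichlet_fun dirichlet_one z = 1" "deriv (dirichlet_fun dirichlet_one) z = 0"
    using d assms by auto
qed

context disk_moebius
begin

text \<open>
  The first summand accounts for the term \<open>f (\<psi> 0) * cnj (g 0)\<close> of the inner product.  The second
  one vanishes at 0 and takes care of the derivatives, by the adjoint identity.
\<close>

lemma hilbert_adjoint_composition:
  "hilbert_adjoint (composition_operator \<psi>) =
     (\<lambda>g. scale_dirichlet (dirichlet_fun g 0) (dirichlet_kernel (\<psi> 0))
          + (composition_operator \<sigma> g - scale_dirichlet (dirichlet_fun g (\<sigma> 0)) dirichlet_one))"
proof (rule hilbert_adjoint_eqI)
  fix f g
  interpret s: disk_moebius "cnj a" "- cnj c" "- cnj b" "cnj d" by (rule krein_adjoint)
  define h where "h = composition_operator \<sigma> g - scale_dirichlet (dirichlet_fun g (\<sigma> 0)) dirichlet_one"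
  note C = composition_operator_fun[OF holomorphic inj image_subset]
  note S = composition_operator_fun[OF s.holomorphic s.inj s.image_subset]
  have h0: "dirichlet_fun h 0 = 0"
    by (simp add: h_def S dirichlet_one_fun)
  have h': "deriv (dirichlet_fun h) z = deriv (dirichlet_fun g) (\<sigma> z) * deriv \<sigma> z" if "cmod z < 1" for z
    using that by (simp add: h_def deriv_dirichlet_fun_simps S dirichlet_one_fun)
  have "dirichlet_cinner f (scale_dirichlet (dirichlet_fun g 0) (dirichlet_kernel (\<psi> 0)) + h)
      = cnj (dirichlet_fun g 0) * dirichlet_fun f (\<psi> 0) + dirichlet_cinner f h"
    using maps_disk[of 0] by (simp add: dirichlet_cinner_add_right dirichlet_cinner_scale dirichlet_cinner_kernel)
  also have "dirichlet_cinner f h = (1 / pi) *\<^sub>R (LINT z:\<DD>|lborel. deriv (dirichlet_fun f) z * cnj (deriv (dirichlet_fun g) (\<sigma> z) * deriv \<sigma> z))"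
  proof -
    have "(LINT z:\<DD>|lborel. deriv (dirichlet_fun f) z * cnj (deriv (dirichlet_fun h) z))
       = (LINT z:\<DD>|lborel. deriv (dirichlet_fun f) z * cnj (deriv (dirichlet_fun g) (\<sigma> z) * deriv \<sigma> z))"
      by (rule set_lebesgue_integral_cong) (simp_all add: h')
    then show ?thesis by (simp add: dirichlet_cinner_eq h0)
  qed
  also have "(LINT z:\<DD>|lborel. deriv (dirichlet_fun f) z * cnj (deriv (dirichlet_fun g) (\<sigma> z) * deriv \<sigma> z))
      = (LINT w:\<DD>|lborel. deriv (dirichlet_fun f) (\<psi> w) * deriv \<psi> w * cnj (deriv (dirichlet_fun g) w))"
    by (rule adjoint_identity[symmetric]) (rule deriv_dirichlet_fun_bergman)+
  also have "\<dots> = (LINT w:\<DD>|lborel. deriv (dirichlet_fun (composition_operator \<psi> f)) w * cnj (deriv (dirichlet_fun g) w))"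
    by (rule set_lebesgue_integral_cong) (simp_all add: C)
  also have "cnj (dirichlet_fun g 0) * dirichlet_fun f (\<psi> 0) + (1 / pi) *\<^sub>R \<dots> = dirichlet_cinner (composition_operator \<psi> f) g"
    by (simp add: dirichlet_cinner_eq C mult.commute)
  finally show "dirichlet_cinner (composition_operator \<psi> f) g
      = dirichlet_cinner f (scale_dirichlet (dirichlet_fun g 0) (dirichlet_kernel (\<psi> 0))
          + (composition_operator \<sigma> g - scale_dirichlet (dirichlet_fun g (\<sigma> 0)) dirichlet_one))"
    unfolding h_def ..
qed

end

section \<open>Compact operators and the essential norm\<close>

lemma scaleR_dirichlet_eq: "r *\<^sub>R f = scale_dirichlet (of_real r) f"
  by (rule dirichlet_eqI) (simp add: scaleR_conv_of_real)

lemma clinear_dirichlet_linear: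
  assumes "clinear_dirichlet T"
  shows "linear T"
  using assms by (intro linearI) (auto simp: clinear_dirichlet_def scaleR_dirichlet_eq)

lemma bounded_linear_if_bounded_on_cball:
  fixes T :: "'a::real_normed_vector \<Rightarrow> 'b::real_normed_vector"
  assumes T: "linear T" and B: "\<And>f. norm f \<le> 1 \<Longrightarrow> norm (T f) \<le> B"
  shows "bounded_linear T"
proof -
  have "norm (T f) \<le> norm f * B" for f
  proof (cases "f = 0")
    case False
    have "norm (T (f /\<^sub>R norm f)) \<le> B" using False by (intro B) simp
    moreover have "norm (T (f /\<^sub>R norm f)) = norm (T f) / norm f"
      by (simp add: linear_cmul[OF T] divide_inverse mult.commute)
    ultimately show ?thesis using False by (simp add: divide_le_eq mult.commute)
  qed (simp add: linear_0[OF T])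
  then show ?thesis
    using T by (intro bounded_linear_intro[of T B]) (auto simp: linear_add linear_cmul)
qed

lemma compact_operator_bounded_linear:
  assumes "compact_operator K"
  shows "bounded_linear K"
proof -
  have "bounded (K ` cball 0 1)"
    using assms unfolding compact_operator_def
    by (intro bounded_subset[OF compact_imp_bounded closure_subset]) simp
  then obtain B where "\<forall>y\<in>K ` cball 0 1. norm y \<le> B"
    unfolding bounded_iff by blast
  then have "norm (K f) \<le> B" if "norm f \<le> 1" for f
    using that by simp
  then show ?thesis
    using assms clinear_dirichlet_linear unfolding compact_operator_def
    by (intro bounded_linear_if_bounded_on_cball) auto
qed

lemma compact_closureI:
  fixes S T :: "'a::metric_space set"
  assumes "S \<subseteq> T" "compact T"
  shows "compact (closure S)"
proof -
  have "closure S \<subseteq> T" using assms by (intro closure_minimal compact_imp_closed)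
  then have "closure S = T \<inter> closure S" by blast
  then show ?thesis using compact_Int_closed[OF assms(2) closed_closure[of S]] by simp
qed

lemma compact_operator_rank_one:
  assumes w: "cmod w < 1"
  shows "compact_operator (\<lambda>f. scale_dirichlet (dirichlet_fun f w) v)"
  unfolding compact_operator_def
proof
  show "clinear_dirichlet (\<lambda>f. scale_dirichlet (dirichlet_fun f w) v)"
    unfolding clinear_dirichlet_def by (auto intro!: dirichlet_eqI simp: algebra_simps)
  let ?B = "norm (dirichlet_kernel w)"
  have "bounded_linear (\<lambda>c. scale_dirichlet c v)"
    by (rule bounded_linear_intro[of _ "norm v"])
       (auto intro!: dirichlet_eqI simp: algebra_simps norm_scale_dirichlet)
  then have "compact ((\<lambda>c. scale_dirichlet c v) ` cball 0 ?B)"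
    by (intro compact_continuous_image linear_continuous_on) auto
  moreover have "(\<lambda>f. scale_dirichlet (dirichlet_fun f w) v) ` cball 0 1 \<subseteq> (\<lambda>c. scale_dirichlet c v) ` cball 0 ?B"
  proof clarify
    fix f :: dirichlet assume "f \<in> cball 0 1"
    then have "norm f * ?B \<le> 1 * ?B" by (intro mult_right_mono) auto
    then have "dirichlet_fun f w \<in> cball 0 ?B"
      using dirichlet_evaluation_bound[OF w, of f] by simp
    then show "scale_dirichlet (dirichlet_fun f w) v \<in> (\<lambda>c. scale_dirichlet c v) ` cball 0 ?B" by blast
  qed
  ultimately show "compact (closure ((\<lambda>f. scale_dirichlet (dirichlet_fun f w) v) ` cball 0 1))"
    by (rule compact_closureI[rotated])
qed

lemma compact_operator_add:
  assumes K: "compact_operator K" and L: "compact_operator L"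
  shows "compact_operator (\<lambda>f. K f + L f)"
  unfolding compact_operator_def
proof
  have scale_add: "scale_dirichlet c (f + g) = scale_dirichlet c f + scale_dirichlet c g" for c f g
    by (auto intro!: dirichlet_eqI simp: algebra_simps)
  show "clinear_dirichlet (\<lambda>f. K f + L f)"
    using K L by (auto simp: compact_operator_def clinear_dirichlet_def scale_add)
  let ?A = "closure (K ` cball 0 1)" and ?B = "closure (L ` cball 0 1)"
  have "compact {x + y |x y. x \<in> ?A \<and> y \<in> ?B}"
    using K L unfolding compact_operator_def by (intro compact_sums) auto
  moreover have "(\<lambda>f. K f + L f) ` cball 0 1 \<subseteq> {x + y |x y. x \<in> ?A \<and> y \<in> ?B}"
  proof (rule image_subsetI)
    fix f :: dirichlet assume "f \<in> cball 0 1"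
    then have "K f \<in> ?A" "L f \<in> ?B" by (auto intro: closure_subset[THEN subsetD])
    then show "K f + L f \<in> {x + y |x y. x \<in> ?A \<and> y \<in> ?B}" by blast
  qed
  ultimately show "compact (closure ((\<lambda>f. K f + L f) ` cball 0 1))"
    by (rule compact_closureI[rotated])
qed

lemma compact_operator_minus:
  assumes K: "compact_operator K"
  shows "compact_operator (\<lambda>f. - K f)"
  unfolding compact_operator_def
proof
  have m: "- f = scale_dirichlet (-1) f" for f
    by (rule dirichlet_eqI) (simp add: uminus_dirichlet.rep_eq)
  have scale_m: "scale_dirichlet c (- f) = - scale_dirichlet c f" for c f
    unfolding m by (rule dirichlet_eqI) simp
  show "clinear_dirichlet (\<lambda>f. - K f)"
    using K by (auto simp: compact_operator_def clinear_dirichlet_def scale_m)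
  have "compact (uminus ` closure (K ` cball 0 1))"
    using K unfolding compact_operator_def by (intro compact_continuous_image continuous_intros) auto
  moreover have "(\<lambda>f. - K f) ` cball 0 1 \<subseteq> uminus ` closure (K ` cball 0 1)"
    by (auto intro!: imageI closure_subset[THEN subsetD])
  ultimately show "compact (closure ((\<lambda>f. - K f) ` cball 0 1))"
    by (rule compact_closureI[rotated])
qed

lemma compact_operator_diff:
  "compact_operator K \<Longrightarrow> compact_operator L \<Longrightarrow> compact_operator (\<lambda>f. K f - L f)"
  using compact_operator_add[OF _ compact_operator_minus] by simp

lemma compact_closure_if_sequences:
  fixes S :: "'a::metric_space set"
  assumes "\<And>x :: nat \<Rightarrow> 'a. (\<And>n. x n \<in> S) \<Longrightarrow> \<exists>l r. strict_mono (r :: nat \<Rightarrow> nat) \<and> (x \<circ> r) \<longlonglongrightarrow> l"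
  shows "compact (closure S)"
  unfolding compact_eq_seq_compact_metric seq_compact_def
proof (intro allI impI)
  fix y :: "nat \<Rightarrow> 'a" assume y: "\<forall>n. y n \<in> closure S"
  have "\<exists>x\<in>S. dist x (y n) < inverse (real (Suc n))" for n
    using y closure_approachable[of "y n" S] by auto
  then obtain x where x: "\<And>n. x n \<in> S" "\<And>n. dist (x n) (y n) < inverse (real (Suc n))" by metis
  then obtain l r where r: "strict_mono r" "(x \<circ> r) \<longlonglongrightarrow> l" using assms by blast
  have "(\<lambda>n. dist (x n) (y n)) \<longlonglongrightarrow> 0"
    by (rule tendsto_sandwich[OF _ _ tendsto_const LIMSEQ_inverse_real_of_nat])
       (use x(2) in \<open>auto intro!: always_eventually less_imp_le simp del: of_nat_Suc\<close>)
  then have "(\<lambda>n. dist ((x \<circ> r) n) ((y \<circ> r) n)) \<longlonglongrightarrow> 0"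
    using LIMSEQ_subseq_LIMSEQ[OF _ r(1)] by (auto simp: o_def)
  then have lim: "(\<lambda>n. dist ((x \<circ> r) n) l + dist ((x \<circ> r) n) ((y \<circ> r) n)) \<longlonglongrightarrow> 0"
    using tendsto_add[of "\<lambda>n. dist ((x \<circ> r) n) l" 0] r(2) by (simp add: tendsto_dist_iff[of _ l])
  have "dist ((y \<circ> r) n) l \<le> dist ((x \<circ> r) n) l + dist ((x \<circ> r) n) ((y \<circ> r) n)" for n
    using dist_triangle3[of "(y \<circ> r) n" l "(x \<circ> r) n"] by simp
  then have "(\<lambda>n. dist ((y \<circ> r) n) l) \<longlonglongrightarrow> 0"
    by (intro tendsto_sandwich[OF _ _ tendsto_const lim] always_eventually allI) auto
  then have l: "(y \<circ> r) \<longlonglongrightarrow> l" by (simp add: tendsto_dist_iff[of _ l])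
  have "l \<in> closure S"
    by (rule closed_sequentially[OF closed_closure _ l]) (simp add: y)
  with l show "\<exists>l\<in>closure S. \<exists>r. strict_mono r \<and> (y \<circ> r) \<longlonglongrightarrow> l" using r(1) by blast
qed

lemma onorm_diff_nonneg:
  assumes "bounded_linear T" "compact_operator K"
  shows "0 \<le> onorm (\<lambda>f. T f - K f)"
  by (intro onorm_pos_le bounded_linear_sub assms compact_operator_bounded_linear)

lemma compact_operator_zero: "compact_operator (\<lambda>f. 0)"
proof -
  have "(\<lambda>f. 0) = (\<lambda>f. scale_dirichlet (dirichlet_fun f 0) 0)"
    by (auto intro!: dirichlet_eqI)
  then show ?thesis using compact_operator_rank_one[of 0 0] by simp
qed

lemma essential_norm_le:
  assumes T: "bounded_linear T" and K: "compact_operator K"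
    and le: "\<And>f. norm (T f - K f) \<le> C * norm f" and C: "0 \<le> C"
  shows "essential_norm T \<le> C"
  unfolding essential_norm_def
proof (rule cINF_lower2)
  show "bdd_below ((\<lambda>K. onorm (\<lambda>f. T f - K f)) ` {K. compact_operator K})"
    using onorm_diff_nonneg[OF T] by (intro bdd_belowI[of _ 0]) auto
  show "onorm (\<lambda>f. T f - K f) \<le> C"
    using C le by (rule onorm_bound)
qed (use K in auto)

lemma essential_norm_ge:
  assumes "\<And>K. compact_operator K \<Longrightarrow> C \<le> onorm (\<lambda>f. T f - K f)"
  shows "C \<le> essential_norm T"
  unfolding essential_norm_def
  by (rule cINF_greatest) (use assms compact_operator_zero in auto)

lemma essential_norm_compact:
  assumes "compact_operator T"
  shows "essential_norm T = 0"
proof (rule antisym)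
  show "essential_norm T \<le> 0"
    using assms by (intro essential_norm_le[of T T] compact_operator_bounded_linear) auto
  show "0 \<le> essential_norm T"
    using assms compact_operator_bounded_linear onorm_diff_nonneg by (intro essential_norm_ge) auto
qed

text \<open>
  Adding \<open>R\<close> translates the set of compact operators, over which the infimum is taken, onto itself.
\<close>

lemma essential_norm_compact_perturbation:
  assumes R: "compact_operator R"
  shows "essential_norm (\<lambda>f. T f + R f) = essential_norm T"
proof -
  have "(\<lambda>K. onorm (\<lambda>f. T f + R f - K f)) ` {K. compact_operator K}
      = (\<lambda>K. onorm (\<lambda>f. T f - K f)) ` {K. compact_operator K}" (is "?A = ?B")
  proof (intro equalityI subsetI)
    fix x assume "x \<in> ?A"
    then obtain K where K: "compact_operator K" "x = onorm (\<lambda>f. T f + R f - K f)" by auto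
    have "T f + R f - K f = T f - (K f - R f)" for f by simp
    then have "x = onorm (\<lambda>f. T f - (K f - R f))" by (simp only: K(2))
    then show "x \<in> ?B"
      by (rule image_eqI[where x = "\<lambda>f. K f - R f"]) (simp add: compact_operator_diff[OF K(1) R])
  next
    fix x assume "x \<in> ?B"
    then obtain K where K: "compact_operator K" "x = onorm (\<lambda>f. T f - K f)" by auto
    have "T f - K f = T f + R f - (K f + R f)" for f by simp
    then have "x = onorm (\<lambda>f. T f + R f - (K f + R f))" by (simp only: K(2))
    then show "x \<in> ?A"
      by (rule image_eqI[where x = "\<lambda>f. K f + R f"]) (simp add: compact_operator_add[OF K(1) R])
  qed
  then show ?thesis by (simp add: essential_norm_def)
qed

section \<open>Norm bounds for composition operators\<close>

lemma dirichlet_norm_components_le: "(cmod (dirichlet_fun f 0))\<^sup>2 \<le> (norm f)\<^sup>2"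
  "(LINT z:\<DD>|lborel. (cmod (deriv (dirichlet_fun f) z))\<^sup>2) \<le> pi * (norm f)\<^sup>2"
proof -
  have "0 \<le> (LINT z:\<DD>|lborel. (cmod (deriv (dirichlet_fun f) z))\<^sup>2)"
    unfolding set_lebesgue_integral_def by (intro integral_nonneg_AE) auto
  then show "(cmod (dirichlet_fun f 0))\<^sup>2 \<le> (norm f)\<^sup>2"
    by (simp add: norm_dirichlet_square)
  show "(LINT z:\<DD>|lborel. (cmod (deriv (dirichlet_fun f) z))\<^sup>2) \<le> pi * (norm f)\<^sup>2"
    by (simp add: norm_dirichlet_square field_simps)
qed

lemma composition_operator_clinear:
  assumes m: "m holomorphic_on \<DD>" "inj_on m \<DD>" "m ` \<DD> \<subseteq> \<DD>"
  shows "clinear_dirichlet (composition_operator m)"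
  unfolding clinear_dirichlet_def
  by (auto intro!: dirichlet_eqI simp: composition_operator_fun[OF m])

text \<open>
  The constant \<open>f (m 0)\<close> is removed because evaluation at \<open>m 0\<close> can have norm larger than 1; what
  remains is a contraction of energies.
\<close>

lemma composition_operator_centered_contraction:
  assumes m: "m holomorphic_on \<DD>" "inj_on m \<DD>" "m ` \<DD> \<subseteq> \<DD>"
  shows "norm (composition_operator m f - scale_dirichlet (dirichlet_fun f (m 0)) dirichlet_one) \<le> norm f"
proof (rule power2_le_imp_le)
  define h where "h = composition_operator m f - scale_dirichlet (dirichlet_fun f (m 0)) dirichlet_one"
  note C = composition_operator_fun[OF m]
  have 0: "dirichlet_fun h 0 = 0" by (simp add: h_def C dirichlet_one_fun)
  have "(LINT z:\<DD>|lborel. (cmod (deriv (dirichlet_fun h) z))\<^sup>2)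
      = (LINT z:\<DD>|lborel. (cmod (deriv (dirichlet_fun f) (m z) * deriv m z))\<^sup>2)"
    by (rule set_lebesgue_integral_cong) (simp_all add: h_def deriv_dirichlet_fun_simps C dirichlet_one_fun)
  also have "\<dots> \<le> (LINT z:\<DD>|lborel. (cmod (deriv (dirichlet_fun f) z))\<^sup>2)"
    by (rule bergman_weighted_composition(3)[OF deriv_dirichlet_fun_bergman m])
  also have "\<dots> \<le> pi * (norm f)\<^sup>2" by (rule dirichlet_norm_components_le)
  finally have "(norm h)\<^sup>2 \<le> (norm f)\<^sup>2"
    by (simp add: norm_dirichlet_square[of h] 0 field_simps)
  then show "(norm (composition_operator m f - scale_dirichlet (dirichlet_fun f (m 0)) dirichlet_one))\<^sup>2 \<le> (norm f)\<^sup>2"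
    unfolding h_def .
qed simp

lemma composition_operator_bounded_linear:
  assumes m: "m holomorphic_on \<DD>" "inj_on m \<DD>" "m ` \<DD> \<subseteq> \<DD>"
  shows "bounded_linear (composition_operator m)"
proof (rule bounded_linear_if_bounded_on_cball)
  show "linear (composition_operator m)"
    using composition_operator_clinear[OF m] by (rule clinear_dirichlet_linear)
  have m0: "cmod (m 0) < 1" using m(3) by (auto simp: image_subset_iff)
  let ?R = "\<lambda>f. scale_dirichlet (dirichlet_fun f (m 0)) dirichlet_one"
  fix f :: dirichlet assume f: "norm f \<le> 1"
  have "norm (?R f) \<le> (norm f * norm (dirichlet_kernel (m 0))) * norm dirichlet_one"
    unfolding norm_scale_dirichlet using dirichlet_evaluation_bound[OF m0, of f]
    by (rule mult_right_mono) simp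
  also have "\<dots> \<le> (1 * norm (dirichlet_kernel (m 0))) * norm dirichlet_one"
    using f by (intro mult_right_mono) auto
  finally have "norm (?R f) \<le> norm (dirichlet_kernel (m 0)) * norm dirichlet_one" by simp
  moreover have "norm (composition_operator m f) \<le> norm (composition_operator m f - ?R f) + norm (?R f)"
    using norm_triangle_ineq[of "composition_operator m f - ?R f" "?R f"] by simp
  ultimately show "norm (composition_operator m f) \<le> 1 + norm (dirichlet_kernel (m 0)) * norm dirichlet_one"
    using composition_operator_centered_contraction[OF m, of f] f by linarith
qed

lemma essential_norm_composition_le_one:
  assumes m: "m holomorphic_on \<DD>" "inj_on m \<DD>" "m ` \<DD> \<subseteq> \<DD>"
  shows "essential_norm (composition_operator m) \<le> 1"
proof (rule essential_norm_le[OF composition_operator_bounded_linear[OF m] compact_operator_rank_one])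
  show "cmod (m 0) < 1" using m(3) by (auto simp: image_subset_iff)
qed (use composition_operator_centered_contraction[OF m] in auto)

text \<open>
  The Bergman formula bounds \<open>f' w\<close> by a constant, depending on \<open>s\<close>, times the mean of \<open>|f'|\<close>, which
  is at most the mean of \<open>(|f'|\<^sup>2 + 1) / 2\<close>.  This local boundedness is the hypothesis of Montel's theorem.
\<close>

lemma derivative_bound_unit_ball:
  assumes f: "norm f \<le> 1" and w: "cmod w \<le> s" "s < 1"
  shows "cmod (deriv (dirichlet_fun f) w) \<le> (1 / (1 - s))\<^sup>2"
proof -
  let ?F = "deriv (dirichlet_fun f)"
  have F: "?F \<in> bergman_functions" by (rule deriv_dirichlet_fun_bergman)
  have wD: "w \<in> \<DD>" using w by simp
  have s1: "0 < 1 / (1 - s)" using w by simp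
  have K: "cmod (1 / (1 - w * cnj z)) \<le> 1 / (1 - s)" "1 - w * cnj z \<noteq> 0" if "z \<in> \<DD>" for z
    using kernel_denominator_bound[of w s z] w that by auto
  have eq: "(LINT z:\<DD>|lborel. ?F z * (1 / (1 - w * cnj z))\<^sup>2) = pi * ?F w"
    using bergman_reproducing[OF bergman_functionsD(1)[OF F] bergman_integrable[OF F] wD]
    by (simp add: power_divide)
  have K2: "cmod ((1 / (1 - w * cnj z))\<^sup>2) \<le> (1 / (1 - s))\<^sup>2" if "z \<in> \<DD>" for z
    unfolding norm_power using K[OF that] by (intro power_mono) auto
  have i: "set_integrable lborel \<DD> (\<lambda>z. ?F z * (1 / (1 - w * cnj z))\<^sup>2)"
    using K by (intro set_integrable_mult_bounded[OF bergman_integrable[OF F] bergman_functionsD(3)[OF F] _ K2]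
        continuous_intros) auto
  let ?B = "\<lambda>z. (1 / (1 - s))\<^sup>2 * ((1/2) * ((cmod (?F z))\<^sup>2 + 1))"
  have i1: "set_integrable lborel \<DD> (\<lambda>_. 1 :: real)"
    by (rule set_integrable_bounded_continuous[of _ 1]) auto
  have iB: "set_integrable lborel \<DD> ?B"
    by (intro set_integrable_mult_right set_integral_add bergman_functionsD[OF F] i1)
  have "pi * cmod (?F w) = cmod (LINT z:\<DD>|lborel. ?F z * (1 / (1 - w * cnj z))\<^sup>2)"
    unfolding eq by (simp add: norm_mult)
  also have "\<dots> \<le> (LINT z:\<DD>|lborel. cmod (?F z * (1 / (1 - w * cnj z))\<^sup>2))"
    using i by (rule set_integral_norm_bound)
  also have "\<dots> \<le> (LINT z:\<DD>|lborel. ?B z)"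
  proof (rule set_integral_mono)
    fix z assume z: "z \<in> \<DD>"
    have "cmod (?F z) \<le> (1/2) * ((cmod (?F z))\<^sup>2 + 1)"
      using sum_squares_bound[of "cmod (?F z)" 1] by simp
    then have "cmod (?F z) * cmod ((1 / (1 - w * cnj z))\<^sup>2) \<le> ((1/2) * ((cmod (?F z))\<^sup>2 + 1)) * (1 / (1 - s))\<^sup>2"
      using K2[OF z] by (intro mult_mono) auto
    then show "cmod (?F z * (1 / (1 - w * cnj z))\<^sup>2) \<le> ?B z" by (simp only: norm_mult mult.commute)
  qed (intro set_integrable_norm i iB)+
  also have "\<dots> = (1 / (1 - s))\<^sup>2 * ((1/2) * ((LINT z:\<DD>|lborel. (cmod (?F z))\<^sup>2) + pi))"
    using set_integral_const[of \<DD> lborel "1::real"] measure_lborel_ball[of 1 0]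
    by (simp add: set_integral_add(2)[OF bergman_functionsD(2)[OF F] i1] del: times_divide_eq_left)
  also have "\<dots> \<le> (1 / (1 - s))\<^sup>2 * ((1/2) * (pi + pi))"
  proof -
    have "pi * (norm f)\<^sup>2 \<le> pi * 1" using f by (intro mult_left_mono) (auto simp: power_le_one)
    then have "(LINT z:\<DD>|lborel. (cmod (?F z))\<^sup>2) \<le> pi"
      using dirichlet_norm_components_le(2)[of f] by linarith
    then show ?thesis by (intro mult_left_mono) auto
  qed
  finally have "pi * cmod (?F w) \<le> pi * (1 / (1 - s))\<^sup>2" by (simp add: mult.commute)
  then show ?thesis by simp
qed

section \<open>Compactness when the image stays away from the circle\<close>

lemma L2_tendsto_if_uniform:
  fixes u :: "nat \<Rightarrow> complex \<Rightarrow> complex"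
  assumes u: "\<And>n. u n \<in> bergman_functions" and P: "P \<in> bergman_functions"
    and lim: "uniform_limit \<DD> u P sequentially"
  shows "(\<lambda>n. LINT z:\<DD>|lborel. (cmod (u n z - P z))\<^sup>2) \<longlonglongrightarrow> 0"
proof (rule tendstoI)
  fix e :: real assume e: "0 < e"
  define \<delta> where "\<delta> = sqrt (e / (2 * pi))"
  have \<delta>: "0 < \<delta>" "\<delta>\<^sup>2 = e / (2 * pi)" using e by (simp_all add: \<delta>_def)
  have "\<forall>\<^sub>F n in sequentially. \<forall>z\<in>\<DD>. dist (u n z) (P z) < \<delta>"
    using lim \<delta>(1) unfolding uniform_limit_iff by blast
  then show "\<forall>\<^sub>F n in sequentially. dist (LINT z:\<DD>|lborel. (cmod (u n z - P z))\<^sup>2) 0 < e"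
  proof eventually_elim
    case (elim n)
    have "(LINT z:\<DD>|lborel. (cmod (u n z - P z))\<^sup>2) \<le> (LINT z:\<DD>|lborel. \<delta>\<^sup>2)"
    proof (rule set_integral_mono)
      show "set_integrable lborel \<DD> (\<lambda>z. (cmod (u n z - P z))\<^sup>2)"
        using bergman_diff(1)[OF u P] by (rule bergman_functionsD)
      show "set_integrable lborel \<DD> (\<lambda>z. \<delta>\<^sup>2)"
        by (rule set_integrable_bounded_continuous[of _ "\<delta>\<^sup>2"]) auto
      show "(cmod (u n z - P z))\<^sup>2 \<le> \<delta>\<^sup>2" if "z \<in> \<DD>" for z
        using elim that by (intro power_mono) (auto simp: dist_norm less_imp_le)
    qed
    also have "\<dots> = e / 2"
      using set_integral_const[of \<DD> lborel "\<delta>\<^sup>2"] measure_lborel_ball[of 1 0] \<delta>(2) by simp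
    finally have "(LINT z:\<DD>|lborel. (cmod (u n z - P z))\<^sup>2) < e" using e by simp
    moreover have "0 \<le> (LINT z:\<DD>|lborel. (cmod (u n z - P z))\<^sup>2)"
      unfolding set_lebesgue_integral_def by (intro integral_nonneg_AE) auto
    ultimately show ?case by simp
  qed
qed

text \<open>
  The energy of a univalent function is the area of its image, here a disk of known radius.
\<close>

lemma moebius_energy:
  assumes cd: "cmod c < cmod d" and det: "a * d - b * c \<noteq> 0"
  shows "(LINT z:\<DD>|lborel. (cmod (deriv (moebius a b c d) z))\<^sup>2)
       = pi * (cmod (a * d - b * c) / ((cmod d)\<^sup>2 - (cmod c)\<^sup>2))\<^sup>2"
proof -
  let ?m = "moebius a b c d"
  let ?r = "cmod (a * d - b * c) / ((cmod d)\<^sup>2 - (cmod c)\<^sup>2)"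
  obtain p where im: "?m ` \<DD> = ball p ?r" using moebius_image_disk[OF cd det] by blast
  have r: "0 \<le> ?r" using cd by (simp add: power_mono)
  have nz: "c * z + d \<noteq> 0" if "z \<in> \<DD>" for z
    using moebius_denominator_nonzero[OF cd, of z] that by simp
  have mh: "?m holomorphic_on \<DD>" using nz by (rule moebius_holomorphic)
  have mi: "inj_on ?m \<DD>" using nz det by (rule moebius_inj_on)
  have fin: "emeasure lborel (ball p ?r) < \<infinity>" by (rule emeasure_bounded_finite) simp
  have "set_integrable lborel (?m ` \<DD>) (\<lambda>_. 1 :: real)"
    unfolding set_integrable_def im using fin by (simp add: integrable_indicator_iff)
  from holomorphic_change_of_variables_real(2)[OF open_ball mh mi _ this]
  have "(LINT z:\<DD>|lborel. (cmod (deriv ?m z))\<^sup>2) = (LINT z:ball p ?r|lborel. 1)"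
    unfolding im by simp
  also have "\<dots> = pi * ?r\<^sup>2"
    using set_integral_const[of "ball p ?r" lborel "1::real"] fin measure_lborel_ball[OF r, of p] by simp
  finally show ?thesis .
qed

lemma cmod_deriv_moebius_le:
  assumes cd: "cmod c < cmod d" and z: "cmod z \<le> 1"
  shows "cmod (deriv (moebius a b c d) z) \<le> cmod (a * d - b * c) / (cmod d - cmod c)\<^sup>2"
proof -
  have "cmod (c * z) \<le> cmod c" using z by (simp add: norm_mult mult_left_le)
  then have "cmod d - cmod c \<le> cmod (c * z + d)"
    using norm_triangle_ineq2[of d "- (c * z)"] by (simp add: add.commute)
  then have "(cmod d - cmod c)\<^sup>2 \<le> (cmod (c * z + d))\<^sup>2"
    using cd by (intro power_mono) auto
  then show ?thesis
    using cd moebius_denominator_nonzero[OF cd z] by (simp add: deriv_moebius norm_divide norm_power frac_le)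
qed

lemma deriv_moebius_bergman:
  assumes cd: "cmod c < cmod d"
  shows "moebius a b c d holomorphic_on \<DD>" "deriv (moebius a b c d) \<in> bergman_functions"
proof -
  show h: "moebius a b c d holomorphic_on \<DD>"
    using moebius_denominator_nonzero[OF cd] by (intro moebius_holomorphic) simp
  show "deriv (moebius a b c d) \<in> bergman_functions"
    by (rule bounded_holomorphic_in_bergman[OF holomorphic_deriv[OF h open_ball] cmod_deriv_moebius_le[OF cd]]) simp
qed

context disk_moebius
begin

lemma deriv_bounded: "cmod z \<le> 1 \<Longrightarrow> cmod (deriv \<psi> z) \<le> cmod (a * d - b * c) / (cmod d - cmod c)\<^sup>2"
  by (rule cmod_deriv_moebius_le[OF c_less_d])

lemma maps_cball_into_smaller:
  assumes "0 \<le> s" "s \<le> 1" "\<And>z. cmod z \<le> s \<Longrightarrow> cmod (\<psi> z) < 1"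
  obtains s' where "s' < 1" "\<And>z. cmod z \<le> s \<Longrightarrow> cmod (\<psi> z) \<le> s'"
proof -
  have "continuous_on (cball 0 s) \<psi>"
    using denominator_nonzero assms(2)
    by (intro holomorphic_on_imp_continuous_on moebius_holomorphic) auto
  then have "compact ((\<lambda>z. cmod (\<psi> z)) ` cball 0 s)"
    by (intro compact_continuous_image continuous_intros) auto
  moreover have "(\<lambda>z. cmod (\<psi> z)) ` cball 0 s \<noteq> {}" using assms by auto
  ultimately obtain z0 where "z0 \<in> cball 0 s" "\<And>z. z \<in> cball 0 s \<Longrightarrow> cmod (\<psi> z) \<le> cmod (\<psi> z0)"
    using compact_attains_sup[of "(\<lambda>z. cmod (\<psi> z)) ` cball 0 s"] by auto
  then show thesis using assms(3) by (intro that[of "cmod (\<psi> z0)"]) auto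
qed

text \<open>
  For a sequence in the unit ball, Montel's theorem yields a subsequence along which the derivatives
  converge uniformly on the compact image of the closed disk; hence the derivatives of the compositions
  converge uniformly on the whole disk.  The constant terms converge along a further subsequence.
  The limit is obtained as a primitive of the limit of the derivatives.
\<close>

lemma compact_composition_operator:
  assumes strict: "\<And>z. cmod z \<le> 1 \<Longrightarrow> cmod (\<psi> z) < 1"
  shows "compact_operator (composition_operator \<psi>)"
  unfolding compact_operator_def
proof
  note C = composition_operator_fun[OF holomorphic inj image_subset]
  show "clinear_dirichlet (composition_operator \<psi>)"
    by (rule composition_operator_clinear[OF holomorphic inj image_subset])
  obtain s where "s < 1" and "\<And>z. cmod z \<le> 1 \<Longrightarrow> cmod (\<psi> z) \<le> s"
    using maps_cball_into_smaller[of 1] strict by auto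
  then have s: "s < 1" "\<And>z. cmod z < 1 \<Longrightarrow> \<psi> z \<in> cball 0 s"
    by auto
  have sD: "cball 0 s \<subseteq> \<DD>" using s by auto
  have \<psi>0: "cmod (\<psi> 0) < 1" by (rule strict) simp
  show "compact (closure (composition_operator \<psi> ` cball 0 1))"
  proof (rule compact_closure_if_sequences)
    fix x :: "nat \<Rightarrow> dirichlet" assume "\<And>n. x n \<in> composition_operator \<psi> ` cball 0 1"
    then have "\<exists>f. norm f \<le> 1 \<and> x n = composition_operator \<psi> f" for n by (metis imageE mem_cball_0)
    then obtain f where f: "\<And>n. norm (f n) \<le> 1" "\<And>n. x n = composition_operator \<psi> (f n)" by metis
    define F where "F n = deriv (dirichlet_fun (f n))" for n
    have F: "F n \<in> bergman_functions" for n unfolding F_def by (rule deriv_dirichlet_fun_bergman)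
    have bd: "\<exists>B. \<forall>h\<in>range F. \<forall>z\<in>K. cmod (h z) \<le> B" if K: "compact K" "K \<subseteq> \<DD>" for K
    proof (cases "K = {}")
      case False
      then obtain w where w: "w \<in> K" "\<And>z. z \<in> K \<Longrightarrow> cmod z \<le> cmod w"
        using compact_attains_sup[of "cmod ` K"] compact_continuous_image[of K cmod] K
        by (auto intro: continuous_intros)
      have "cmod (F n z) \<le> (1 / (1 - cmod w))\<^sup>2" if "z \<in> K" for n z
        unfolding F_def using w that K(2) by (intro derivative_bound_unit_ball f) auto
      then show ?thesis by blast
    qed auto
    obtain G r where G: "G holomorphic_on \<DD>" and r: "strict_mono (r :: nat \<Rightarrow> nat)"
      and lim: "\<And>K. \<lbrakk>compact K; K \<subseteq> \<DD>\<rbrakk> \<Longrightarrow> uniform_limit K (F \<circ> r) G sequentially"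
    proof (rule Montel[of \<DD> "range F" F])
      show "h holomorphic_on \<DD>" if "h \<in> range F" for h
        using that bergman_functionsD(1)[OF F] by auto
      show "\<exists>B. \<forall>h\<in>range F. \<forall>z\<in>K. cmod (h z) \<le> B" if "compact K" "K \<subseteq> \<DD>" for K
        by (rule bd[OF that])
      fix G r
      assume "G holomorphic_on \<DD>" "strict_mono (r :: nat \<Rightarrow> nat)"
        "\<And>K. \<lbrakk>compact K; K \<subseteq> \<DD>\<rbrakk> \<Longrightarrow> uniform_limit K (F \<circ> r) G sequentially"
      then show thesis by (rule that)
    qed auto
    have fr: "dirichlet_fun (f (r n)) (\<psi> 0) \<in> cball 0 (norm (dirichlet_kernel (\<psi> 0)))" for n
    proof -
      have "norm (f (r n)) * norm (dirichlet_kernel (\<psi> 0)) \<le> 1 * norm (dirichlet_kernel (\<psi> 0))"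
        using f(1) by (rule mult_right_mono) simp
      then show ?thesis using dirichlet_evaluation_bound[OF \<psi>0, of "f (r n)"] by simp
    qed
    obtain k q where q: "strict_mono (q :: nat \<Rightarrow> nat)"
      and k: "((\<lambda>n. dirichlet_fun (f (r n)) (\<psi> 0)) \<circ> q) \<longlonglongrightarrow> k"
    proof (rule seq_compactE[OF compact_imp_seq_compact[OF compact_cball]])
      show "\<forall>n. dirichlet_fun (f (r n)) (\<psi> 0) \<in> cball 0 (norm (dirichlet_kernel (\<psi> 0)))"
        using fr by (rule allI)
      fix k q
      assume "strict_mono (q :: nat \<Rightarrow> nat)" "((\<lambda>n. dirichlet_fun (f (r n)) (\<psi> 0)) \<circ> q) \<longlonglongrightarrow> k"
      then show thesis by (rule that)
    qed
    define P where "P z = G (\<psi> z) * deriv \<psi> z" for z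
    have bG: "bounded (G ` cball 0 s)"
      using G sD by (intro compact_imp_bounded compact_continuous_image
          holomorphic_on_imp_continuous_on[OF holomorphic_on_subset]) auto
    have bGp: "bounded ((\<lambda>z. G (\<psi> z)) ` \<DD>)"
      by (rule bounded_subset[OF bG]) (use s(2) in auto)
    have bd\<psi>: "bounded (deriv \<psi> ` \<DD>)"
      unfolding bounded_iff
      by (rule exI[of _ "cmod (a * d - b * c) / (cmod d - cmod c)\<^sup>2"]) (use deriv_bounded in auto)
    have hP: "P holomorphic_on \<DD>"
      unfolding P_def using holomorphic_on_compose_gen[OF holomorphic G image_subset] holomorphic
      by (auto simp: o_def intro!: holomorphic_intros holomorphic_deriv)
    have "bounded (P ` \<DD>)"
    proof -
      from bGp obtain B1 where B1: "\<forall>y\<in>(\<lambda>z. G (\<psi> z)) ` \<DD>. norm y \<le> B1" unfolding bounded_iff by blast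
      from bd\<psi> obtain B2 where B2: "\<forall>y\<in>deriv \<psi> ` \<DD>. norm y \<le> B2" unfolding bounded_iff by blast
      have "norm (P z) \<le> B1 * B2" if "z \<in> \<DD>" for z
      proof -
        have "norm (G (\<psi> z)) \<le> B1" "norm (deriv \<psi> z) \<le> B2" using B1 B2 that by auto
        moreover have "0 \<le> B1" using calculation(1) norm_ge_zero order_trans by blast
        ultimately show ?thesis unfolding P_def norm_mult by (intro mult_mono) auto
      qed
      then show ?thesis unfolding bounded_iff by blast
    qed
    then have PB: "P \<in> bergman_functions"
      using hP bounded_holomorphic_in_bergman unfolding bounded_iff by blast
    obtain H where H: "\<And>z. z \<in> \<DD> \<Longrightarrow> (H has_field_derivative P z) (at z)"
    proof (rule holomorphic_convex_primitive'[OF convex_ball open_ball hP])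
      fix g assume g: "\<And>z. z \<in> \<DD> \<Longrightarrow> (g has_field_derivative P z) (at z within \<DD>)"
      show thesis
        by (rule that[of g]) (use g at_within_open[OF _ open_ball] in metis)
    qed
    let ?h = "\<lambda>z. H z - H 0 + k"
    have dh: "(?h has_field_derivative P z) (at z)" if "z \<in> \<DD>" for z
      using H[OF that] by (auto intro!: derivative_eq_intros)
    have hh: "?h holomorphic_on \<DD>"
      using dh unfolding holomorphic_on_open[OF open_ball] by blast
    have dPh: "deriv ?h z = P z" if "z \<in> \<DD>" for z using dh[OF that] by (rule DERIV_imp_deriv)
    have "deriv ?h \<in> bergman_functions"
    proof -
      have "set_integrable lborel \<DD> (\<lambda>z. (cmod (deriv ?h z))\<^sup>2) \<longleftrightarrow> set_integrable lborel \<DD> (\<lambda>z. (cmod (P z))\<^sup>2)"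
        by (rule set_integrable_cong[OF refl refl]) (subst dPh, auto)
      then show ?thesis
        using PB hh holomorphic_deriv[OF hh open_ball] unfolding bergman_functions_def by simp
    qed
    note h = dirichlet_of[OF hh this]
    let ?g = "dirichlet_of ?h"
    let ?n = "\<lambda>n. r (q n)"
    have u: "uniform_limit \<DD> (\<lambda>n z. F (?n n) (\<psi> z) * deriv \<psi> z) P sequentially"
      unfolding P_def
    proof (rule uniform_lim_mult[OF _ uniform_limit_const bGp bd\<psi>])
      have "uniform_limit (cball 0 s) (\<lambda>n. (F \<circ> r) (q n)) G sequentially"
        by (rule filterlim_compose[OF lim filterlim_subseq[OF q]]) (use sD in auto)
      then have "uniform_limit \<DD> (\<lambda>n z. (F \<circ> r) (q n) (\<psi> z)) (\<lambda>z. G (\<psi> z)) sequentially"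
        by (rule uniform_limit_compose') (use s(2) in auto)
      then show "uniform_limit \<DD> (\<lambda>n z. F (?n n) (\<psi> z)) (\<lambda>z. G (\<psi> z)) sequentially"
        by (simp add: o_def)
    qed
    have FW: "(\<lambda>z. F (?n n) (\<psi> z) * deriv \<psi> z) \<in> bergman_functions" for n
      by (rule bergman_weighted_composition(1)[OF F holomorphic inj image_subset])
    have I: "(\<lambda>n. LINT z:\<DD>|lborel. (cmod (F (?n n) (\<psi> z) * deriv \<psi> z - P z))\<^sup>2) \<longlonglongrightarrow> 0"
      by (rule L2_tendsto_if_uniform[OF FW PB u])
    have J: "(\<lambda>n. (cmod (dirichlet_fun (f (?n n)) (\<psi> 0) - k))\<^sup>2) \<longlonglongrightarrow> 0"
    proof -
      have "(\<lambda>n. dirichlet_fun (f (?n n)) (\<psi> 0) - k) \<longlonglongrightarrow> 0"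
        using k by (intro LIM_zero) (simp add: o_def)
      from tendsto_power[OF tendsto_norm[OF this], of 2] show ?thesis by simp
    qed
    have nrm: "(norm (x (?n n) - ?g))\<^sup>2 = (cmod (dirichlet_fun (f (?n n)) (\<psi> 0) - k))\<^sup>2
        + (1 / pi) * (LINT z:\<DD>|lborel. (cmod (F (?n n) (\<psi> z) * deriv \<psi> z - P z))\<^sup>2)" for n
    proof -
      have "dirichlet_fun (x (?n n) - ?g) 0 = dirichlet_fun (f (?n n)) (\<psi> 0) - k"
        by (simp add: f C h)
      moreover have "(LINT z:\<DD>|lborel. (cmod (deriv (dirichlet_fun (x (?n n) - ?g)) z))\<^sup>2)
          = (LINT z:\<DD>|lborel. (cmod (F (?n n) (\<psi> z) * deriv \<psi> z - P z))\<^sup>2)"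
        by (rule set_lebesgue_integral_cong)
           (simp_all add: deriv_dirichlet_fun_simps f C h dPh F_def del: deriv_add deriv_diff)
      ultimately show ?thesis by (simp add: norm_dirichlet_square)
    qed
    have "(\<lambda>n. (norm (x (?n n) - ?g))\<^sup>2) \<longlonglongrightarrow> 0"
      unfolding nrm using tendsto_add[OF J tendsto_mult_left[OF I, of "1 / pi"]] by simp
    then have "(\<lambda>n. norm (x (?n n) - ?g)) \<longlonglongrightarrow> 0"
      using tendsto_real_sqrt[of "\<lambda>n. (norm (x (?n n) - ?g))\<^sup>2" 0] by simp
    then have "(\<lambda>n. x (?n n)) \<longlonglongrightarrow> ?g"
      by (simp add: LIM_zero_iff tendsto_norm_zero_iff)
    then have "(x \<circ> (r \<circ> q)) \<longlonglongrightarrow> ?g" by (simp add: o_def)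
    then show "\<exists>l r. strict_mono (r :: nat \<Rightarrow> nat) \<and> (x \<circ> r) \<longlonglongrightarrow> l"
      using strict_mono_o[OF r q] by blast
  qed
qed

end

section \<open>The lower bound at a point of contact with the circle\<close>

lemma one_minus_square_dilation_radius_tendsto: "(\<lambda>n. 1 - (dilation_radius n)\<^sup>2) \<longlonglongrightarrow> 0"
  using tendsto_diff[OF tendsto_const[of 1] tendsto_power[OF dilation_radius_tendsto, of 2]] by simp

text \<open>
  Up to a constant summand this is a disk automorphism composed with a rotation: it is the function
  \<open>(1 - r\<^sup>2) * u / (1 - r * u)\<close> of \<open>u = cnj \<zeta> * z\<close>, normalized to vanish at 0.  Its energy is that of
  the identity, and concentrates at \<open>\<zeta>\<close> as \<open>r\<close> tends to 1.
\<close>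

definition peak_function :: "complex \<Rightarrow> real \<Rightarrow> complex \<Rightarrow> complex"
  where "peak_function \<zeta> r = moebius (of_real (1 - r\<^sup>2) * cnj \<zeta>) 0 (- of_real r * cnj \<zeta>) 1"

context
  fixes \<zeta> :: complex and r :: real
  assumes \<zeta>: "cmod \<zeta> = 1" and r: "0 < r" "r < 1"
begin

lemma peak_coefficients: "cmod (- of_real r * cnj \<zeta>) < cmod 1"
  "of_real (1 - r\<^sup>2) * cnj \<zeta> * 1 - 0 * (- of_real r * cnj \<zeta>) \<noteq> 0"
  "cmod (of_real (1 - r\<^sup>2) * cnj \<zeta> * 1 - 0 * (- of_real r * cnj \<zeta>)) = 1 - r\<^sup>2"
proof -
  have r2: "0 < 1 - r\<^sup>2" using r by (simp add: abs_square_less_1)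
  show "cmod (- of_real r * cnj \<zeta>) < cmod 1" using \<zeta> r by (simp add: norm_mult)
  have "cmod (of_real (1 - r\<^sup>2) * cnj \<zeta> * 1 - 0 * (- of_real r * cnj \<zeta>)) = \<bar>1 - r\<^sup>2\<bar> * cmod \<zeta>"
    by (simp add: norm_mult del: of_real_diff of_real_power)
  then show *: "cmod (of_real (1 - r\<^sup>2) * cnj \<zeta> * 1 - 0 * (- of_real r * cnj \<zeta>)) = 1 - r\<^sup>2"
    using r2 \<zeta> by simp
  then show "of_real (1 - r\<^sup>2) * cnj \<zeta> * 1 - 0 * (- of_real r * cnj \<zeta>) \<noteq> 0"
    using r2 by (metis less_irrefl norm_zero)
qed

lemma peak_holomorphic: "peak_function \<zeta> r holomorphic_on \<DD>" "deriv (peak_function \<zeta> r) \<in> bergman_functions"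
  unfolding peak_function_def by (rule deriv_moebius_bergman[OF peak_coefficients(1)])+

lemma peak_energy: "(LINT z:\<DD>|lborel. (cmod (deriv (peak_function \<zeta> r) z))\<^sup>2) = pi"
proof -
  have "1 - r\<^sup>2 \<noteq> 0" using r by (simp add: power2_eq_1_iff)
  moreover have "(cmod (1::complex))\<^sup>2 - (cmod (- of_real r * cnj \<zeta>))\<^sup>2 = 1 - r\<^sup>2"
    using \<zeta> by (simp add: norm_mult)
  ultimately show ?thesis
    using moebius_energy[OF peak_coefficients(1,2)] unfolding peak_function_def peak_coefficients(3)
    by simp
qed

lemma peak_bounds:
  assumes w: "cmod w \<le> s" "s < 1"
  shows "cmod (peak_function \<zeta> r w) \<le> (1 - r\<^sup>2) / (1 - s)"
    and "cmod (deriv (peak_function \<zeta> r) w) \<le> (1 - r\<^sup>2) / (1 - s)\<^sup>2"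
proof -
  have r2: "0 < 1 - r\<^sup>2" using r by (simp add: abs_square_less_1)
  have "cmod (of_real r * cnj \<zeta> * w) \<le> 1 * s"
    unfolding norm_mult using \<zeta> r w by (intro mult_mono) auto
  then have le: "1 - s \<le> cmod (- of_real r * cnj \<zeta> * w + 1)"
    using norm_triangle_ineq2[of 1 "of_real r * cnj \<zeta> * w"] by (simp add: add.commute)
  have s: "0 < 1 - s" using w by simp
  then have nz: "- of_real r * cnj \<zeta> * w + 1 \<noteq> 0" using le by auto
  have "cmod (of_real (1 - r\<^sup>2) * cnj \<zeta> * w + 0) \<le> 1 - r\<^sup>2"
  proof -
    have "cmod (of_real (1 - r\<^sup>2) * cnj \<zeta> * w + 0) = (1 - r\<^sup>2) * cmod w"
      using \<zeta> r2 by (simp add: norm_mult del: of_real_diff of_real_power)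
    then show ?thesis using r2 w by (simp add: mult_left_le)
  qed
  then show "cmod (peak_function \<zeta> r w) \<le> (1 - r\<^sup>2) / (1 - s)"
    unfolding peak_function_def moebius_def norm_divide using le s r2 by (intro frac_le) auto
  have "(1 - s)\<^sup>2 \<le> (cmod (- of_real r * cnj \<zeta> * w + 1))\<^sup>2" using le s by (intro power_mono) auto
  then show "cmod (deriv (peak_function \<zeta> r) w) \<le> (1 - r\<^sup>2) / (1 - s)\<^sup>2"
    unfolding peak_function_def deriv_moebius[OF nz] norm_divide norm_power peak_coefficients(3)
    using s r2 by (intro frac_le) auto
qed

text \<open>
  As \<open>r\<close> tends to 1 the right-hand side tends to \<open>\<pi>\<close>, the full energy: a disk internally tangent to
  the circle at \<open>\<zeta>\<close> captures in the limit all of the energy of the peak function.  The value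
  follows by parametrizing the tangent disk affinely, since the peak function then becomes another
  linear fractional map, for which the energy is known.
\<close>

lemma peak_energy_tangent_disk:
  assumes \<rho>: "0 < \<rho>" "\<rho> \<le> 1"
  shows "(LINT z:ball (of_real (1 - \<rho>) * \<zeta>) \<rho>|lborel. (cmod (deriv (peak_function \<zeta> r) z))\<^sup>2)
     = pi * ((1 + r) * \<rho> / (1 - r + 2 * r * \<rho>))\<^sup>2"
proof -
  let ?p = "of_real (1 - \<rho>) * \<zeta>"
  let ?A = "moebius (of_real \<rho>) ?p 0 1"
  let ?a = "of_real ((1 - r\<^sup>2) * \<rho>) * cnj \<zeta>" and ?b = "complex_of_real ((1 - r\<^sup>2) * (1 - \<rho>))"
    and ?c = "- of_real (r * \<rho>) * cnj \<zeta>" and ?d = "complex_of_real (1 - r * (1 - \<rho>))"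
  have \<zeta>\<zeta>: "\<zeta> * cnj \<zeta> = 1" using complex_norm_square[of \<zeta>] \<zeta> by simp
  have r2: "0 < 1 - r\<^sup>2" using r by (simp add: abs_square_less_1)
  have im: "?A ` \<DD> = ball ?p \<rho>"
    using moebius_image_disk[of 0 1 "of_real \<rho>" ?p] \<rho> by simp
  have Ah: "?A holomorphic_on \<DD>" by (intro moebius_holomorphic) simp
  have Ai: "inj_on ?A \<DD>" using \<rho> by (intro moebius_inj_on) auto
  have AD: "?A ` \<DD> \<subseteq> \<DD>"
    unfolding im using \<rho> \<zeta> by (subst ball_subset_ball_iff) (simp add: norm_mult del: of_real_diff)
  have cpos: "0 \<le> r * \<rho>" "r * \<rho> < 1 - r * (1 - \<rho>)" using r \<rho> by (auto simp: algebra_simps)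
  have cd: "cmod ?c < cmod ?d"
    using cpos \<zeta> by (simp add: norm_mult del: of_real_diff of_real_mult)
  have det: "?a * ?d - ?b * ?c = of_real ((1 - r\<^sup>2) * \<rho>) * cnj \<zeta>"
    by (simp add: algebra_simps)
  have ndet: "cmod (?a * ?d - ?b * ?c) = (1 - r\<^sup>2) * \<rho>"
    unfolding det using r2 \<rho> \<zeta> by (simp add: norm_mult del: of_real_diff of_real_mult of_real_power)
  have eq: "deriv (peak_function \<zeta> r) (?A z) * deriv ?A z = deriv (moebius ?a ?b ?c ?d) z"
    if "z \<in> \<DD>" for z
  proof -
    have z: "?c * z + ?d \<noteq> 0" using moebius_denominator_nonzero[OF cd, of z] that by simp
    have A: "- of_real r * cnj \<zeta> * ?A z + 1 = ?c * z + ?d"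
    proof -
      have "- of_real r * cnj \<zeta> * ?A z + 1 = ?c * z - of_real r * of_real (1 - \<rho>) * (\<zeta> * cnj \<zeta>) + 1"
        by (simp add: moebius_def algebra_simps)
      then show ?thesis by (simp add: \<zeta>\<zeta>)
    qed
    have "deriv ?A z = of_real \<rho>" by (simp add: deriv_moebius)
    moreover have "deriv (peak_function \<zeta> r) (?A z) = of_real (1 - r\<^sup>2) * cnj \<zeta> / (?c * z + ?d)\<^sup>2"
      using deriv_moebius[of "- of_real r * cnj \<zeta>" "?A z" 1 "of_real (1 - r\<^sup>2) * cnj \<zeta>" 0] z
      unfolding A peak_function_def by simp
    moreover have "deriv (moebius ?a ?b ?c ?d) z = of_real ((1 - r\<^sup>2) * \<rho>) * cnj \<zeta> / (?c * z + ?d)\<^sup>2"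
      unfolding deriv_moebius[OF z] det ..
    ultimately show ?thesis by simp
  qed
  have "(LINT z:ball ?p \<rho>|lborel. (cmod (deriv (peak_function \<zeta> r) z))\<^sup>2)
      = (LINT z:\<DD>|lborel. (cmod (deriv (peak_function \<zeta> r) (?A z) * deriv ?A z))\<^sup>2)"
    by (rule bergman_weighted_composition(2)[OF peak_holomorphic(2) Ah Ai AD, unfolded im, symmetric])
  also have "\<dots> = (LINT z:\<DD>|lborel. (cmod (deriv (moebius ?a ?b ?c ?d) z))\<^sup>2)"
    by (rule set_lebesgue_integral_cong, simp, intro allI impI, simp only: eq)
  also have "\<dots> = pi * ((1 - r\<^sup>2) * \<rho> / ((cmod ?d)\<^sup>2 - (cmod ?c)\<^sup>2))\<^sup>2"
  proof -
    have "?a * ?d - ?b * ?c \<noteq> 0" using ndet r2 \<rho> by (metis less_irrefl mult_pos_pos norm_zero)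
    from moebius_energy[OF cd this] show ?thesis unfolding ndet .
  qed
  also have "(1 - r\<^sup>2) * \<rho> / ((cmod ?d)\<^sup>2 - (cmod ?c)\<^sup>2) = (1 + r) * \<rho> / (1 - r + 2 * r * \<rho>)"
  proof -
    have "cmod ?d = 1 - r * (1 - \<rho>)" "cmod ?c = r * \<rho>"
      using cpos \<zeta> by (simp_all add: norm_mult del: of_real_diff of_real_mult)
    then have 1: "(cmod ?d)\<^sup>2 - (cmod ?c)\<^sup>2 = (1 - r) * (1 - r + 2 * r * \<rho>)"
      by (simp only:) (simp add: power2_eq_square algebra_simps)
    have 2: "(1 - r\<^sup>2) * \<rho> = (1 - r) * ((1 + r) * \<rho>)" by (simp add: power2_eq_square algebra_simps)
    have "1 - r \<noteq> 0" using r by simp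
    then show ?thesis unfolding 1 2 by (rule mult_divide_mult_cancel_left)
  qed
  finally show ?thesis .
qed

end

context disk_moebius
begin

text \<open>
  The image is a disk inside the unit disk whose boundary contains \<open>\<psi> \<eta>\<close>, so its centre lies on the
  radius through \<open>\<psi> \<eta>\<close>.
\<close>

lemma image_tangent_disk:
  assumes \<eta>: "cmod \<eta> = 1" "cmod (\<psi> \<eta>) = 1"
  obtains \<rho> where "0 < \<rho>" "\<rho> \<le> 1" "\<psi> ` \<DD> = ball (of_real (1 - \<rho>) * \<psi> \<eta>) \<rho>"
proof -
  let ?\<zeta> = "\<psi> \<eta>"
  define N where "N = (cmod d)\<^sup>2 - (cmod c)\<^sup>2"
  define p where "p = (b * cnj d - a * cnj c) / of_real N"
  define \<rho> where "\<rho> = cmod (a * d - b * c) / N"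
  have N: "N > 0" unfolding N_def using c_less_d power_strict_mono[of "cmod c" "cmod d" 2] by simp
  have \<rho>: "0 < \<rho>" using det N by (simp add: \<rho>_def)
  have im: "\<psi> ` \<DD> = ball p \<rho>"
    unfolding p_def \<rho>_def N_def by (rule moebius_image_disk[OF c_less_d det])
  have p\<rho>: "cmod p + \<rho> \<le> 1"
    using image_subset \<rho> unfolding im ball_subset_ball_iff by simp
  have "cmod (cnj d * \<eta> + cnj c) = cmod (c * \<eta> + d)"
    by (rule power2_eq_imp_eq) (use cmod_conjugate_pair_diff[of c \<eta> d] \<eta>(1) in auto)
  then have d: "cmod (?\<zeta> - p) = \<rho>"
    using moebius_minus_center[OF c_less_d denominator_nonzero[of \<eta>], of a b] \<eta>(1) N denominator_nonzero[of \<eta>]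
    unfolding p_def \<rho>_def N_def[symmetric] by (simp add: norm_mult norm_divide)
  \<comment> \<open>Rotate the point of contact to 1: then \<open>|1 - x| = \<rho>\<close> and \<open>|x| \<le> 1 - \<rho>\<close> leave only \<open>x = 1 - \<rho>\<close>.\<close>
  define x where "x = p * cnj ?\<zeta>"
  have \<zeta>\<zeta>: "?\<zeta> * cnj ?\<zeta> = 1" using complex_norm_square[of ?\<zeta>] \<eta>(2) by simp
  have "cmod (1 - x) = \<rho>"
  proof -
    have "1 - x = (?\<zeta> - p) * cnj ?\<zeta>" by (simp add: x_def left_diff_distrib \<zeta>\<zeta>)
    then show ?thesis using d \<eta>(2) by (simp add: norm_mult)
  qed
  then have "1 - Re x \<le> \<rho>" using complex_Re_le_cmod[of "1 - x"] by simp
  moreover have "cmod x \<le> 1 - \<rho>" using p\<rho> \<eta>(2) by (simp add: x_def norm_mult)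
  moreover have "Re x \<le> cmod x" by (rule complex_Re_le_cmod)
  ultimately have "Re x = 1 - \<rho>" "cmod x = Re x" by linarith+
  then have "x = of_real (1 - \<rho>)"
    by (simp add: complex_eq_iff) (metis abs_norm_cancel cmod_eq_Re Im_eq_0)
  then have "p = of_real (1 - \<rho>) * ?\<zeta>"
    using \<zeta>\<zeta> by (metis (no_types, lifting) x_def mult.assoc mult.commute mult_1)
  moreover have "\<rho> \<le> 1" using p\<rho> norm_ge_zero[of p] by linarith
  ultimately show thesis using \<rho> im that by blast
qed

text \<open>
  Let \<open>f n\<close> be the peak functions at the point of contact \<open>\<psi> \<eta>\<close>.  They have norm 1, their images
  \<open>T (f n)\<close> under \<open>T = composition_operator \<psi>\<close> have norms with limit inferior at least 1 and tend weakly
  to 0, and \<open>K (f n)\<close> tends to some \<open>y\<close> along a subsequence.  By weak convergence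
  \<open>|T (f n) - y|\<^sup>2\<close> is asymptotically at least \<open>1 + |y|\<^sup>2\<close>, so \<open>T - K\<close> has norm at least 1.
\<close>

lemma essential_norm_ge_one_if_touching:
  assumes \<eta>: "cmod \<eta> = 1" "cmod (\<psi> \<eta>) = 1"
  shows "1 \<le> essential_norm (composition_operator \<psi>)"
proof (rule essential_norm_ge)
  fix K assume K: "compact_operator K"
  let ?\<zeta> = "\<psi> \<eta>" and ?T = "composition_operator \<psi>" and ?r = dilation_radius
  note C = composition_operator_fun[OF holomorphic inj image_subset]
  note peak = peak_holomorphic[OF \<eta>(2) dilation_radius]
  obtain \<rho> where \<rho>: "0 < \<rho>" "\<rho> \<le> 1" "\<psi> ` \<DD> = ball (of_real (1 - \<rho>) * ?\<zeta>) \<rho>"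
    using image_tangent_disk[OF \<eta>] by blast
  define m where "m n = peak_function ?\<zeta> (?r n)" for n
  define f where "f n = dirichlet_of (m n)" for n
  define H where "H n = (\<lambda>z. deriv (m n) (\<psi> z) * deriv \<psi> z)" for n
  \<comment> \<open>\<open>pi * (\<kappa> n)\<^sup>2\<close> is the energy of the \<open>n\<close>-th peak function over the image of \<open>\<psi>\<close>.\<close>
  define \<kappa> where "\<kappa> n = (1 + ?r n) * \<rho> / (1 - ?r n + 2 * ?r n * \<rho>)" for n
  have m: "m n holomorphic_on \<DD>" "deriv (m n) \<in> bergman_functions" for n
    unfolding m_def by (rule peak)+
  note F = dirichlet_of[OF m, folded f_def]
  have norm_f: "norm (f n) = 1" for n
  proof -
    have "(LINT z:\<DD>|lborel. (cmod (deriv (dirichlet_fun (f n)) z))\<^sup>2) = (LINT z:\<DD>|lborel. (cmod (deriv (m n) z))\<^sup>2)"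
      by (rule set_lebesgue_integral_cong) (simp_all add: F)
    also have "\<dots> = pi" unfolding m_def by (rule peak_energy[OF \<eta>(2) dilation_radius])
    finally have "(norm (f n))\<^sup>2 = 1"
      unfolding norm_dirichlet_square by (simp add: F m_def peak_function_def moebius_def)
    then show ?thesis by (simp add: power2_eq_1_iff) (metis norm_ge_zero not_one_le_zero le_minus_one_simps(3))
  qed
  have Tf: "dirichlet_fun (?T (f n)) 0 = m n (\<psi> 0)" for n
    using maps_disk[of 0] by (simp add: C F)
  have dTf: "deriv (dirichlet_fun (?T (f n))) z = H n z" if "cmod z < 1" for n z
    using that maps_disk[OF that] by (simp add: C F H_def)
  have HB: "H n \<in> bergman_functions" for n
    unfolding H_def by (rule bergman_weighted_composition(1)[OF m(2) holomorphic inj image_subset])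
  have HE: "(LINT z:\<DD>|lborel. (cmod (H n z))\<^sup>2) = pi * (\<kappa> n)\<^sup>2" for n
    unfolding H_def \<kappa>_def bergman_weighted_composition(2)[OF m(2) holomorphic inj image_subset] \<rho>(3)
    unfolding m_def by (rule peak_energy_tangent_disk[OF \<eta>(2) dilation_radius \<rho>(1,2)])
  have HM: "(LINT z:\<DD>|lborel. (cmod (H n z))\<^sup>2) \<le> pi" for n
    using bergman_weighted_composition(3)[OF m(2) holomorphic inj image_subset, of n]
      peak_energy[OF \<eta>(2) dilation_radius, of n] by (simp add: H_def m_def)
  have \<kappa>_le: "(\<kappa> n)\<^sup>2 \<le> (norm (?T (f n)))\<^sup>2" for n
  proof -
    have "(LINT z:\<DD>|lborel. (cmod (deriv (dirichlet_fun (?T (f n))) z))\<^sup>2) = pi * (\<kappa> n)\<^sup>2"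
      unfolding HE[symmetric] by (rule set_lebesgue_integral_cong) (simp_all add: dTf)
    then show ?thesis using dirichlet_norm_components_le(2)[of "?T (f n)"] by simp
  qed
  have \<kappa>_lim: "\<kappa> \<longlonglongrightarrow> 1"
  proof -
    have "\<kappa> \<longlonglongrightarrow> (1 + 1) * \<rho> / (1 - 1 + 2 * 1 * \<rho>)"
      unfolding \<kappa>_def [abs_def] using \<rho>(1) by (intro tendsto_intros dilation_radius_tendsto) auto
    then show ?thesis using \<rho>(1) by simp
  qed
  have weak: "(\<lambda>n. inner (?T (f n)) y) \<longlonglongrightarrow> 0" for y
  proof -
    have 1: "(\<lambda>n. m n (\<psi> 0)) \<longlonglongrightarrow> 0"
    proof (rule Lim_null_comparison)
      have "cmod (m n (\<psi> 0)) \<le> (1 - (?r n)\<^sup>2) / (1 - cmod (\<psi> 0))" for n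
        unfolding m_def using maps_disk[of 0] by (intro peak_bounds(1)[OF \<eta>(2) dilation_radius]) auto
      then show "\<forall>\<^sub>F n in sequentially. norm (m n (\<psi> 0)) \<le> (1 - (?r n)\<^sup>2) / (1 - cmod (\<psi> 0))" by simp
      show "(\<lambda>n. (1 - (?r n)\<^sup>2) / (1 - cmod (\<psi> 0))) \<longlonglongrightarrow> 0"
        using tendsto_divide_zero[OF one_minus_square_dilation_radius_tendsto] by simp
    qed
    have 2: "(\<lambda>n. LINT z:\<DD>|lborel. H n z * cnj (deriv (dirichlet_fun y) z)) \<longlonglongrightarrow> 0"
    proof (rule bergman_weak_null[OF HB deriv_dirichlet_fun_bergman HM])
      fix s :: real assume s: "0 < s" "s < 1"
      obtain s' where s': "s' < 1" "\<And>z. cmod z \<le> s \<Longrightarrow> cmod (\<psi> z) \<le> s'"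
        using maps_cball_into_smaller[of s] s maps_disk by auto
      define B where "B = cmod (a * d - b * c) / (cmod d - cmod c)\<^sup>2"
      have lim: "(\<lambda>n. (1 - (?r n)\<^sup>2) / (1 - s')\<^sup>2 * B) \<longlonglongrightarrow> 0"
        using tendsto_mult_left_zero[OF tendsto_divide_zero[OF one_minus_square_dilation_radius_tendsto, of "(1 - s')\<^sup>2"], of B] by simp
      have le: "cmod (H n z) \<le> (1 - (?r n)\<^sup>2) / (1 - s')\<^sup>2 * B" if "z \<in> ball 0 s" for n z
      proof -
        have "cmod (deriv (m n) (\<psi> z)) \<le> (1 - (?r n)\<^sup>2) / (1 - s')\<^sup>2"
          unfolding m_def using that s' by (intro peak_bounds(2)[OF \<eta>(2) dilation_radius]) auto
        moreover have "cmod (deriv \<psi> z) \<le> B" unfolding B_def using that s by (intro deriv_bounded) auto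
        moreover have "0 \<le> (1 - (?r n)\<^sup>2) / (1 - s')\<^sup>2"
          using dilation_radius[of n] by (simp add: power_le_one)
        ultimately show ?thesis unfolding H_def norm_mult by (intro mult_mono) auto
      qed
      show "uniform_limit (ball 0 s) H (\<lambda>_. 0) sequentially"
        unfolding uniform_limit_iff
      proof (intro allI impI)
        fix e :: real assume e: "0 < e"
        have "\<forall>\<^sub>F n in sequentially. (1 - (?r n)\<^sup>2) / (1 - s')\<^sup>2 * B < e"
          using lim e by (rule order_tendstoD(2))
        then show "\<forall>\<^sub>F n in sequentially. \<forall>z\<in>ball 0 s. dist (H n z) 0 < e"
        proof eventually_elim
          case (elim n)
          then show ?case using le_less_trans[OF le[of _ n] elim] by (simp add: dist_norm)
        qed
      qed
    qed
    have "dirichlet_cinner (?T (f n)) y = m n (\<psi> 0) * cnj (dirichlet_fun y 0)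
        + (1 / pi) *\<^sub>R (LINT z:\<DD>|lborel. H n z * cnj (deriv (dirichlet_fun y) z))" for n
    proof -
      have "(LINT z:\<DD>|lborel. deriv (dirichlet_fun (?T (f n))) z * cnj (deriv (dirichlet_fun y) z))
          = (LINT z:\<DD>|lborel. H n z * cnj (deriv (dirichlet_fun y) z))"
        by (rule set_lebesgue_integral_cong) (simp_all add: dTf)
      then show ?thesis by (simp add: dirichlet_cinner_eq Tf)
    qed
    moreover have "(\<lambda>n. m n (\<psi> 0) * cnj (dirichlet_fun y 0)
        + (1 / pi) *\<^sub>R (LINT z:\<DD>|lborel. H n z * cnj (deriv (dirichlet_fun y) z))) \<longlonglongrightarrow> 0 * cnj (dirichlet_fun y 0) + (1 / pi) *\<^sub>R 0"
      by (intro tendsto_intros 1 2)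
    ultimately have "(\<lambda>n. dirichlet_cinner (?T (f n)) y) \<longlonglongrightarrow> 0" by simp
    from tendsto_Re[OF this] show ?thesis by (simp add: inner_dirichlet_def)
  qed
  have bl: "bounded_linear (\<lambda>f. ?T f - K f)"
    by (intro bounded_linear_sub composition_operator_bounded_linear[OF holomorphic inj image_subset]
        compact_operator_bounded_linear K)
  let ?N = "onorm (\<lambda>f. ?T f - K f)"
  have N0: "0 \<le> ?N" using bl by (rule onorm_pos_le)
  obtain y q where q: "strict_mono (q :: nat \<Rightarrow> nat)" and y: "((\<lambda>n. K (f n)) \<circ> q) \<longlonglongrightarrow> y"
  proof (rule seq_compactE[OF compact_imp_seq_compact])
    show "compact (closure (K ` cball 0 1))" using K by (simp add: compact_operator_def)
    show "\<forall>n. K (f n) \<in> closure (K ` cball 0 1)"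
      using norm_f by (auto intro!: closure_subset[THEN subsetD])
    fix y q assume "strict_mono (q :: nat \<Rightarrow> nat)" "((\<lambda>n. K (f n)) \<circ> q) \<longlonglongrightarrow> y"
    then show thesis by (rule that)
  qed
  have le: "(\<kappa> (q n))\<^sup>2 - 2 * inner (?T (f (q n))) y + (norm y)\<^sup>2 \<le> (?N + norm (K (f (q n)) - y))\<^sup>2" for n
  proof -
    have "norm (?T (f (q n)) - y) \<le> norm (?T (f (q n)) - K (f (q n))) + norm (K (f (q n)) - y)"
      using norm_triangle_ineq[of "?T (f (q n)) - K (f (q n))" "K (f (q n)) - y"] by simp
    also have "norm (?T (f (q n)) - K (f (q n))) \<le> ?N"
      using onorm[OF bl, of "f (q n)"] by (simp add: norm_f)
    finally have "(norm (?T (f (q n)) - y))\<^sup>2 \<le> (?N + norm (K (f (q n)) - y))\<^sup>2"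
      by (intro power_mono) auto
    moreover have "(norm (?T (f (q n)) - y))\<^sup>2 = (norm (?T (f (q n))))\<^sup>2 - 2 * inner (?T (f (q n))) y + (norm y)\<^sup>2"
      by (simp add: power2_norm_eq_inner inner_diff_left inner_diff_right inner_commute)
    ultimately show ?thesis using \<kappa>_le[of "q n"] by linarith
  qed
  have "1\<^sup>2 - 2 * 0 + (norm y)\<^sup>2 \<le> (?N + 0)\<^sup>2"
  proof (rule LIMSEQ_le)
    show "(\<lambda>n. (\<kappa> (q n))\<^sup>2 - 2 * inner (?T (f (q n))) y + (norm y)\<^sup>2) \<longlonglongrightarrow> 1\<^sup>2 - 2 * 0 + (norm y)\<^sup>2"
      using LIMSEQ_subseq_LIMSEQ[OF \<kappa>_lim q] LIMSEQ_subseq_LIMSEQ[OF weak[of y] q]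
      by (intro tendsto_intros) (auto simp: o_def)
    have "(\<lambda>n. norm (K (f (q n)) - y)) \<longlonglongrightarrow> 0"
      using y by (simp add: o_def LIM_zero_iff tendsto_norm_zero_iff)
    then show "(\<lambda>n. (?N + norm (K (f (q n)) - y))\<^sup>2) \<longlonglongrightarrow> (?N + 0)\<^sup>2"
      by (intro tendsto_intros)
  qed (use le in auto)
  then have "1 + (norm y)\<^sup>2 \<le> ?N\<^sup>2" by simp
  then have "1\<^sup>2 \<le> ?N\<^sup>2" using zero_le_power2[of "norm y"] unfolding one_power2 by linarith
  then show "1 \<le> ?N" using N0 by (rule power2_le_imp_le)
qed

lemma essential_norm_composition_operator:
  "essential_norm (composition_operator \<psi>) = (if \<psi> ` \<TT> \<inter> \<TT> = {} then 0 else 1)"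
proof (cases "\<psi> ` \<TT> \<inter> \<TT> = {}")
  case True
  have "cmod (\<psi> z) < 1" if "cmod z \<le> 1" for z
  proof (cases "cmod z < 1")
    case False
    then have "cmod z = 1" using that by simp
    then have "\<psi> z \<in> \<psi> ` \<TT>" by simp
    then have "\<psi> z \<notin> \<TT>" using True by blast
    then have "cmod (\<psi> z) \<noteq> 1" by simp
    then show ?thesis using maps_cdisk[OF that] by simp
  qed (rule maps_disk)
  then have "essential_norm (composition_operator \<psi>) = 0"
    by (intro essential_norm_compact compact_composition_operator)
  then show ?thesis using True by simp
next
  case False
  then obtain \<eta> where "\<eta> \<in> \<TT>" "\<psi> \<eta> \<in> \<TT>" by blast
  then have "cmod \<eta> = 1" "cmod (\<psi> \<eta>) = 1" by simp_all
  then have "essential_norm (composition_operator \<psi>) = 1"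
    using essential_norm_ge_one_if_touching[of \<eta>]
      essential_norm_composition_le_one[OF holomorphic inj image_subset] by linarith
  then show ?thesis unfolding if_not_P[OF False] .
qed

end

section \<open>Products of a composition operator and an adjoint\<close>

context disk_moebius
begin

text \<open>
  On the circle the reflection \<open>z \<mapsto> 1 / cnj z\<close> is the identity, so that \<open>\<sigma>\<close> acts there as the inverse
  of \<open>\<psi>\<close> in the sense that \<open>|\<sigma> w| = 1\<close> means that \<open>\<psi> z = w\<close> has a solution on the circle.
\<close>

lemma krein_adjoint_unimodular_iff:
  assumes w: "cmod w = 1"
  shows "cmod (\<sigma> w) = 1 \<longleftrightarrow> w \<in> \<psi> ` \<TT>"
proof -
  interpret s: disk_moebius "cnj a" "- cnj c" "- cnj b" "cnj d" by (rule krein_adjoint)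
  define u where "u = cnj w"
  have wu: "w * u = 1" using complex_norm_square[of w] w by (simp add: u_def)
  have "cnj a * w + - cnj c = cnj (a * u - c)" "- cnj b * w + cnj d = cnj (d - b * u)"
    by (simp_all add: u_def)
  then have n: "cmod (\<sigma> w) = cmod (a * u - c) / cmod (d - b * u)"
    unfolding moebius_def by (simp only: norm_divide complex_mod_cnj)
  have nz: "d - b * u \<noteq> 0"
    using s.denominator_nonzero[of w] w \<open>- cnj b * w + cnj d = cnj (d - b * u)\<close> by auto
  have key: "\<psi> z = w \<longleftrightarrow> z * (a * u - c) = d - b * u" if "cmod z \<le> 1" for z
  proof -
    have "\<psi> z = w \<longleftrightarrow> a * z + b = w * (c * z + d)"
      using denominator_nonzero[OF that] by (simp add: moebius_def divide_eq_eq)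
    also have "\<dots> \<longleftrightarrow> (a * z + b) * u = c * z + d"
      using wu by (metis (no_types, lifting) mult.assoc mult.commute mult_1)
    also have "\<dots> \<longleftrightarrow> z * (a * u - c) = d - b * u" by (auto simp: algebra_simps)
    finally show ?thesis .
  qed
  show ?thesis
  proof
    assume "cmod (\<sigma> w) = 1"
    then have eq: "cmod (a * u - c) = cmod (d - b * u)" using n nz by (simp add: divide_eq_eq)
    then have nz': "a * u - c \<noteq> 0" using nz by auto
    let ?z = "(d - b * u) / (a * u - c)"
    have z: "cmod ?z = 1" using eq nz' nz by (simp add: norm_divide)
    then have "\<psi> ?z = w" using key[of ?z] nz' by simp
    then show "w \<in> \<psi> ` \<TT>" using z by (metis imageI mem_sphere_0)
  next
    assume "w \<in> \<psi> ` \<TT>"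
    then obtain z where z: "cmod z = 1" "\<psi> z = w" by auto
    then have "cmod (z * (a * u - c)) = cmod (d - b * u)" using key[of z] by simp
    then show "cmod (\<sigma> w) = 1" using n nz z by (simp add: norm_mult)
  qed
qed

end

text \<open>
  The coefficients of the composition are the entries of the product of the coefficient matrices.
\<close>

lemma disk_moebius_compose:
  assumes "disk_moebius a b c d" "disk_moebius a' b' c' d'"
  shows "disk_moebius (a' * a + b' * c) (a' * b + b' * d) (c' * a + d' * c) (c' * b + d' * d)"
    and "cmod z \<le> 1 \<Longrightarrow> moebius (a' * a + b' * c) (a' * b + b' * d) (c' * a + d' * c) (c' * b + d' * d) z
           = moebius a' b' c' d' (moebius a b c d z)"
proof -
  interpret p: disk_moebius a b c d by fact
  interpret q: disk_moebius a' b' c' d' by fact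
  have num: "(a' * a + b' * c) * z + (a' * b + b' * d) = (a' * p.\<psi> z + b') * (c * z + d)"
    and den: "(c' * a + d' * c) * z + (c' * b + d' * d) = (c' * p.\<psi> z + d') * (c * z + d)"
    if "cmod z \<le> 1" for z
  proof -
    have "p.\<psi> z * (c * z + d) = a * z + b"
      using p.denominator_nonzero[OF that] by (simp add: moebius_def)
    then show "(a' * a + b' * c) * z + (a' * b + b' * d) = (a' * p.\<psi> z + b') * (c * z + d)"
      "(c' * a + d' * c) * z + (c' * b + d' * d) = (c' * p.\<psi> z + d') * (c * z + d)"
      by (simp_all only: distrib_right mult.assoc) (simp_all add: algebra_simps)
  qed
  show "disk_moebius (a' * a + b' * c) (a' * b + b' * d) (c' * a + d' * c) (c' * b + d' * d)"
  proof
    have "(a' * a + b' * c) * (c' * b + d' * d) - (a' * b + b' * d) * (c' * a + d' * c)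
        = (a' * d' - b' * c') * (a * d - b * c)" by (simp add: algebra_simps)
    then show "(a' * a + b' * c) * (c' * b + d' * d) - (a' * b + b' * d) * (c' * a + d' * c) \<noteq> 0"
      using p.det q.det by simp
    fix z :: complex assume z: "cmod z < 1"
    have "0 < cmod (c * z + d)" using p.denominator_nonzero[of z] z by simp
    then have "cmod (a' * p.\<psi> z + b') * cmod (c * z + d) < cmod (c' * p.\<psi> z + d') * cmod (c * z + d)"
      using q.self_map[OF p.maps_disk[OF z]] by (rule mult_strict_right_mono[rotated])
    then show "cmod ((a' * a + b' * c) * z + (a' * b + b' * d)) < cmod ((c' * a + d' * c) * z + (c' * b + d' * d))"
      using z by (simp only: num den norm_mult less_imp_le)
  qed
  assume z: "cmod z \<le> 1"
  show "moebius (a' * a + b' * c) (a' * b + b' * d) (c' * a + d' * c) (c' * b + d' * d) z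
           = moebius a' b' c' d' (moebius a b c d z)"
    using p.denominator_nonzero[OF z]
    unfolding moebius_def[of "a' * a + b' * c"] num[OF z] den[OF z] moebius_def[of a'] by simp
qed

lemma linear_fractional_self_map_moebius:
  assumes "linear_fractional_self_map \<phi>"
  obtains a b c d where "\<phi> = moebius a b c d" "disk_moebius a b c d"
proof -
  obtain a b c d where *: "a * d - b * c \<noteq> 0" "\<forall>z\<in>\<DD>. c * z + d \<noteq> 0"
    "\<phi> = (\<lambda>z. (a * z + b) / (c * z + d))" "\<phi> ` \<DD> \<subseteq> \<DD>"
    using assms unfolding linear_fractional_self_map_def by blast
  have "disk_moebius a b c d"
  proof
    fix z :: complex assume z: "cmod z < 1"
    then have "c * z + d \<noteq> 0" "cmod (\<phi> z) < 1" using * by (auto simp: image_subset_iff)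
    then show "cmod (a * z + b) < cmod (c * z + d)" by (simp add: *(3) norm_divide divide_less_eq)
  qed fact
  moreover have "\<phi> = moebius a b c d" by (simp add: *(3) moebius_def fun_eq_iff)
  ultimately show thesis by (rule that[rotated])
qed

theorem theorem5p2:
  fixes \<phi> \<psi> :: "complex \<Rightarrow> complex"
  assumes "linear_fractional_self_map \<phi>" and "linear_fractional_self_map \<psi>"
  shows "essential_norm (composition_operator \<phi> \<circ> hilbert_adjoint (composition_operator \<psi>)) =
    (if \<phi> ` \<TT> \<inter> \<psi> ` \<TT> \<inter> \<TT> = {} then 0 else 1)"
proof -
  obtain a b c d where \<phi>: "\<phi> = moebius a b c d" and p: "disk_moebius a b c d"
    using linear_fractional_self_map_moebius[OF assms(1)] .
  obtain a' b' c' d' where \<psi>: "\<psi> = moebius a' b' c' d'" and q: "disk_moebius a' b' c' d'"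
    using linear_fractional_self_map_moebius[OF assms(2)] .
  interpret p: disk_moebius a b c d by (rule p)
  interpret q: disk_moebius a' b' c' d' by (rule q)
  interpret s: disk_moebius "cnj a'" "- cnj c'" "- cnj b'" "cnj d'" by (rule q.krein_adjoint)
  define \<sigma> where "\<sigma> = moebius (cnj a') (- cnj c') (- cnj b') (cnj d')"
  note comp = disk_moebius_compose[OF p q.krein_adjoint]
  interpret t: disk_moebius "cnj a' * a + - cnj c' * c" "cnj a' * b + - cnj c' * d"
    "- cnj b' * a + cnj d' * c" "- cnj b' * b + cnj d' * d" by (rule comp)
  \<comment> \<open>\<open>\<tau> = \<sigma> \<circ> \<phi>\<close> on the closed disk; the formula also fixes its values elsewhere.\<close>
  define \<tau> where "\<tau> = moebius (cnj a' * a + - cnj c' * c) (cnj a' * b + - cnj c' * d)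
    (- cnj b' * a + cnj d' * c) (- cnj b' * b + cnj d' * d)"
  have \<tau>: "\<tau> z = \<sigma> (\<phi> z)" if "cmod z \<le> 1" for z
    unfolding \<tau>_def \<sigma>_def \<phi> by (rule comp(2)[OF that])
  \<comment> \<open>The terms of the product that are not a composition operator have rank at most 2.\<close>
  let ?R = "\<lambda>g. scale_dirichlet (dirichlet_fun g 0) (composition_operator \<phi> (dirichlet_kernel (\<psi> 0)))
      - scale_dirichlet (dirichlet_fun g (\<sigma> 0)) dirichlet_one"
  have "(composition_operator \<phi> \<circ> hilbert_adjoint (composition_operator \<psi>)) g
      = composition_operator \<tau> g + ?R g" for g
  proof (rule dirichlet_eqI)
    fix z :: complex assume z: "cmod z < 1"
    note P = composition_operator_fun(1)[OF p.holomorphic p.inj p.image_subset z, folded \<phi>]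
    have \<phi>z: "cmod (\<phi> z) < 1" unfolding \<phi> by (rule p.maps_disk[OF z])
    note S = composition_operator_fun(1)[OF s.holomorphic s.inj s.image_subset \<phi>z, folded \<sigma>_def]
    note T = composition_operator_fun(1)[OF t.holomorphic t.inj t.image_subset z, folded \<tau>_def]
    show "dirichlet_fun ((composition_operator \<phi> \<circ> hilbert_adjoint (composition_operator \<psi>)) g) z
      = dirichlet_fun (composition_operator \<tau> g + ?R g) z"
      unfolding \<psi> q.hilbert_adjoint_composition unfolding \<sigma>_def[symmetric]
      using z \<phi>z by (simp add: P S T \<tau> dirichlet_one_fun)
  qed
  then have "composition_operator \<phi> \<circ> hilbert_adjoint (composition_operator \<psi>)
      = (\<lambda>g. composition_operator \<tau> g + ?R g)" by (rule ext)
  moreover have "compact_operator ?R"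
    using s.maps_disk[of 0] unfolding \<sigma>_def
    by (intro compact_operator_diff compact_operator_rank_one) auto
  ultimately have "essential_norm (composition_operator \<phi> \<circ> hilbert_adjoint (composition_operator \<psi>))
      = essential_norm (composition_operator \<tau>)"
    by (simp add: essential_norm_compact_perturbation)
  also have "\<dots> = (if \<tau> ` \<TT> \<inter> \<TT> = {} then 0 else 1)"
    unfolding \<tau>_def by (rule t.essential_norm_composition_operator)
  also have "\<tau> ` \<TT> \<inter> \<TT> = {} \<longleftrightarrow> \<phi> ` \<TT> \<inter> \<psi> ` \<TT> \<inter> \<TT> = {}"
  proof -
    have "cmod (\<tau> z) = 1 \<longleftrightarrow> cmod (\<phi> z) = 1 \<and> \<phi> z \<in> \<psi> ` \<TT>" if z: "cmod z = 1" for z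
    proof -
      have le: "cmod (\<phi> z) \<le> 1" unfolding \<phi> using z by (intro p.maps_cdisk) simp
      have "cmod (\<phi> z) = 1" if "cmod (\<sigma> (\<phi> z)) = 1"
        using that le s.maps_disk[of "\<phi> z"] unfolding \<sigma>_def by fastforce
      then show ?thesis
        using q.krein_adjoint_unimodular_iff[of "\<phi> z"] \<tau>[of z] z unfolding \<sigma>_def \<psi> by auto
    qed
    then have "(\<forall>z\<in>\<TT>. \<tau> z \<notin> \<TT>) \<longleftrightarrow> (\<forall>z\<in>\<TT>. \<phi> z \<notin> \<psi> ` \<TT> \<inter> \<TT>)"
      by (intro ball_cong) auto
    then show ?thesis by blast
  qed
  finally show ?thesis .
qed

end
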